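(* Let $n\ge 2$, $a_1,\ldots,a_{n-1}$ positive integers and $\lambda=\sum a_i\omega_i$. For $w\in S_n$, the vertex $T_w$ of $P_\lambda$ is simple if and only if for all $1\le i<j\le n$, the condition $w^{-1}(j)\le i$ implies $w^{-1}(i+1)\le j$. In particular, the number of simple vertices of $P_\lambda$ equals the $(n-1)$-st large Schröder number (indexed so that the $0$-th, $1$-st, $2$-nd large Schröder numbers are $1,2,6$).
   Context: Let $U=\mathbb R^{\binom n2}$ with coordinates $x_{i,j}$, $1\le i<j\le n$. A Dyck path is a sequence $d=((i_1,j_1),\ldots,(i_N,j_N))$ of pairs with $1\le i_k<j_k\le n$, $j_1-i_1=j_N-i_N=1$, and each $(i_{k+1},j_{k+1})$ equal to $(i_k+1,j_k)$ or $(i_k,j_k+1)$. Put $S(x,d)=\sum_{(i,j)\in d}x_{i,j}$ and $M(\lambda,d)=a_{i_1}+a_{i_1+1}+\ldots+a_{i_N}$. The FFLV polytope is $P_\lambda=\{x\in U: x\ge 0,\ S(x,d)\le M(\lambda,d)\ \forall d\}$ and $\Pi_\lambda=P_\lambda\cap\mathbb Z^{\binom n2}$. Let $\alpha_i$ be the simple roots of $\mathfrak{sl}_n$, $\omega_i$ the fundamental weights, $\alpha_{i,j}=\alpha_i+\ldots+\alpha_{j-1}$, $\varepsilon_i=\omega_i-\omega_{i-1}$ ($\omega_0=\omega_n=0$); $S_n$ acts on weights by $w\varepsilon_i=\varepsilon_{w(i)}$. For $T\in\Pi_\lambda$ let $\mu_T=\lambda-\sum_{i<j}T_{i,j}\alpha_{i,j}$;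 for every $w\in S_n$ there is a unique $T_w\in\Pi_\lambda$ with $\mu_{T_w}=w\lambda$, and it is a vertex of $P_\lambda$. A vertex is simple if the tangent cone at it is simplicial and unimodular. *)

theory Defs
  imports
    "HOL-Analysis.Analysis"
    "HOL-Library.Function_Algebras"
    "HOL-Combinatorics.Permutations"
begin

text \<open>
  Pointwise real vector space structure on functions. It makes the library notions
  \<^const>\<open>independent\<close>, \<^const>\<open>convex_cone\<close> and \<^const>\<open>extreme_point_of\<close> available for coordinate
  vectors whose index set depends on a natural number.
\<close>

instantiation "fun" :: (type, scaleR) scaleR
begin

definition "r *\<^sub>R f = (\<lambda>x. r *\<^sub>R f x)"

instance ..

end

lemma scaleR_fun_apply [simp]: "(r *\<^sub>R f) x = r *\<^sub>R f x"
  by (simp add: scaleR_fun_def)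

instance "fun" :: (type, real_vector) real_vector
  by standard (auto simp: fun_eq_iff scaleR_add_right scaleR_add_left)

lemma sum_fun_apply: "(\<Sum>i\<in>I. f i) x = (\<Sum>i\<in>I. f i x)"
  by (induction I rule: infinite_finite_induct) auto

definition idx :: "nat \<Rightarrow> (nat \<times> nat) set" where
  "idx n = {(i, j). 1 \<le> i \<and> i < j \<and> j \<le> n}"

text \<open>
  The space \<open>U\<close> of vectors \<open>(x\<^sub>i\<^sub>,\<^sub>j)\<close> is modelled by the functions on \<^typ>\<open>nat \<times> nat\<close> vanishing
  outside \<^const>\<open>idx\<close>.
\<close>

definition U_space :: "nat \<Rightarrow> (nat \<times> nat \<Rightarrow> real) set" where
  "U_space n = {x. \<forall>p. p \<notin> idx n \<longrightarrow> x p = 0}"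

definition U_lattice :: "nat \<Rightarrow> (nat \<times> nat \<Rightarrow> real) set" where
  "U_lattice n = {x \<in> U_space n. \<forall>p. x p \<in> \<int>}"

definition dyck_path :: "nat \<Rightarrow> (nat \<times> nat) list \<Rightarrow> bool" where
  "dyck_path n d \<longleftrightarrow>
     d \<noteq> [] \<and> set d \<subseteq> idx n \<and>
     snd (hd d) = fst (hd d) + 1 \<and> snd (last d) = fst (last d) + 1 \<and>
     successively (\<lambda>(i, j) q. q = (i + 1, j) \<or> q = (i, j + 1)) d"

definition path_sum :: "(nat \<times> nat \<Rightarrow> real) \<Rightarrow> (nat \<times> nat) list \<Rightarrow> real" where
  "path_sum x d = sum_list (map x d)"

definition path_bound :: "(nat \<Rightarrow> nat) \<Rightarrow> (nat \<times> nat) list \<Rightarrow> nat" where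
  "path_bound a d = (\<Sum>i = fst (hd d)..fst (last d). a i)"

definition FFLV :: "nat \<Rightarrow> (nat \<Rightarrow> nat) \<Rightarrow> (nat \<times> nat \<Rightarrow> real) set" where
  "FFLV n a = {x \<in> U_space n. (\<forall>p \<in> idx n. 0 \<le> x p) \<and>
     (\<forall>d. dyck_path n d \<longrightarrow> path_sum x d \<le> real (path_bound a d))}"

definition FFLV_points :: "nat \<Rightarrow> (nat \<Rightarrow> nat) \<Rightarrow> (nat \<times> nat \<Rightarrow> real) set" where
  "FFLV_points n a = FFLV n a \<inter> U_lattice n"

text \<open>
  A weight of \<open>sl\<^sub>n\<close> is given by its coordinates with respect to the fundamental weights
  \<open>\<omega>\<^sub>1, \<dots>, \<omega>\<^sub>n\<^sub>-\<^sub>1\<close>, i.e. by a function on \<^typ>\<open>nat\<close> vanishing outside \<open>{1..<n}\<close>.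
\<close>

definition fund_weight :: "nat \<Rightarrow> nat \<Rightarrow> (nat \<Rightarrow> real)" where
  "fund_weight n i = (\<lambda>k. if k = i \<and> 1 \<le> i \<and> i < n then 1 else 0)"

definition eps :: "nat \<Rightarrow> nat \<Rightarrow> (nat \<Rightarrow> real)" where
  "eps n i = fund_weight n i - fund_weight n (i - 1)"

text \<open>The rows of the Cartan matrix of type \<open>A\<^sub>n\<^sub>-\<^sub>1\<close>.\<close>

definition simple_root :: "nat \<Rightarrow> nat \<Rightarrow> (nat \<Rightarrow> real)" where
  "simple_root n i = 2 *\<^sub>R fund_weight n i - fund_weight n (i - 1) - fund_weight n (i + 1)"

definition pos_root :: "nat \<Rightarrow> nat \<Rightarrow> nat \<Rightarrow> (nat \<Rightarrow> real)" where
  "pos_root n i j = (\<Sum>k = i..<j. simple_root n k)"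

text \<open>
  The action of a permutation \<open>w\<close>: since \<open>\<omega>\<^sub>i = \<epsilon>\<^sub>1 + \<dots> + \<epsilon>\<^sub>i\<close>, the linear map with
  \<open>\<epsilon>\<^sub>k \<mapsto> \<epsilon>\<^sub>w\<^sub>(\<^sub>k\<^sub>)\<close> sends \<open>\<omega>\<^sub>i\<close> to \<open>\<epsilon>\<^sub>w\<^sub>(\<^sub>1\<^sub>) + \<dots> + \<epsilon>\<^sub>w\<^sub>(\<^sub>i\<^sub>)\<close>; see \<open>weyl_act_eps\<close> below.
\<close>

definition weyl_act :: "nat \<Rightarrow> (nat \<Rightarrow> nat) \<Rightarrow> (nat \<Rightarrow> real) \<Rightarrow> (nat \<Rightarrow> real)" where
  "weyl_act n w \<mu> = (\<Sum>i\<in>{1..<n}. \<mu> i *\<^sub>R (\<Sum>k = 1..i. eps n (w k)))"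

lemma sum_eps: "(\<Sum>k = 1..i. eps n k) = fund_weight n i"
  by (induction i) (auto simp: eps_def fund_weight_def fun_eq_iff)

lemma weyl_act_linear: "linear (weyl_act n w)"
  by (rule linearI)
     (simp_all add: weyl_act_def scaleR_add_left sum.distrib scaleR_sum_right)

lemma weyl_act_fund_weight:
  assumes "i \<le> n" "w permutes {1..n}"
  shows "weyl_act n w (fund_weight n i) = (\<Sum>k = 1..i. eps n (w k))"
proof (cases "i = 0 \<or> i = n")
  case True
  have "(\<Sum>k = 1..n. eps n (w k)) = (\<Sum>k = 1..n. eps n k)"
    by (rule sum.permute[OF assms(2), unfolded o_def, symmetric])
  also have "\<dots> = 0"
    unfolding sum_eps by (simp add: fund_weight_def fun_eq_iff)
  finally have "(\<Sum>k = 1..i. eps n (w k)) = 0"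
    using True by auto
  moreover have "weyl_act n w (fund_weight n i) = 0"
    unfolding weyl_act_def
    by (rule sum.neutral) (use True in \<open>auto simp: fund_weight_def\<close>)
  ultimately show ?thesis by simp
next
  case False
  have "weyl_act n w (fund_weight n i) =
      (\<Sum>j\<in>{1..<n}. if j = i then (\<Sum>k = 1..i. eps n (w k)) else 0)"
    unfolding weyl_act_def
    by (rule sum.cong) (use False assms(1) in \<open>auto simp: fund_weight_def\<close>)
  then show ?thesis
    using False assms(1) by simp
qed

lemma weyl_act_eps:
  assumes "i \<in> {1..n}" "w permutes {1..n}"
  shows "weyl_act n w (eps n i) = eps n (w i)"
proof -
  obtain m where m: "i = Suc m" "m \<le> n" "Suc m \<le> n"
    using assms(1) by (cases i) auto
  have "weyl_act n w (eps n i) =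
      weyl_act n w (fund_weight n (Suc m)) - weyl_act n w (fund_weight n m)"
    using m by (simp add: eps_def linear_diff[OF weyl_act_linear])
  then show ?thesis
    using m weyl_act_fund_weight[OF _ assms(2)] by simp
qed

lemma simple_root_eps: "simple_root n i = eps n i - eps n (i + 1)"
  by (auto simp: simple_root_def eps_def fun_eq_iff)

definition highest_weight :: "nat \<Rightarrow> (nat \<Rightarrow> nat) \<Rightarrow> (nat \<Rightarrow> real)" where
  "highest_weight n a = (\<Sum>i\<in>{1..<n}. real (a i) *\<^sub>R fund_weight n i)"

definition point_weight :: "nat \<Rightarrow> (nat \<Rightarrow> nat) \<Rightarrow> (nat \<times> nat \<Rightarrow> real) \<Rightarrow> (nat \<Rightarrow> real)" where
  "point_weight n a T = highest_weight n a - (\<Sum>(i, j)\<in>idx n. T (i, j) *\<^sub>R pos_root n i j)"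

definition perm_vertex :: "nat \<Rightarrow> (nat \<Rightarrow> nat) \<Rightarrow> (nat \<Rightarrow> nat) \<Rightarrow> (nat \<times> nat \<Rightarrow> real)" where
  "perm_vertex n a w =
     (THE T. T \<in> FFLV_points n a \<and> point_weight n a T = weyl_act n w (highest_weight n a))"

text \<open>The tangent cone is translated so that its apex is the origin.\<close>

definition tangent_cone :: "'a::real_vector set \<Rightarrow> 'a \<Rightarrow> 'a set" where
  "tangent_cone P v = {t *\<^sub>R (x - v) | t x. 0 \<le> t \<and> x \<in> P}"

definition simplicial_cone :: "'a::real_vector set \<Rightarrow> bool" where
  "simplicial_cone C \<longleftrightarrow> (\<exists>B. finite B \<and> independent B \<and> C = convex_cone hull B)"

definition lattice_basis :: "'a::real_vector set \<Rightarrow> 'a set \<Rightarrow> bool" where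
  "lattice_basis L B \<longleftrightarrow>
     finite B \<and> independent B \<and> L = {\<Sum>b\<in>B. real_of_int (c b) *\<^sub>R b | c. True}"

definition unimodular_cone :: "'a::real_vector set \<Rightarrow> 'a set \<Rightarrow> bool" where
  "unimodular_cone L C \<longleftrightarrow> (\<exists>B. lattice_basis L B \<and> C = convex_cone hull B)"

definition simple_vertex :: "nat \<Rightarrow> (nat \<times> nat \<Rightarrow> real) set \<Rightarrow> (nat \<times> nat \<Rightarrow> real) \<Rightarrow> bool" where
  "simple_vertex n P v \<longleftrightarrow>
     v extreme_point_of P \<and>
     simplicial_cone (tangent_cone P v) \<and> unimodular_cone (U_lattice n) (tangent_cone P v)"

fun large_schroeder :: "nat \<Rightarrow> nat" where
  "large_schroeder 0 = 1"
| "large_schroeder (Suc n) =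
     large_schroeder n + (\<Sum>k\<le>n. large_schroeder k * large_schroeder (n - k))"

lemma large_schroeder_small:
  "large_schroeder 0 = 1" "large_schroeder 1 = 2" "large_schroeder 2 = 6" "large_schroeder 3 = 22"
  by (simp_all add: eval_nat_numeral)

end

theory Submission
  imports Defs
begin

text \<open>
  Call the Dyck path that runs along row \<open>i\<close> and then down column \<open>j\<close> the hook at \<open>(i, j)\<close>.
  A point \<open>x\<close> of the polytope is a simple vertex iff the tight Dyck paths at \<open>x\<close> are exactly the
  hooks at the support of \<open>x\<close>. If they are, the tight constraints form a system that is triangular
  with respect to \<open>j - i\<close> and has diagonal entries \<open>1\<close> and \<open>-1\<close>. Conversely, no tight constraint is
  a nonnegative combination of the other ones, so at a simple vertex they are linearly independent;
  hence tight paths do not turn at zeros of \<open>x\<close>, and a perturbation argument on the graph of tight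
  edges shows that the hook at every point of the support is tight.

  The point \<open>T\<^sub>w\<close> is the sum over \<open>k\<close> of \<open>a\<^sub>k\<close> times the indicator of the nested matching of
  \<open>{1..k} - w{1..k}\<close> with \<open>w{1..k} - {1..k}\<close>. Covering by the hooks at this matching shows that it
  is the only point of the polytope of its weight, and comparing consecutive matchings shows that
  all its tight paths are hooks iff there are no \<open>m < j\<close> with \<open>w\<inverse>(j) < m\<close> and \<open>j < w\<inverse>(m)\<close>.
  Following tight edges from hook to hook shows that every simple vertex has an extremal weight.
  Finally, splitting such a permutation at the preimage of the maximum gives the recursion of the
  large Schroeder numbers.
\<close>

section \<open>Lattice paths and hooks\<close>

text \<open>A tangent cone does not see a tight inequality that is implied by other tight ones, so
  its shape alone need not control all tight constraints. Positivity of the \<open>a i\<close> makes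
  every tight constraint irredundant; at a simple vertex the tight functionals then correspond one
  to one to the generators of the cone, and any linear relation among them is a contradiction. The
  main device for producing new tight paths is to exchange the tails of two tight paths at a common
  point. It works because the bound of a path is a contribution of its source minus a contribution
  of its sink. The final count concerns all vertices of the polytope, not only the points of
  permutations, hence the separate argument that a simple vertex has extremal weight. Throughout,
  \<open>v\<close> stands for the inverse of \<open>w\<close>: the point of \<open>w\<close> is
  recognised by the weight coordinates \<open>lam n a (v m)\<close>, and strict decrease of
  \<open>lam\<close> recovers \<open>v\<close> from them.\<close>

definition lstep :: "nat \<times> nat \<Rightarrow> nat \<times> nat \<Rightarrow> bool" where
  "lstep q p \<longleftrightarrow> p = (fst q + 1, snd q) \<or> p = (fst q, snd q + 1)"

definition src :: "(nat \<times> nat) list \<Rightarrow> nat" where "src d = fst (hd d)"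
definition snk :: "(nat \<times> nat) list \<Rightarrow> nat" where "snk d = snd (last d)"

text \<open>
  The coordinates of the highest weight as a partition, normalised by \<open>\<lambda>\<^sub>n = 0\<close>; the bound of a Dyck
  path is the difference of two of them.
\<close>

definition lam :: "nat \<Rightarrow> (nat \<Rightarrow> nat) \<Rightarrow> nat \<Rightarrow> real" where
  "lam n a i = (\<Sum>k=i..<n. real (a k))"

lemma idx_iff [simp]: "(i, j) \<in> idx n \<longleftrightarrow> 1 \<le> i \<and> i < j \<and> j \<le> n"
  by (simp add: idx_def)

lemma finite_idx [simp]: "finite (idx n)"
  by (rule finite_subset[of _ "{1..n} \<times> {1..n}"]) (auto simp: idx_def)

lemma dyck_path_iff:
  "dyck_path n d \<longleftrightarrow> d \<noteq> [] \<and> set d \<subseteq> idx n \<and> snd (hd d) = fst (hd d) + 1 \<and>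
     snd (last d) = fst (last d) + 1 \<and> successively lstep d"
proof -
  have "(\<lambda>(i, j) q. q = (i + 1, j) \<or> q = (i, j + 1)) = lstep"
    by (auto simp: fun_eq_iff lstep_def)
  then show ?thesis by (simp add: dyck_path_def)
qed

text \<open>The strict growth of the coordinate sum makes the relation irreflexive as well as
  transitive, so that distinctness and comparability of the points of a path can both be read
  off.\<close>

lemma lattice_path_sorted:
  assumes "successively lstep d"
  shows "sorted_wrt (\<lambda>p q. fst p \<le> fst q \<and> snd p \<le> snd q \<and> fst p + snd p < fst q + snd q) d"
proof -
  let ?R = "\<lambda>p q :: nat \<times> nat. fst p \<le> fst q \<and> snd p \<le> snd q \<and> fst p + snd p < fst q + snd q"
  have "successively ?R d"
    by (rule successively_mono[OF assms]) (auto simp: lstep_def)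
  moreover have "transp ?R"
    by (auto intro!: transpI)
  ultimately show ?thesis
    by (simp add: successively_conv_sorted_wrt)
qed

lemma lattice_path_distinct: "successively lstep d \<Longrightarrow> distinct d"
  by (drule lattice_path_sorted) (auto simp: sorted_wrt_iff_nth_less distinct_conv_nth,
      metis less_irrefl nat_neq_iff)

lemma lattice_path_chain:
  assumes "successively lstep d" "p \<in> set d" "q \<in> set d"
  shows "fst p \<le> fst q \<and> snd p \<le> snd q \<or> fst q \<le> fst p \<and> snd q \<le> snd p"
proof -
  obtain k l where kl: "k < length d" "l < length d" "p = d ! k" "q = d ! l"
    using assms(2,3) by (metis in_set_conv_nth)
  then show ?thesis
    using lattice_path_sorted[OF assms(1)] unfolding sorted_wrt_iff_nth_less
    by (metis linorder_neqE_nat order_refl)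
qed

lemma lattice_path_hd_le:
  assumes "successively lstep d" "p \<in> set d"
  shows "fst (hd d) \<le> fst p" "snd (hd d) \<le> snd p"
  using lattice_path_sorted[OF assms(1)] assms(2) by (cases d; auto)+

lemma lattice_path_le_last:
  assumes "successively lstep d" "p \<in> set d"
  shows "fst p \<le> fst (last d)" "snd p \<le> snd (last d)"
  using lattice_path_sorted[OF assms(1)] assms(2)
  by (cases d rule: rev_cases; auto simp: sorted_wrt_append)+

lemma lattice_path_length:
  assumes "successively lstep d" "d \<noteq> []"
  shows "fst (last d) + snd (last d) + 1 = fst (hd d) + snd (hd d) + length d"
  using assms
proof (induction d)
  case (Cons p d)
  then show ?case
    by (cases d) (auto simp: lstep_def)
qed simp

text \<open>Discrete intermediate values: the row changes by at most one per step, so row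
  \<open>r\<close> is left by a downward step.\<close>

lemma lattice_path_crosses_row:
  assumes "successively lstep d" "d \<noteq> []" "fst (hd d) \<le> r" "r < fst (last d)"
  shows "\<exists>j. (r, j) \<in> set d \<and> (r + 1, j) \<in> set d"
  using assms
proof (induction d)
  case (Cons p d)
  show ?case
  proof (cases d)
    case (Cons q e)
    have st: "lstep p q" using Cons.prems(1) \<open>d = q # e\<close> by simp
    show ?thesis
    proof (cases "fst q \<le> r")
      case True
      then show ?thesis using Cons.IH Cons.prems \<open>d = q # e\<close> by auto
    next
      case False
      then have "p = (r, snd p)" "q = (r + 1, snd p)"
        using st Cons.prems(3) by (auto simp: lstep_def prod_eq_iff)
      then show ?thesis using \<open>d = q # e\<close> by (metis list.set_intros(1,2))
    qed
  qed (use Cons.prems in auto)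
qed simp

lemma lattice_path_crosses_column:
  assumes "successively lstep d" "d \<noteq> []" "snd (hd d) \<le> c" "c < snd (last d)"
  shows "\<exists>i. (i, c) \<in> set d \<and> (i, c + 1) \<in> set d"
  using assms
proof (induction d)
  case (Cons p d)
  show ?case
  proof (cases d)
    case (Cons q e)
    have st: "lstep p q" using Cons.prems(1) \<open>d = q # e\<close> by simp
    show ?thesis
    proof (cases "snd q \<le> c")
      case True
      then show ?thesis using Cons.IH Cons.prems \<open>d = q # e\<close> by auto
    next
      case False
      then have "p = (fst p, c)" "q = (fst p, c + 1)"
        using st Cons.prems(3) by (auto simp: lstep_def prod_eq_iff)
      then show ?thesis using \<open>d = q # e\<close> by (metis list.set_intros(1,2))
    qed
  qed (use Cons.prems in auto)
qed simp

lemma dyck_path_elem: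
  assumes "dyck_path n d" "(i, j) \<in> set d"
  shows "src d \<le> i" "1 \<le> i" "i < j" "j \<le> snk d" "j \<le> n"
  using assms lattice_path_hd_le[of d "(i, j)"] lattice_path_le_last[of d "(i, j)"]
  by (auto simp: dyck_path_iff src_def snk_def)

lemma dyck_path_ends:
  assumes "dyck_path n d"
  shows "1 \<le> src d" "src d < snk d" "snk d \<le> n"
    "hd d = (src d, src d + 1)" "last d = (snk d - 1, snk d)"
    "(src d, src d + 1) \<in> set d" "(snk d - 1, snk d) \<in> set d"
proof -
  have ne: "d \<noteq> []" and hd: "snd (hd d) = fst (hd d) + 1" and la: "snd (last d) = fst (last d) + 1"
    using assms by (auto simp: dyck_path_iff)
  show h: "hd d = (src d, src d + 1)"
    using hd by (simp add: src_def prod_eq_iff)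
  show l: "last d = (snk d - 1, snk d)"
    using la by (simp add: snk_def prod_eq_iff)
  show hi: "(src d, src d + 1) \<in> set d" using h ne by (metis hd_in_set)
  show li: "(snk d - 1, snk d) \<in> set d" using l ne by (metis last_in_set)
  show "1 \<le> src d" using dyck_path_elem(2)[OF assms hi] .
  show "src d < snk d" using dyck_path_elem(4)[OF assms hi] by simp
  show "snk d \<le> n" using dyck_path_elem(5)[OF assms li] .
qed

lemma path_bound_eq_lam:
  assumes "dyck_path n d"
  shows "real (path_bound a d) = lam n a (src d) - lam n a (snk d)"
proof -
  have "{src d..fst (last d)} = {src d..<snk d}"
    using dyck_path_ends[OF assms] by auto
  then have "real (path_bound a d) = (\<Sum>k=src d..<snk d. real (a k))"
    by (simp add: path_bound_def src_def)
  moreover have "lam n a (src d) = (\<Sum>k=src d..<snk d. real (a k)) + lam n a (snk d)"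
    unfolding lam_def using dyck_path_ends[OF assms]
    by (intro sum.atLeastLessThan_concat[symmetric]) auto
  ultimately show ?thesis by simp
qed

lemma path_sum_eq_sum:
  "dyck_path n d \<Longrightarrow> path_sum x d = sum x (set d)"
  by (simp add: path_sum_def dyck_path_iff lattice_path_distinct sum_list_distinct_conv_sum_set)

lemma finite_dyck_paths: "finite {d. dyck_path n d}"
  by (rule finite_subset[OF _ finite_subset_distinct[OF finite_idx[of n]]])
     (auto simp: dyck_path_iff lattice_path_distinct)

lemma FFLV_iff:
  "x \<in> FFLV n a \<longleftrightarrow> x \<in> U_space n \<and> (\<forall>p\<in>idx n. 0 \<le> x p) \<and>
     (\<forall>d. dyck_path n d \<longrightarrow> sum x (set d) \<le> lam n a (src d) - lam n a (snk d))"
  unfolding FFLV_def using path_sum_eq_sum path_bound_eq_lam by auto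

definition tight :: "nat \<Rightarrow> (nat \<Rightarrow> nat) \<Rightarrow> (nat \<times> nat \<Rightarrow> real) \<Rightarrow> (nat \<times> nat) list \<Rightarrow> bool" where
  "tight n a x d \<longleftrightarrow> dyck_path n d \<and> sum x (set d) = lam n a (src d) - lam n a (snk d)"

lemma sum_set_append:
  "distinct (u @ t) \<Longrightarrow> sum x (set (u @ t)) = sum x (set u) + sum x (set t)"
  by (simp add: sum.union_disjoint)

text \<open>Exchanging tails at \<open>q\<close> preserves the total of the two sums and the total
  of the two bounds. Both new paths obey their bounds, so equality of the totals forces equality for
  each.\<close>

lemma tight_swap:
  assumes x: "x \<in> FFLV n a" and t: "tight n a x (u @ q # t)" and t': "tight n a x (u' @ q # t')"
  shows "tight n a x (u @ q # t')"
proof -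
  have d: "dyck_path n (u @ q # t)" "dyck_path n (u' @ q # t')" using t t' by (auto simp: tight_def)
  have ends: "src (u @ q # t') = src (u @ q # t)" "src (u' @ q # t) = src (u' @ q # t')"
    "snk (u @ q # t') = snk (u' @ q # t')" "snk (u' @ q # t) = snk (u @ q # t)"
    by (simp_all add: src_def snk_def hd_append)
  have dy: "dyck_path n (u @ q # t')" "dyck_path n (u' @ q # t)"
    using d by (auto simp: dyck_path_iff successively_append_iff hd_append)
  have di: "distinct (u @ q # t')" "distinct (u' @ q # t)" "distinct (u @ q # t)" "distinct (u' @ q
      # t')"
    using d dy lattice_path_distinct unfolding dyck_path_iff by blast+
  have "sum x (set (u @ q # t')) + sum x (set (u' @ q # t))
      = sum x (set (u @ q # t)) + sum x (set (u' @ q # t'))"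
    unfolding sum_set_append[OF di(1)] sum_set_append[OF di(2)]
      sum_set_append[OF di(3)] sum_set_append[OF di(4)] by simp
  moreover have "sum x (set (u @ q # t')) \<le> lam n a (src (u @ q # t')) - lam n a (snk (u @ q # t'))"
    "sum x (set (u' @ q # t)) \<le> lam n a (src (u' @ q # t)) - lam n a (snk (u' @ q # t))"
    using x dy by (auto simp: FFLV_iff)
  ultimately show ?thesis
    using t t' dy unfolding tight_def ends by linarith
qed

section \<open>Hooks\<close>

definition hook :: "nat \<Rightarrow> nat \<Rightarrow> (nat \<times> nat) list" where
  "hook i j = map (Pair i) [i + 1..<j + 1] @ map (\<lambda>k. (k, j)) [i + 1..<j]"

lemma set_hook: "set (hook i j) = Pair i ` {i<..j} \<union> (\<lambda>k. (k, j)) ` {i<..<j}"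
  by (auto simp: hook_def)

lemma successively_upt: "(\<And>k. i \<le> k \<Longrightarrow> k + 1 < j \<Longrightarrow> P k (k + 1)) \<Longrightarrow> successively P [i..<j]"
proof (induction j)
  case (Suc j)
  have "P (j - 1) j" if "i < j" using Suc.prems[of "j - 1"] that by simp
  then show ?case using Suc by (cases "i < j") (auto simp: successively_append_iff last_upt)
qed simp

lemma dyck_path_hook:
  assumes "1 \<le> i" "i < j" "j \<le> n"
  shows "dyck_path n (hook i j)" "src (hook i j) = i" "snk (hook i j) = j"
proof -
  have ne: "[i + 1..<j + 1] \<noteq> []" using assms by simp
  have hd1: "hd (hook i j) = (i, i + 1)"
    using assms ne by (simp add: hook_def hd_append hd_map del: upt_Suc)
  have la1: "last (map (Pair i) [i + 1..<j + 1]) = (i, j)"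
    using assms ne by (simp add: last_map del: upt_Suc)
  have la: "last (hook i j) = (j - 1, j)"
  proof (cases "j = i + 1")
    case True
    then show ?thesis by (simp add: hook_def)
  next
    case False
    then have "[i + 1..<j] \<noteq> []" using assms by simp
    then show ?thesis by (simp add: hook_def last_map del: upt_Suc)
  qed
  show s: "src (hook i j) = i" "snk (hook i j) = j" by (simp_all add: src_def snk_def hd1 la)
  have "successively lstep (hook i j)"
    unfolding hook_def successively_append_iff successively_map la1
    by (auto intro!: successively_upt simp: lstep_def hd_map simp del: upt_Suc)
  moreover have "set (hook i j) \<subseteq> idx n" using assms by (auto simp: set_hook)
  ultimately show "dyck_path n (hook i j)"
    using hd1 la assms by (auto simp: dyck_path_iff hook_def)
qed

lemma sum_hook:
  fixes y :: "nat \<times> nat \<Rightarrow> real"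
  shows "sum y (set (hook i j)) = (\<Sum>k\<in>{i<..j}. y (i, k)) + (\<Sum>k\<in>{i<..<j}. y (k, j))"
proof -
  have "sum y (set (hook i j)) = sum y (Pair i ` {i<..j}) + sum y ((\<lambda>k. (k, j)) ` {i<..<j})"
    unfolding set_hook by (rule sum.union_disjoint) auto
  also have "sum y (Pair i ` {i<..j}) = (\<Sum>k\<in>{i<..j}. y (i, k))"
    by (subst sum.reindex) (auto simp: inj_on_def)
  also have "sum y ((\<lambda>k. (k, j)) ` {i<..<j}) = (\<Sum>k\<in>{i<..<j}. y (k, j))"
    by (subst sum.reindex) (auto simp: inj_on_def)
  finally show ?thesis .
qed

lemma sum_hook_corner:
  fixes y :: "nat \<times> nat \<Rightarrow> real"
  assumes "i < j"
  shows "sum y (set (hook i j)) = y (i, j) + (\<Sum>k\<in>{i<..<j}. y (i, k)) + (\<Sum>k\<in>{i<..<j}. y (k, j))"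
proof -
  have "{i<..j} = insert j {i<..<j}" using assms by auto
  then show ?thesis by (simp add: sum_hook)
qed

lemma dyck_path_card:
  assumes "dyck_path n d" shows "card (set d) + 2 * src d + 1 = 2 * snk d"
proof -
  have s: "successively lstep d" "d \<noteq> []" using assms by (auto simp: dyck_path_iff)
  show ?thesis
    using lattice_path_length[OF s] dyck_path_ends[OF assms] distinct_card[OF
        lattice_path_distinct[OF s(1)]]
    by auto
qed

text \<open>Every point of \<open>d\<close> is comparable with the corner
  \<open>(src d, snk d)\<close>, hence lies in its row or its column. The inclusion is an equality
  because the length of a Dyck path depends only on its ends.\<close>

lemma dyck_path_hook_iff:
  assumes d: "dyck_path n d" and c: "(src d, snk d) \<in> set d"
  shows "set d = set (hook (src d) (snk d))"
proof (rule card_subset_eq)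
  show "finite (set (hook (src d) (snk d)))" by simp
  show "set d \<subseteq> set (hook (src d) (snk d))"
  proof
    fix p assume p: "p \<in> set d"
    obtain i j where [simp]: "p = (i, j)" by (cases p)
    have s: "successively lstep d" using d by (auto simp: dyck_path_iff)
    show "p \<in> set (hook (src d) (snk d))"
      using lattice_path_chain[OF s p c] dyck_path_elem[OF d, of i j] p
      by (auto simp: set_hook image_iff)
  qed
  show "card (set d) = card (set (hook (src d) (snk d)))"
    using dyck_path_card[OF d] dyck_path_card[OF dyck_path_hook(1), of "src d" "snk d" n]
      dyck_path_ends[OF d] dyck_path_hook[of "src d" "snk d" n] by simp
qed

section \<open>The tangent cone\<close>

definition ip :: "nat \<Rightarrow> (nat \<times> nat \<Rightarrow> real) \<Rightarrow> (nat \<times> nat \<Rightarrow> real) \<Rightarrow> real" where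
  "ip n c y = (\<Sum>p\<in>idx n. c p * y p)"

definition punit :: "nat \<times> nat \<Rightarrow> nat \<times> nat \<Rightarrow> real" where
  "punit p = (\<lambda>q. of_bool (q = p))"

definition pathv :: "(nat \<times> nat) list \<Rightarrow> nat \<times> nat \<Rightarrow> real" where
  "pathv d = (\<lambda>q. - of_bool (q \<in> set d))"

text \<open>All inequalities take the form \<open>m \<le> ip n c x\<close>; the path functionals are
  negated for this, so the tangent cone is cut out by \<open>0 \<le> ip n c y\<close> for tight
  \<open>c\<close>.\<close>

definition constrs :: "nat \<Rightarrow> (nat \<Rightarrow> nat) \<Rightarrow> ((nat \<times> nat \<Rightarrow> real) \<times> real) set" where
  "constrs n a = (\<lambda>p. (punit p, 0)) ` idx n \<union>
     (\<lambda>d. (pathv d, lam n a (snk d) - lam n a (src d))) ` {d. dyck_path n d}"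

definition tightv :: "nat \<Rightarrow> (nat \<Rightarrow> nat) \<Rightarrow> (nat \<times> nat \<Rightarrow> real) \<Rightarrow> (nat \<times> nat \<Rightarrow> real) set" where
  "tightv n a x = {c. \<exists>m. (c, m) \<in> constrs n a \<and> ip n c x = m}"

lemma ip_add [simp]: "ip n c (y + z) = ip n c y + ip n c z"
  by (simp add: ip_def distrib_left sum.distrib)

lemma ip_diff [simp]: "ip n c (y - z) = ip n c y - ip n c z"
  by (simp add: ip_def right_diff_distrib sum_subtractf)

lemma ip_scaleR [simp]: "ip n c (t *\<^sub>R y) = t * ip n c y"
  by (simp add: ip_def sum_distrib_left mult.left_commute)

lemma ip_sum: "ip n c (\<Sum>b\<in>B. f b) = (\<Sum>b\<in>B. ip n c (f b))"
  unfolding ip_def sum_fun_apply sum_distrib_left by (rule sum.swap)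

lemma ip_punit [simp]: "p \<in> idx n \<Longrightarrow> ip n (punit p) y = y p"
  by (simp add: ip_def punit_def)

lemma ip_punit_right [simp]: "p \<in> idx n \<Longrightarrow> ip n c (punit p) = c p"
  by (simp add: ip_def punit_def)

lemma ip_pathv: "dyck_path n d \<Longrightarrow> ip n (pathv d) y = - sum y (set d)"
proof -
  assume "dyck_path n d"
  then have "set d \<subseteq> idx n" by (simp add: dyck_path_iff)
  then have "(\<Sum>p\<in>set d. y p) = (\<Sum>p\<in>idx n. if p \<in> set d then y p else 0)"
    by (subst sum.inter_restrict[symmetric]) (auto intro!: sum.cong)
  also have "\<dots> = (\<Sum>p\<in>idx n. of_bool (p \<in> set d) * y p)"
    by (rule sum.cong) auto
  finally show ?thesis by (simp add: ip_def pathv_def sum_negf)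
qed

lemma U_space_add: "y \<in> U_space n \<Longrightarrow> z \<in> U_space n \<Longrightarrow> y + z \<in> U_space n"
  and U_space_diff: "y \<in> U_space n \<Longrightarrow> z \<in> U_space n \<Longrightarrow> y - z \<in> U_space n"
  and U_space_scaleR: "y \<in> U_space n \<Longrightarrow> t *\<^sub>R y \<in> U_space n"
  and U_space_punit: "p \<in> idx n \<Longrightarrow> punit p \<in> U_space n"
  by (auto simp: U_space_def punit_def)

lemma U_space_sum: "(\<And>b. b \<in> B \<Longrightarrow> f b \<in> U_space n) \<Longrightarrow> (\<Sum>b\<in>B. f b) \<in> U_space n"
  by (auto simp: U_space_def sum_fun_apply)

lemma U_space_expand:
  assumes "y \<in> U_space n" shows "y = (\<Sum>p\<in>idx n. y p *\<^sub>R punit p)"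
proof
  fix q
  have "(\<Sum>p\<in>idx n. y p *\<^sub>R punit p) q = (\<Sum>p\<in>idx n. if p = q then y q else 0)"
    unfolding sum_fun_apply by (rule sum.cong) (auto simp: punit_def)
  then show "y q = (\<Sum>p\<in>idx n. y p *\<^sub>R punit p) q"
    using assms by (cases q) (auto simp: U_space_def)
qed

lemma finite_constrs: "finite (constrs n a)"
  using finite_dyck_paths by (simp add: constrs_def)

lemma finite_tightv: "finite (tightv n a x)"
  by (rule finite_subset[OF _ finite_imageI[OF finite_constrs, of fst]]) (force simp: tightv_def)

lemma FFLV_constrs: "x \<in> FFLV n a \<longleftrightarrow> x \<in> U_space n \<and> (\<forall>(c, m)\<in>constrs n a. m \<le> ip n c x)"
  by (auto simp: FFLV_iff constrs_def ip_pathv ball_Un)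

lemma tightv_iff:
  "c \<in> tightv n a x \<longleftrightarrow> (\<exists>p\<in>idx n. c = punit p \<and> x p = 0) \<or> (\<exists>d. tight n a x d \<and> c = pathv d)"
  by (auto simp: tightv_def constrs_def tight_def ip_pathv)

text \<open>There are finitely many constraints: the slack ones survive a small move by continuity,
  the tight ones by the sign assumption on \<open>y\<close>.\<close>

lemma FFLV_feasible_direction:
  assumes x: "x \<in> FFLV n a" and y: "y \<in> U_space n" and t: "\<And>c. c \<in> tightv n a x \<Longrightarrow> 0 \<le> ip n c y"
  shows "\<exists>e>0. x + e *\<^sub>R y \<in> FFLV n a"
proof -
  have "\<forall>\<^sub>F e in at_right 0. case cm of (c, m) \<Rightarrow> m \<le> ip n c x + e * ip n c y"
    if "cm \<in> constrs n a" for cm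
  proof (cases cm)
    case (Pair c m)
    have le: "m \<le> ip n c x" using x that Pair by (auto simp: FFLV_constrs)
    show ?thesis
    proof (cases "m = ip n c x")
      case True
      then have "0 \<le> ip n c y" using t that Pair by (auto simp: tightv_def)
      then show ?thesis using True Pair
        by (auto intro!: eventually_mono[OF eventually_at_right_less])
    next
      case False
      have "((\<lambda>e. ip n c x + e * ip n c y) \<longlongrightarrow> ip n c x + 0 * ip n c y) (at_right 0)"
        by (intro tendsto_intros)
      then have "\<forall>\<^sub>F e in at_right 0. m < ip n c x + e * ip n c y"
        by (rule order_tendstoD) (use le False in auto)
      then show ?thesis using Pair by (auto elim: eventually_mono)
    qed
  qed
  then have "\<forall>\<^sub>F e in at_right 0. \<forall>cm\<in>constrs n a. case cm of (c, m) \<Rightarrow> m \<le> ip n c x + e * ip n c y"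
    by (intro eventually_ball_finite finite_constrs) auto
  then have "\<forall>\<^sub>F e in at_right (0::real). e > 0 \<and> x + e *\<^sub>R y \<in> FFLV n a"
    using eventually_at_right_less
    by eventually_elim (use x y in \<open>auto simp: FFLV_constrs U_space_add U_space_scaleR\<close>)
  then have "\<exists>e. e > 0 \<and> x + e *\<^sub>R y \<in> FFLV n a"
    by (rule eventually_happens'[rotated]) simp
  then show ?thesis by blast
qed

lemma tangent_cone_FFLV:
  assumes x: "x \<in> FFLV n a"
  shows "tangent_cone (FFLV n a) x = {y \<in> U_space n. \<forall>c\<in>tightv n a x. 0 \<le> ip n c y}"
proof (intro set_eqI iffI)
  fix y assume "y \<in> tangent_cone (FFLV n a) x"
  then obtain t z where y: "y = t *\<^sub>R (z - x)" "0 \<le> t" "z \<in> FFLV n a"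
    by (auto simp: tangent_cone_def)
  then have "0 \<le> ip n c y" if "c \<in> tightv n a x" for c
    using that by (force simp: tightv_def FFLV_constrs)
  then show "y \<in> {y \<in> U_space n. \<forall>c\<in>tightv n a x. 0 \<le> ip n c y}"
    using x y by (auto simp: FFLV_constrs U_space_scaleR U_space_diff)
next
  fix y assume "y \<in> {y \<in> U_space n. \<forall>c\<in>tightv n a x. 0 \<le> ip n c y}"
  then obtain e where e: "e > 0" "x + e *\<^sub>R y \<in> FFLV n a"
    using FFLV_feasible_direction[OF x] by auto
  then have "y = (1 / e) *\<^sub>R ((x + e *\<^sub>R y) - x)" by simp
  then show "y \<in> tangent_cone (FFLV n a) x"
    using e unfolding tangent_cone_def by (intro CollectI exI[of _ "1/e"] exI[of _ "x + e *\<^sub>R y"])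
        auto
qed

lemma convex_cone_hull_finite:
  assumes B: "finite B"
  shows "convex_cone hull B = {\<Sum>b\<in>B. u b *\<^sub>R b | u. \<forall>b\<in>B. 0 \<le> u b}" (is "_ = ?K")
proof (rule hull_unique)
  show "B \<subseteq> ?K"
  proof
    fix b assume "b \<in> B"
    then have "b = (\<Sum>b'\<in>B. of_bool (b' = b) *\<^sub>R b')"
      using B by (simp add: of_bool_def if_distrib[of "\<lambda>r. r *\<^sub>R _"] cong: if_cong)
    then show "b \<in> ?K" by (intro CollectI exI[of _ "\<lambda>b'. of_bool (b' = b)"]) auto
  qed
  have "0 \<in> ?K" by (intro CollectI exI[of _ "\<lambda>_. 0"]) auto
  moreover have "y + z \<in> ?K" if "y \<in> ?K" "z \<in> ?K" for y z
  proof -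
    from that obtain u u' where "y = (\<Sum>b\<in>B. u b *\<^sub>R b)" "\<forall>b\<in>B. 0 \<le> u b"
      "z = (\<Sum>b\<in>B. u' b *\<^sub>R b)" "\<forall>b\<in>B. 0 \<le> u' b" by auto
    then show ?thesis
      by (intro CollectI exI[of _ "\<lambda>b. u b + u' b"]) (auto simp: scaleR_add_left sum.distrib)
  qed
  moreover have "t *\<^sub>R y \<in> ?K" if "y \<in> ?K" "0 \<le> t" for y t
  proof -
    from that obtain u where "y = (\<Sum>b\<in>B. u b *\<^sub>R b)" "\<forall>b\<in>B. 0 \<le> u b" by auto
    then show ?thesis using that(2)
      by (intro CollectI exI[of _ "\<lambda>b. t * u b"]) (auto simp: scaleR_sum_right)
  qed
  ultimately show "convex_cone ?K" unfolding convex_cone_iff by blast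
  show "?K \<subseteq> T" if T: "B \<subseteq> T" "convex_cone T" for T
  proof
    fix y assume "y \<in> ?K"
    then obtain u where u: "y = (\<Sum>b\<in>B. u b *\<^sub>R b)" "\<forall>b\<in>B. 0 \<le> u b" by auto
    have "A \<subseteq> B \<Longrightarrow> (\<Sum>b\<in>A. u b *\<^sub>R b) \<in> T" for A
    proof (induction A rule: infinite_finite_induct)
      case (insert b A)
      then show ?case using T u by (auto intro!: convex_cone_add convex_cone_scaleR)
    qed (use T convex_cone_contains_0 in auto)
    then show "y \<in> T" using u by simp
  qed
qed

text \<open>The last property says that each facet of the cone is cut out by a tight functional. If
  none separated \<open>b\<close> from the facet opposite to it, then an interior point of this
  facet minus a small multiple of \<open>b\<close> would still satisfy all tight constraints,
  although its coefficient at \<open>b\<close> is negative.\<close>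

lemma unimodular_tangent_cone_dual:
  assumes x: "x \<in> FFLV n a" and uni: "unimodular_cone (U_lattice n) (tangent_cone (FFLV n a) x)"
  obtains B where "finite B" "B \<subseteq> U_space n"
    "\<And>y. y \<in> U_space n \<Longrightarrow> \<exists>u. y = (\<Sum>b\<in>B. u b *\<^sub>R b)"
    "\<And>b c. b \<in> B \<Longrightarrow> c \<in> tightv n a x \<Longrightarrow> 0 \<le> ip n c b"
    "\<And>b. b \<in> B \<Longrightarrow> \<exists>c\<in>tightv n a x. 0 < ip n c b \<and> (\<forall>b'\<in>B - {b}. ip n c b' = 0)"
proof -
  obtain B where L: "lattice_basis (U_lattice n) B"
    and C: "tangent_cone (FFLV n a) x = convex_cone hull B"
    using uni by (auto simp: unimodular_cone_def)
  have fin: "finite B" and ind: "independent B"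
    and Leq: "U_lattice n = {\<Sum>b\<in>B. real_of_int (c b) *\<^sub>R b | c. True}"
    using L by (auto simp: lattice_basis_def)
  have BC: "y \<in> U_space n \<and> (\<forall>c\<in>tightv n a x. 0 \<le> ip n c y) \<longleftrightarrow>
      (\<exists>u. y = (\<Sum>b\<in>B. u b *\<^sub>R b) \<and> (\<forall>b\<in>B. 0 \<le> u b))" for y
    using C unfolding tangent_cone_FFLV[OF x] convex_cone_hull_finite[OF fin] by blast
  have BU: "b \<in> U_space n" "\<And>c. c \<in> tightv n a x \<Longrightarrow> 0 \<le> ip n c b" if "b \<in> B" for b
  proof -
    have "b \<in> convex_cone hull B" using that by (simp add: hull_inc)
    then have "b \<in> {y \<in> U_space n. \<forall>c\<in>tightv n a x. 0 \<le> ip n c y}"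
      using C tangent_cone_FFLV[OF x] by simp
    then show "b \<in> U_space n" "\<And>c. c \<in> tightv n a x \<Longrightarrow> 0 \<le> ip n c b" by auto
  qed
  \<comment> \<open>The unit vectors are lattice points, so a lattice basis spans the whole
    space.\<close>
  have span: "\<exists>u. y = (\<Sum>b\<in>B. u b *\<^sub>R b)" if y: "y \<in> U_space n" for y
  proof -
    have "\<exists>u. punit p = (\<Sum>b\<in>B. real_of_int (u b) *\<^sub>R b)" if "p \<in> idx n" for p
    proof -
      have "punit p \<in> U_lattice n"
        using U_space_punit[OF that] by (auto simp: U_lattice_def punit_def)
      then show ?thesis unfolding Leq by auto
    qed
    then obtain u where u: "\<And>p. p \<in> idx n \<Longrightarrow> punit p = (\<Sum>b\<in>B. real_of_int (u p b) *\<^sub>R b)"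
      by metis
    have "y = (\<Sum>p\<in>idx n. y p *\<^sub>R (\<Sum>b\<in>B. real_of_int (u p b) *\<^sub>R b))"
      using U_space_expand[OF y] u by (simp cong: sum.cong)
    also have "\<dots> = (\<Sum>b\<in>B. \<Sum>p\<in>idx n. (y p * real_of_int (u p b)) *\<^sub>R b)"
      unfolding scaleR_sum_right by (subst sum.swap) simp
    also have "\<dots> = (\<Sum>b\<in>B. (\<Sum>p\<in>idx n. y p * real_of_int (u p b)) *\<^sub>R b)"
      by (simp add: scaleR_sum_left)
    finally show ?thesis by (intro exI)
  qed
  have dual: "\<exists>c\<in>tightv n a x. 0 < ip n c b \<and> (\<forall>b'\<in>B - {b}. ip n c b' = 0)" if b: "b \<in> B" for b
  proof -
    \<comment> \<open>A relative interior point of the facet opposite to \<open>b\<close>.\<close>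
    define y where "y = (\<Sum>b'\<in>B - {b}. b')"
    have yU: "y \<in> U_space n" unfolding y_def by (rule U_space_sum) (use BU in auto)
    have ipy: "ip n c y = (\<Sum>b'\<in>B - {b}. ip n c b')" for c
      by (simp add: y_def ip_sum)
    have ypos: "0 \<le> ip n c y" if "c \<in> tightv n a x" for c
      unfolding ipy by (rule sum_nonneg) (use BU that in auto)
    have "\<exists>c\<in>tightv n a x. ip n c y = 0 \<and> 0 < ip n c b"
    proof (rule ccontr)
      assume neg: "\<not> ?thesis"
      have "\<forall>\<^sub>F e in at_right 0. 0 \<le> ip n c (y - e *\<^sub>R b)" if c: "c \<in> tightv n a x" for c
      proof (cases "ip n c b = 0")
        case True
        then show ?thesis using ypos[OF c] by simp
      next
        case False
        then have "0 < ip n c y" using neg ypos[OF c] BU(2)[OF b c] c by fastforce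
        moreover have "((\<lambda>e. ip n c (y - e *\<^sub>R b)) \<longlongrightarrow> ip n c y - 0 * ip n c b) (at_right 0)"
          unfolding ip_diff ip_scaleR by (intro tendsto_intros)
        ultimately have "\<forall>\<^sub>F e in at_right 0. 0 < ip n c (y - e *\<^sub>R b)"
          by (intro order_tendstoD(1)) auto
        then show ?thesis by (auto elim: eventually_mono)
      qed
      then have "\<forall>\<^sub>F e in at_right 0. \<forall>c\<in>tightv n a x. 0 \<le> ip n c (y - e *\<^sub>R b)"
        by (intro eventually_ball_finite finite_tightv) auto
      then have "\<forall>\<^sub>F e in at_right (0::real). 0 < e \<and> (\<forall>c\<in>tightv n a x. 0 \<le> ip n c (y - e *\<^sub>R b))"
        using eventually_at_right_less by eventually_elim auto
      then have "\<exists>e. 0 < e \<and> (\<forall>c\<in>tightv n a x. 0 \<le> ip n c (y - e *\<^sub>R b))"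
        by (rule eventually_happens'[rotated]) simp
      then obtain e where e: "0 < e" "\<forall>c\<in>tightv n a x. 0 \<le> ip n c (y - e *\<^sub>R b)" by blast
      then obtain u where u: "y - e *\<^sub>R b = (\<Sum>b'\<in>B. u b' *\<^sub>R b')" "\<forall>b'\<in>B. 0 \<le> u b'"
        using BC[of "y - e *\<^sub>R b"] yU BU(1)[OF b] by (auto simp: U_space_diff U_space_scaleR)
      have "(\<Sum>b'\<in>B. (u b' - (if b' = b then - e else 1)) *\<^sub>R b')
          = (\<Sum>b'\<in>B. u b' *\<^sub>R b') - (\<Sum>b'\<in>B. (if b' = b then - e else 1) *\<^sub>R b')"
        by (simp add: scaleR_diff_left sum_subtractf)
      also have "(\<Sum>b'\<in>B. (if b' = b then - e else 1) *\<^sub>R b') = - (e *\<^sub>R b) + (\<Sum>b'\<in>B - {b}. b')"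
        by (subst sum.remove[OF fin b]) (auto intro!: sum.cong)
      also have "(\<Sum>b'\<in>B. u b' *\<^sub>R b') - (- (e *\<^sub>R b) + (\<Sum>b'\<in>B - {b}. b')) = 0"
        unfolding u(1)[symmetric] y_def by (simp add: fun_eq_iff)
      finally have "(\<Sum>b'\<in>B. (u b' - (if b' = b then - e else 1)) *\<^sub>R b') = 0" .
      then have "u b - (if b = b then - e else 1) = 0"
        by (rule independentD[OF ind fin subset_refl _ b])
      then show False using u(2) b e by auto
    qed
    then obtain c where c: "c \<in> tightv n a x" "ip n c y = 0" "0 < ip n c b" by blast
    have "\<forall>b'\<in>B - {b}. ip n c b' = 0"
      using c(2) fin BU(2)[OF _ c(1)] unfolding ipy by (subst (asm) sum_nonneg_eq_0_iff) auto
    then show ?thesis using c by blast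
  qed
  show ?thesis by (rule that[OF fin _ span BU(2) dual]) (use BU in auto)
qed

section \<open>Independence of the tight constraints\<close>

lemma lam_diff:
  assumes "1 \<le> s" "s \<le> t" "t \<le> n"
  shows "lam n a s - lam n a t = (\<Sum>k\<in>{1..<n}. real (a k) * of_bool (s \<le> k \<and> k < t))"
proof -
  have "lam n a s = (\<Sum>k=s..<t. real (a k)) + lam n a t"
    unfolding lam_def using assms by (intro sum.atLeastLessThan_concat[symmetric]) auto
  moreover have "(\<Sum>k=s..<t. real (a k)) = (\<Sum>k\<in>{1..<n}. real (a k) * of_bool (s \<le> k \<and> k < t))"
    using assms by (intro sum.mono_neutral_cong_left) auto
  ultimately show ?thesis by simp
qed

text \<open>The bound of a path is a nonempty sum of positive \<open>a k\<close>, so a tight path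
  cannot have sum zero.\<close>

lemma tight_meets_support:
  assumes "tight n a x d" "\<forall>i\<in>{1..n - 1}. 0 < a i"
  shows "\<exists>p\<in>set d. x p \<noteq> 0"
proof (rule ccontr)
  assume "\<not> ?thesis"
  then have "sum x (set d) = 0" by simp
  moreover have d: "dyck_path n d" using assms by (simp add: tight_def)
  have e: "1 \<le> src d" "src d < snk d" "snk d \<le> n" using dyck_path_ends[OF d] by auto
  have "lam n a (src d) = (\<Sum>k=src d..<snk d. real (a k)) + lam n a (snk d)"
    unfolding lam_def using e by (intro sum.atLeastLessThan_concat[symmetric]) auto
  moreover have "0 < (\<Sum>k=src d..<snk d. real (a k))"
    by (rule sum_pos) (use e assms(2) in auto)
  ultimately show False using assms(1) by (simp add: tight_def)
qed

text \<open>
  Counting the weight of the paths that use row \<open>k\<close> (equivalently column \<open>k + 1\<close>) gives at least \<open>1\<close>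
  for every such row of \<open>d\<close>, and exactly \<open>1\<close> by the bound. So each path of the cover contains all of
  \<open>d\<close> in the rows and columns it uses, and a path that is shorter than \<open>d\<close> cannot do this at its
  end.
\<close>

lemma path_cover_extremal:
  fixes w :: "'b \<Rightarrow> real"
  assumes a: "\<forall>i\<in>{1..n - 1}. 0 < a i" and d: "dyck_path n d" and J: "finite J"
    and dd: "\<And>b. b \<in> J \<Longrightarrow> dyck_path n (dd b)" and w: "\<And>b. b \<in> J \<Longrightarrow> 0 < w b"
    and cover: "\<And>p. p \<in> set d \<Longrightarrow> 1 \<le> (\<Sum>b\<in>J. w b * of_bool (p \<in> set (dd b)))"
    and bound: "(\<Sum>b\<in>J. w b * (lam n a (src (dd b)) - lam n a (snk (dd b))))
      \<le> lam n a (src d) - lam n a (snk d)"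
  shows "\<exists>b\<in>J. set (dd b) = set d"
proof -
  define I where "I e k \<longleftrightarrow> src e \<le> k \<and> k < snk e" for e :: "(nat \<times> nat) list" and k
  have lamI: "lam n a (src e) - lam n a (snk e) = (\<Sum>k\<in>{1..<n}. real (a k) * of_bool (I e k))"
    if "dyck_path n e" for e
    unfolding I_def by (rule lam_diff) (use dyck_path_ends[OF that] in auto)
  have sd: "successively lstep d" "d \<noteq> []" using d by (auto simp: dyck_path_iff)
  have elem: "I e i" "I e (j - 1)" if "dyck_path n e" "(i, j) \<in> set e" for e i j
    using dyck_path_elem[OF that] by (auto simp: I_def)
  have row: "\<exists>j. (k, j) \<in> set d" if "I d k" for k
  proof (cases "k = snk d - 1")
    case True
    then show ?thesis using dyck_path_ends(7)[OF d] by auto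
  next
    case False
    then have "fst (hd d) \<le> k" "k < fst (last d)"
      using that dyck_path_ends[OF d] by (auto simp: I_def)
    then show ?thesis
      using lattice_path_crosses_row[OF sd] by blast
  qed
  have cnt: "of_bool (I d k) \<le> (\<Sum>b\<in>J. w b * of_bool (I (dd b) k))" for k
  proof (cases "I d k")
    case True
    then obtain j where j: "(k, j) \<in> set d" using row by blast
    have "1 \<le> (\<Sum>b\<in>J. w b * of_bool ((k, j) \<in> set (dd b)))" by (rule cover[OF j])
    also have "\<dots> \<le> (\<Sum>b\<in>J. w b * of_bool (I (dd b) k))"
      by (rule sum_mono) (use elem(1)[OF dd] w in \<open>force intro!: mult_left_mono\<close>)
    finally show ?thesis using True by simp
  next
    case False
    then show ?thesis using w by (auto intro!: sum_nonneg simp: less_imp_le)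
  qed
  have "(\<Sum>b\<in>J. w b * (lam n a (src (dd b)) - lam n a (snk (dd b))))
      = (\<Sum>b\<in>J. \<Sum>k\<in>{1..<n}. real (a k) * (w b * of_bool (I (dd b) k)))"
    by (rule sum.cong) (simp_all only: lamI[OF dd] sum_distrib_left mult.left_commute)
  also have "\<dots> = (\<Sum>k\<in>{1..<n}. real (a k) * (\<Sum>b\<in>J. w b * of_bool (I (dd b) k)))"
    by (subst sum.swap) (simp add: sum_distrib_left)
  finally have "(\<Sum>k\<in>{1..<n}. real (a k) * ((\<Sum>b\<in>J. w b * of_bool (I (dd b) k)) - of_bool (I d k))) \<le>
      0"
    using bound unfolding lamI[OF d] by (simp add: right_diff_distrib sum_subtractf)
  then have "(\<Sum>k\<in>{1..<n}. real (a k) * ((\<Sum>b\<in>J. w b * of_bool (I (dd b) k)) - of_bool (I d k))) = 0"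
    using cnt by (intro antisym sum_nonneg) auto
  then have eqs: "\<forall>k\<in>{1..<n}. real (a k) * ((\<Sum>b\<in>J. w b * of_bool (I (dd b) k)) - of_bool (I d k)) =
      0"
    using cnt by (subst (asm) sum_nonneg_eq_0_iff) auto
  have eq: "(\<Sum>b\<in>J. w b * of_bool (I (dd b) k)) = of_bool (I d k)" if "1 \<le> k" "k < n" for k
  proof -
    have "0 < a k" using a that by auto
    moreover have "real (a k) * ((\<Sum>b\<in>J. w b * of_bool (I (dd b) k)) - of_bool (I d k)) = 0"
      by (rule bspec[OF eqs]) (use that in simp)
    ultimately show ?thesis unfolding mult_eq_0_iff by linarith
  qed
  have forced: "(i, j) \<in> set (dd b)"
    if p: "(i, j) \<in> set d" and b: "b \<in> J" and k: "I (dd b) k" "k = i \<or> k = j - 1" for i j k b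
  proof -
    have kr: "1 \<le> k" "k < n" "I d k"
      using k dyck_path_elem[OF d p] elem[OF d p] dyck_path_ends[OF d] by (auto simp: I_def)
    have le: "w b * of_bool ((i, j) \<in> set (dd b)) \<le> w b * of_bool (I (dd b) k)" if "b \<in> J" for b
      using elem[OF dd[OF that], of i j] k(2) w[OF that] by auto
    have "(\<Sum>b\<in>J. w b * of_bool (I (dd b) k) - w b * of_bool ((i, j) \<in> set (dd b))) \<le> 0"
      using eq[OF kr(1,2)] cover[OF p] kr(3) by (simp add: sum_subtractf)
    then have "(\<Sum>b\<in>J. w b * of_bool (I (dd b) k) - w b * of_bool ((i, j) \<in> set (dd b))) = 0"
      using le by (intro antisym sum_nonneg) auto
    then have "w b * of_bool (I (dd b) k) - w b * of_bool ((i, j) \<in> set (dd b)) = 0"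
      using le b J by (subst (asm) sum_nonneg_eq_0_iff) auto
    then show ?thesis using w[OF b] k(1) by (auto split: if_splits)
  qed
  have "J \<noteq> {}" using cover[OF dyck_path_ends(6)[OF d]] by auto
  then obtain b where b: "b \<in> J" by blast
  note db = dd[OF b] and e = dyck_path_ends[OF dd[OF b]]
  have Isub: "I d k" if "I (dd b) k" for k
  proof (rule ccontr)
    assume neg: "\<not> I d k"
    have kr: "1 \<le> k" "k < n" using that e by (auto simp: I_def)
    have "(\<Sum>b\<in>J. w b * of_bool (I (dd b) k)) = 0" using eq[OF kr] neg by simp
    then have "w b * of_bool (I (dd b) k) = 0"
      using w b J by (subst (asm) sum_nonneg_eq_0_iff) (auto simp: less_imp_le)
    then show False using that w[OF b] by simp
  qed
  have Is: "I d (src (dd b))" "I d (snk (dd b) - 1)" using Isub e by (auto simp: I_def)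
  \<comment> \<open>Otherwise \<open>d\<close> goes down from row \<open>snk (dd b) - 1\<close> in
    some column \<open>j\<close>. The upper point is forced onto \<open>dd b\<close>, so
    \<open>j \<le> snk (dd b)\<close>; the lower point lies strictly above the diagonal, so
    \<open>j > snk (dd b)\<close>. The source is handled by the transposed argument.\<close>
  have "snk (dd b) = snk d"
  proof (rule ccontr)
    assume "snk (dd b) \<noteq> snk d"
    then have "snk (dd b) - 1 < fst (last d)" "fst (hd d) \<le> snk (dd b) - 1"
      using Is dyck_path_ends[OF d] e by (auto simp: I_def)
    then obtain j where j: "(snk (dd b) - 1, j) \<in> set d" "(snk (dd b), j) \<in> set d"
      using lattice_path_crosses_row[OF sd] e by fastforce
    have "(snk (dd b) - 1, j) \<in> set (dd b)"
      by (rule forced[OF j(1) b, of "snk (dd b) - 1"]) (use e in \<open>auto simp: I_def\<close>)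
    then show False using dyck_path_elem(4)[OF db] dyck_path_elem(3)[OF d j(2)] by force
  qed
  moreover have "src (dd b) = src d"
  proof (rule ccontr)
    assume "src (dd b) \<noteq> src d"
    then have "snd (hd d) \<le> src (dd b)" "src (dd b) < snd (last d)"
      using Is dyck_path_ends[OF d] e by (auto simp: I_def)
    then obtain i where i: "(i, src (dd b)) \<in> set d" "(i, src (dd b) + 1) \<in> set d"
      using lattice_path_crosses_column[OF sd] by blast
    have "(i, src (dd b) + 1) \<in> set (dd b)"
      by (rule forced[OF i(2) b, of "src (dd b)"]) (use e in \<open>auto simp: I_def\<close>)
    then show False using dyck_path_elem(1)[OF db] dyck_path_elem(3)[OF d i(1)] by force
  qed
  ultimately have same: "src (dd b) = src d" "snk (dd b) = snk d" by auto
  have "set d \<subseteq> set (dd b)"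
  proof
    fix p assume p: "p \<in> set d"
    obtain i j where ij: "p = (i, j)" by (cases p)
    have "I (dd b) i" using elem(1)[OF d, of i j] p ij same by (simp add: I_def)
    then show "p \<in> set (dd b)" using forced[of i j b i] p ij b by simp
  qed
  moreover have "card (set d) = card (set (dd b))"
    using dyck_path_card[OF d] dyck_path_card[OF db] same by simp
  ultimately have "set d = set (dd b)" by (intro card_subset_eq) auto
  then show ?thesis using b by auto
qed

lemma pathv_eq_iff: "pathv d = pathv e \<longleftrightarrow> set d = set e"
  by (auto simp: pathv_def fun_eq_iff)

text \<open>Each tight functional spans an extreme ray of the dual cone. If \<open>c\<close> is a
  unit functional, a path in the combination would contribute a negative coordinate at a support
  point, where nothing can compensate it; so only unit functionals remain. If \<open>c\<close> comes
  from a path \<open>d\<close>, the unit terms are nonnegative and vanish on the support of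
  \<open>x\<close>: the weighted paths cover \<open>d\<close>, and evaluating at \<open>x\<close>
  shows that their bounds add up to that of \<open>d\<close>.\<close>

lemma tightv_extremal:
  assumes x: "x \<in> FFLV n a" and a: "\<forall>i\<in>{1..n - 1}. 0 < a i" and J: "finite J"
    and c: "c \<in> tightv n a x" and cc: "\<And>b. b \<in> J \<Longrightarrow> cc b \<in> tightv n a x"
    and w: "\<And>b. b \<in> J \<Longrightarrow> 0 \<le> w b"
    and comb: "\<And>y. y \<in> U_space n \<Longrightarrow> ip n c y = (\<Sum>b\<in>J. w b * ip n (cc b) y)"
  shows "\<exists>b\<in>J. cc b = c"
proof -
  have coord: "c p = (\<Sum>b\<in>J. w b * cc b p)" if "p \<in> idx n" for p
    using comb[OF U_space_punit[OF that]] that by simp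
  define J' where "J' = {b \<in> J. 0 < w b \<and> (\<exists>d. tight n a x d \<and> cc b = pathv d)}"
  have J': "finite J'" "J' \<subseteq> J" using J by (auto simp: J'_def)
  \<comment> \<open>The terms outside \<open>J'\<close> have weight 0 or are unit functionals at
    zeros of \<open>x\<close>.\<close>
  have rest: "0 \<le> w b * cc b p" "x p \<noteq> 0 \<Longrightarrow> w b * cc b p = 0" if "b \<in> J - J'" for b p
  proof -
    have "w b = 0 \<or> (\<exists>q\<in>idx n. cc b = punit q \<and> x q = 0)"
      using that cc[of b] w[of b] by (auto simp: J'_def tightv_iff)
    then show "0 \<le> w b * cc b p" "x p \<noteq> 0 \<Longrightarrow> w b * cc b p = 0"
      using that w[of b] by (auto simp: punit_def)
  qed
  have "\<forall>b\<in>J'. \<exists>d. tight n a x d \<and> cc b = pathv d" by (auto simp: J'_def)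
  then obtain dd where dd: "\<And>b. b \<in> J' \<Longrightarrow> tight n a x (dd b)" "\<And>b. b \<in> J' \<Longrightarrow> cc b = pathv (dd b)"
    using bchoice[of J' "\<lambda>b d. tight n a x d \<and> cc b = pathv d"] by blast
  have split: "c p = (\<Sum>b\<in>J - J'. w b * cc b p) - (\<Sum>b\<in>J'. w b * of_bool (p \<in> set (dd b)))"
    if "p \<in> idx n" for p
  proof -
    have "c p = (\<Sum>b\<in>J - J'. w b * cc b p) + (\<Sum>b\<in>J'. w b * cc b p)"
      unfolding coord[OF that] by (rule sum.subset_diff[OF J'(2) J])
    then show ?thesis by (simp add: dd(2) pathv_def sum_negf cong: sum.cong)
  qed
  consider (unit) p where "p \<in> idx n" "c = punit p" "x p = 0" | (path) d where "tight n a x d" "c =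
      pathv d"
    using c by (auto simp: tightv_iff)
  then show ?thesis
  proof cases
    case (unit p)
    have "J' = {}"
    proof (rule ccontr)
      assume "J' \<noteq> {}"
      then obtain b where b: "b \<in> J'" by blast
      obtain q where q: "q \<in> set (dd b)" "x q \<noteq> 0"
        using tight_meets_support[OF dd(1)[OF b] a] by blast
      have qi: "q \<in> idx n" using dd(1)[OF b] q by (auto simp: tight_def dyck_path_iff)
      have "(\<Sum>b\<in>J - J'. w b * cc b q) = 0" by (rule sum.neutral) (use rest q in auto)
      moreover have "0 < (\<Sum>b\<in>J'. w b * of_bool (q \<in> set (dd b)))"
        by (rule sum_pos2[OF J'(1) b]) (use b q in \<open>auto simp: J'_def\<close>)
      moreover have "c q = 0" using unit q by (auto simp: punit_def)
      ultimately show False using split[OF qi] by simp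
    qed
    then have "(\<Sum>b\<in>J. w b * cc b p) \<noteq> 0" using coord[OF unit(1)] unit by (simp add: punit_def)
    then obtain b where b: "b \<in> J" "w b * cc b p \<noteq> 0" by (rule sum.not_neutral_contains_not_neutral)
    then have "\<not> (\<exists>d. tight n a x d \<and> cc b = pathv d)" using \<open>J' = {}\<close> w[OF b(1)] by (auto simp:
        J'_def)
    then obtain q where "cc b = punit q" using cc[OF b(1)] by (auto simp: tightv_iff)
    then have "cc b = punit p" using b(2) by (auto simp: punit_def split: if_splits)
    then show ?thesis using b unit by auto
  next
    case (path d)
    have dd': "dyck_path n (dd b)" "sum x (set (dd b)) = lam n a (src (dd b)) - lam n a (snk (dd
        b))"
      if "b \<in> J'" for b using dd(1)[OF that] by (auto simp: tight_def)
    have d: "dyck_path n d" and ds: "sum x (set d) = lam n a (src d) - lam n a (snk d)"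
      using path by (auto simp: tight_def)
    have di: "p \<in> idx n" if "p \<in> set d" for p using d that by (auto simp: dyck_path_iff)
    have xsum: "sum x (set e) = (\<Sum>p\<in>idx n. x p * of_bool (p \<in> set e))" if "dyck_path n e" for e
      using ip_pathv[OF that, of x] by (simp add: ip_def pathv_def sum_negf mult.commute)
    have "\<exists>b\<in>J'. set (dd b) = set d"
    proof (rule path_cover_extremal[OF a d J'(1)])
      fix p assume p: "p \<in> set d"
      have "0 \<le> (\<Sum>b\<in>J - J'. w b * cc b p)" by (rule sum_nonneg) (use rest in auto)
      then show "1 \<le> (\<Sum>b\<in>J'. w b * of_bool (p \<in> set (dd b)))"
        using split[OF di[OF p]] path p by (simp add: pathv_def)
    next
      have "(\<Sum>b\<in>J'. w b * (lam n a (src (dd b)) - lam n a (snk (dd b))))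
          = (\<Sum>b\<in>J'. \<Sum>p\<in>idx n. x p * (w b * of_bool (p \<in> set (dd b))))"
        by (rule sum.cong)
          (simp_all only: dd'(2)[symmetric] xsum[OF dd'(1)] sum_distrib_left mult.left_commute)
      also have "\<dots> = (\<Sum>p\<in>idx n. x p * (\<Sum>b\<in>J'. w b * of_bool (p \<in> set (dd b))))"
        by (subst sum.swap) (simp add: sum_distrib_left)
      also have "\<dots> = (\<Sum>p\<in>idx n. x p * of_bool (p \<in> set d))"
      proof (rule sum.cong)
        fix p assume p: "p \<in> idx n"
        show "x p * (\<Sum>b\<in>J'. w b * of_bool (p \<in> set (dd b))) = x p * of_bool (p \<in> set d)"
        proof (cases "x p = 0")
          case False
          have "(\<Sum>b\<in>J - J'. w b * cc b p) = 0" by (rule sum.neutral) (use rest False in auto)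
          then show ?thesis using split[OF p] path by (simp add: pathv_def)
        qed simp
      qed simp
      also have "\<dots> = lam n a (src d) - lam n a (snk d)" using xsum[OF d] ds by simp
      finally show "(\<Sum>b\<in>J'. w b * (lam n a (src (dd b)) - lam n a (snk (dd b))))
        \<le> lam n a (src d) - lam n a (snk d)" by simp
    qed (use dd' in \<open>auto simp: J'_def\<close>)
    then obtain b where "b \<in> J'" "set (dd b) = set d" by blast
    then have "b \<in> J" "cc b = c" using J'(2) dd(2) path pathv_eq_iff by auto
    then show ?thesis by blast
  qed
qed

text \<open>Choose for each generator \<open>b\<close> a tight \<open>cc b\<close> that is positive
  on \<open>b\<close> and zero on the other generators. Comparing values on the basis
  \<open>B\<close> writes any tight \<open>c\<close> as a nonnegative combination of the
  \<open>cc b\<close>, so by extremality \<open>c\<close> is one of them. Up to scaling,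
  \<open>B\<close> is thus dual to the full set of tight functionals.\<close>

lemma simple_vertex_dual:
  assumes a: "\<forall>i\<in>{1..n - 1}. 0 < a i" and v: "simple_vertex n (FFLV n a) x"
  shows "c \<in> tightv n a x \<Longrightarrow> \<exists>b\<in>U_space n. 0 < ip n c b \<and> (\<forall>c'\<in>tightv n a x. c' \<noteq> c \<longrightarrow> ip n c' b = 0)"
    and "y \<in> U_space n \<Longrightarrow> (\<And>c. c \<in> tightv n a x \<Longrightarrow> ip n c y = 0) \<Longrightarrow> y = 0"
proof -
  have x: "x \<in> FFLV n a" using v by (auto simp: simple_vertex_def extreme_point_of_def)
  obtain B where B: "finite B" "B \<subseteq> U_space n"
    "\<And>y. y \<in> U_space n \<Longrightarrow> \<exists>u. y = (\<Sum>b\<in>B. u b *\<^sub>R b)"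
    "\<And>b c. b \<in> B \<Longrightarrow> c \<in> tightv n a x \<Longrightarrow> 0 \<le> ip n c b"
    "\<And>b. b \<in> B \<Longrightarrow> \<exists>c\<in>tightv n a x. 0 < ip n c b \<and> (\<forall>b'\<in>B - {b}. ip n c b' = 0)"
    using v unimodular_tangent_cone_dual[OF x] by (auto simp: simple_vertex_def)
  from B(5) obtain cc where cc: "\<And>b. b \<in> B \<Longrightarrow> cc b \<in> tightv n a x" "\<And>b. b \<in> B \<Longrightarrow> 0 < ip n (cc b) b"
    "\<And>b b'. b \<in> B \<Longrightarrow> b' \<in> B \<Longrightarrow> b' \<noteq> b \<Longrightarrow> ip n (cc b) b' = 0"
    by (metis DiffI singletonD)
  have coeff: "ip n (cc b) (\<Sum>b'\<in>B. u b' *\<^sub>R b') = u b * ip n (cc b) b" if "b \<in> B" for b u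
  proof -
    have "ip n (cc b) (\<Sum>b'\<in>B. u b' *\<^sub>R b') = (\<Sum>b'\<in>B. if b' = b then u b * ip n (cc b) b else 0)"
      unfolding ip_sum ip_scaleR by (rule sum.cong) (use cc that in auto)
    then show ?thesis using B(1) that by simp
  qed
  have comb: "\<exists>b\<in>B. cc b = c" if c: "c \<in> tightv n a x" for c
  proof (rule tightv_extremal[OF x a B(1) c, of cc "\<lambda>b. ip n c b / ip n (cc b) b"])
    fix y assume "y \<in> U_space n"
    then obtain u where u: "y = (\<Sum>b\<in>B. u b *\<^sub>R b)" using B(3) by blast
    show "ip n c y = (\<Sum>b\<in>B. ip n c b / ip n (cc b) b * ip n (cc b) y)"
      unfolding u
    proof (subst ip_sum, rule sum.cong)
      fix b assume b: "b \<in> B"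
      show "ip n c (u b *\<^sub>R b) = ip n c b / ip n (cc b) b * ip n (cc b) (\<Sum>b\<in>B. u b *\<^sub>R b)"
        unfolding coeff[OF b] using cc(2)[OF b] by simp
    qed simp
  qed (use cc(1,2) B(4)[OF _ c] in \<open>auto intro!: divide_nonneg_pos\<close>)
  show "\<exists>b\<in>U_space n. 0 < ip n c b \<and> (\<forall>c'\<in>tightv n a x. c' \<noteq> c \<longrightarrow> ip n c' b = 0)"
    if c: "c \<in> tightv n a x"
  proof -
    obtain b where b: "b \<in> B" "cc b = c" using comb[OF c] by blast
    have "ip n c' b = 0" if c': "c' \<in> tightv n a x" "c' \<noteq> c" for c'
      using comb[OF c'(1)] b c'(2) cc(3) by metis
    then show ?thesis using b B(2) cc(2) by blast
  qed
  show "y = 0" if y: "y \<in> U_space n" "\<And>c. c \<in> tightv n a x \<Longrightarrow> ip n c y = 0"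
  proof -
    obtain u where u: "y = (\<Sum>b\<in>B. u b *\<^sub>R b)" using B(3)[OF y(1)] by blast
    have "u b = 0" if "b \<in> B" for b
      using coeff[OF that, of u] y(2)[OF cc(1)[OF that]] cc(2)[OF that] u by auto
    then show ?thesis unfolding u by (intro sum.neutral) auto
  qed
qed

section \<open>Tight paths at a simple vertex\<close>

text \<open>A Dyck path that contains the pair of its ends is a hook by
  \<open>dyck_path_hook_iff\<close>, so the second clause says that the tight paths are hooks at
  support points.\<close>

definition hook_vertex :: "nat \<Rightarrow> (nat \<Rightarrow> nat) \<Rightarrow> (nat \<times> nat \<Rightarrow> real) \<Rightarrow> bool" where
  "hook_vertex n a x \<longleftrightarrow>
     (\<forall>i j. (i, j) \<in> idx n \<longrightarrow> x (i, j) \<noteq> 0 \<longrightarrow> tight n a x (hook i j)) \<and>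
     (\<forall>d. tight n a x d \<longrightarrow> (src d, snk d) \<in> set d \<and> x (src d, snk d) \<noteq> 0)"

text \<open>The corner is the only point of a hook with maximal difference of coordinates, so
  induction on this difference solves for the value at the corner.\<close>

lemma hook_system_trivial:
  fixes x y :: "nat \<times> nat \<Rightarrow> real"
  assumes U: "y \<in> U_space n"
    and Z: "\<And>p. p \<in> idx n \<Longrightarrow> x p = 0 \<Longrightarrow> y p = 0"
    and S: "\<And>i j. (i, j) \<in> idx n \<Longrightarrow> x (i, j) \<noteq> 0 \<Longrightarrow> sum y (set (hook i j)) = 0"
  shows "y = 0"
proof -
  have "y (i, j) = 0" for i j
  proof (induction "j - i" arbitrary: i j rule: less_induct)
    case less
    show ?case
    proof (cases "(i, j) \<in> idx n \<and> x (i, j) \<noteq> 0")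
      case True
      then have "i < j" by simp
      have "(\<Sum>k\<in>{i<..<j}. y (i, k)) = 0" "(\<Sum>k\<in>{i<..<j}. y (k, j)) = 0"
        by (rule sum.neutral; use less in auto)+
      then show ?thesis using S[of i j] True sum_hook_corner[OF \<open>i < j\<close>, of y] by simp
    next
      case False
      then show ?thesis using U Z[of "(i, j)"] by (auto simp: U_space_def)
    qed
  qed
  then show ?thesis by (auto simp: fun_eq_iff)
qed

text \<open>With the diagonal points added, the two ends of a path are edges like the other ones.\<close>

definition ext :: "(nat \<times> nat) list \<Rightarrow> (nat \<times> nat) list" where
  "ext d = (src d, src d) # d @ [(snk d, snk d)]"

lemma ext_inj: "ext d = ext e \<Longrightarrow> d = e"
  by (simp add: ext_def)

text \<open>From \<open>(s, s)\<close> the only step into \<open>idx n\<close> leads to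
  \<open>(s, s + 1)\<close>, and \<open>(t, t)\<close> is entered only from
  \<open>(t - 1, t)\<close>. The conditions on the ends of a Dyck path thus become ordinary step
  conditions.\<close>

lemma dyck_path_ext_iff:
  "dyck_path n d \<and> src d = s \<and> snk d = t \<longleftrightarrow>
     d \<noteq> [] \<and> set d \<subseteq> idx n \<and> successively lstep ((s, s) # d @ [(t, t)])"
proof (cases "d = []")
  case False
  then have "hd d \<in> set d" "last d \<in> set d" by auto
  then have "lstep (s, s) (hd d) \<longleftrightarrow> hd d = (s, s + 1)" "lstep (last d) (t, t) \<longleftrightarrow> last d = (t - 1, t) \<and>
      0 < t"
    if "set d \<subseteq> idx n"
    using that by (cases "hd d"; cases "last d"; force simp: lstep_def)+
  moreover have "successively lstep ((s, s) # d @ [(t, t)]) \<longleftrightarrow>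
      lstep (s, s) (hd d) \<and> successively lstep d \<and> lstep (last d) (t, t)"
    using False by (auto simp: successively_Cons successively_append_iff)
  moreover have "0 < snd (last d)" if "set d \<subseteq> idx n"
    using that \<open>last d \<in> set d\<close> by (cases "last d") auto
  ultimately show ?thesis
    using False by (auto simp: dyck_path_iff src_def snk_def prod_eq_iff)
qed (simp add: dyck_path_iff)

lemma dyck_path_ext: "dyck_path n d \<Longrightarrow> successively lstep (ext d)"
  using dyck_path_ext_iff[of n d "src d" "snk d"] by (simp add: ext_def)

lemma ext_split:
  assumes "ext d = U @ p # V" "fst p \<noteq> snd p"
  obtains u v where "d = u @ p # v" "U = (src d, src d) # u" "V = v @ [(snk d, snk d)]"
proof -
  have "U \<noteq> []" using assms by (auto simp: ext_def)
  then obtain u where U: "U = (src d, src d) # u"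
    using assms(1) by (cases U) (simp_all add: ext_def)
  have "last (ext d) = (snk d, snk d)" by (simp add: ext_def)
  then have "V \<noteq> []" "last (p # V) = (snk d, snk d)" using assms by auto
  then have V: "V = butlast V @ [(snk d, snk d)]" by (metis append_butlast_last_id last.simps)
  have "d @ [(snk d, snk d)] = (u @ p # butlast V) @ [(snk d, snk d)]"
    using assms(1) V unfolding ext_def U by simp
  then show ?thesis using that[OF _ U V] by blast
qed

lemma tight_ext_swap:
  assumes x: "x \<in> FFLV n a" and "tight n a x d" "tight n a x d'"
    and "ext d = U @ p # V" "ext d' = U' @ p # V'" and p: "fst p \<noteq> snd p"
  shows "\<exists>e. tight n a x e \<and> ext e = U @ p # V'"
proof -
  obtain u v where 1: "d = u @ p # v" "U = (src d, src d) # u" "V = v @ [(snk d, snk d)]"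
    using ext_split[OF assms(4) p] .
  obtain u' v' where 2: "d' = u' @ p # v'" "U' = (src d', src d') # u'" "V' = v' @ [(snk d', snk
      d')]"
    using ext_split[OF assms(5) p] .
  have "tight n a x (u @ p # v')"
    using tight_swap[OF x] assms(2,3) 1(1) 2(1) by blast
  moreover have "src (u @ p # v') = src d" "snk (u @ p # v') = snk d'"
    using 1 2 by (simp_all add: src_def snk_def hd_append)
  then have "ext (u @ p # v') = U @ p # V'" using 1 2 by (simp add: ext_def)
  ultimately show ?thesis by blast
qed

lemma ext_interior:
  assumes "ext d = U @ q # p # r # V" shows "p \<in> set d"
proof -
  have "d = butlast (tl (ext d))" by (simp add: ext_def)
  also have "\<dots> = tl (U @ [q]) @ p # butlast (r # V)"
    unfolding assms by (cases U) (auto simp: butlast_append)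
  finally show ?thesis by simp
qed

lemma ext_off_diagonal: "p \<in> set (ext d) \<Longrightarrow> fst p \<noteq> snd p \<Longrightarrow> p \<in> set d"
  by (auto simp: ext_def)

section \<open>The graph of tight edges\<close>

definition tedge :: "nat \<Rightarrow> (nat \<Rightarrow> nat) \<Rightarrow> (nat \<times> nat \<Rightarrow> real) \<Rightarrow> nat \<times> nat \<Rightarrow> nat \<times> nat \<Rightarrow> bool" where
  "tedge n a x q p \<longleftrightarrow> (\<exists>d U V. tight n a x d \<and> ext d = U @ q # p # V)"

text \<open>Exchanging tails at \<open>p\<close> makes tightness a local property: consecutive tight
  edges can be realised on one tight path.\<close>

lemma tedge_combine:
  assumes "x \<in> FFLV n a" "tedge n a x q p" "tedge n a x p r" "fst p \<noteq> snd p"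
  shows "\<exists>d U V. tight n a x d \<and> ext d = U @ q # p # r # V"
proof -
  obtain d U V d' U' V' where "tight n a x d" "ext d = U @ q # p # V"
    "tight n a x d'" "ext d' = U' @ p # r # V'"
    using assms by (auto simp: tedge_def)
  then show ?thesis
    using tight_ext_swap[OF assms(1), of d d' "U @ [q]" p V U' "r # V'"] assms(4) by auto
qed

text \<open>In the application \<open>q # p # e\<close> is an extended path,
  \<open>butlast (p # e)\<close> is the Dyck path itself, and \<open>g\<close> labels its
  edges.\<close>

lemma telescope:
  fixes y :: "'a \<Rightarrow> real"
  assumes "\<And>U q' p' r V. q # p # e = U @ q' # p' # r # V \<Longrightarrow> y p' = g p' r - g q' p'"
    and "q # p # e = U @ [q', p']"
  shows "sum_list (map y (butlast (p # e))) = g q' p' - g q p"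
  using assms
proof (induction e arbitrary: q p U)
  case Nil
  have "U = []" using arg_cong[OF Nil.prems(2), of length] by simp
  then show ?case using Nil.prems(2) by simp
next
  case (Cons r e)
  have 1: "y p = g p r - g q p" by (rule Cons.prems(1)[of "[]"]) simp
  obtain U1 where U1: "U = q # U1" using Cons.prems(2) by (cases U) auto
  have "sum_list (map y (butlast (r # e))) = g q' p' - g p r"
  proof (rule Cons.IH)
    show "y p' = g p' r' - g q' p'" if "p # r # e = U @ q' # p' # r' # V" for U q' p' r' V
      by (rule Cons.prems(1)[of "q # U" q' p' r' V]) (simp add: that)
    show "p # r # e = U1 @ [q', p']" using Cons.prems(2) U1 by simp
  qed
  then show ?case using 1 by simp
qed

lemma edge_constant:
  assumes "\<And>U q' p' r V. q # p # e = U @ q' # p' # r # V \<Longrightarrow> g p' r = g q' p'"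
    and "q # p # e = U @ q' # p' # V"
  shows "g q' p' = g q p"
  using assms
proof (induction e arbitrary: q p U)
  case Nil
  have "U = []" using arg_cong[OF Nil.prems(2), of length] by simp
  then show ?case using Nil.prems(2) by simp
next
  case (Cons r e)
  show ?case
  proof (cases U)
    case (Cons q0 U1)
    have "g p r = g q p" by (rule Cons.prems(1)[of "[]"]) simp
    moreover have "g q' p' = g p r"
    proof (rule Cons.IH)
      show "g p' r' = g q' p'" if "p # r # e = U @ q' # p' # r' # V" for U q' p' r' V
        by (rule Cons.prems(1)[of "q # U" q' p' r' V]) (simp add: that)
      show "p # r # e = U1 @ q' # p' # V" using Cons.prems(2) Cons by simp
    qed
    ultimately show ?thesis by simp
  qed (use Cons.prems(2) in auto)
qed

text \<open>
  A perturbation of the support that preserves all tight paths is the difference of the values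
  leaving and entering each point, for an edge labelling with value \<open>0\<close> at the ends of the paths,
  with equal values on all edges that leave (or enter) a common point, and with unchanged value at
  the zeros of \<open>x\<close>. The labelling below is the indicator of the edges that are not forced to have
  value \<open>0\<close>: \<open>edge_val\<close> says that the edge leaving \<open>(i, j)\<close> to the right (for \<open>True\<close>) or downwards
  (for \<open>False\<close>) is forced. Values are passed on only towards the diagonal: from a down edge into a
  support point to the edge entering it from the left, and from a right edge out of a support point
  to the down edge leaving it.
\<close>

function edge_val :: "(nat \<times> nat \<Rightarrow> bool) \<Rightarrow> (nat \<times> nat \<Rightarrow> bool) \<Rightarrow> (nat \<times> nat \<Rightarrow> bool) \<Rightarrow> bool \<Rightarrow> nat \<Rightarrow>
    nat \<Rightarrow> bool" where
  "edge_val R D S True i j =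
     (if j \<le> i then True else if S (i, j) then D (i, j) \<and> edge_val R D S False i j
      else edge_val R D S True i (j - 1))"
| "edge_val R D S False i j =
     (if j \<le> i + 1 then True else if S (i + 1, j) then R (i + 1, j - 1) \<and> edge_val R D S True (i +
         1) (j - 1)
      else edge_val R D S False (i + 1) j)"
  by pat_completeness auto
termination
  \<comment> \<open>Every call moves closer to the diagonal, except the one from a right edge to the
    down edge at the same point; the boolean accounts for it.\<close>
  by (relation "Wellfounded.measure (\<lambda>(R, D, S, b, i, j). 2 * (j - i) + of_bool b)") auto

declare edge_val.simps [simp del]

context
  fixes n :: nat and a :: "nat \<Rightarrow> nat" and x :: "nat \<times> nat \<Rightarrow> real"
  assumes a: "\<forall>i\<in>{1..n - 1}. 0 < a i" and v: "simple_vertex n (FFLV n a) x"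
begin

lemma simple_vertex_mem: "x \<in> FFLV n a"
  using v by (auto simp: simple_vertex_def extreme_point_of_def)

lemma simple_vertex_path_dual:
  assumes "tight n a x d"
  shows "\<exists>b\<in>U_space n. sum b (set d) \<noteq> 0 \<and> (\<forall>p\<in>idx n. x p = 0 \<longrightarrow> b p = 0) \<and>
    (\<forall>e. tight n a x e \<longrightarrow> set e \<noteq> set d \<longrightarrow> sum b (set e) = 0)"
proof -
  have "pathv d \<in> tightv n a x" using assms by (auto simp: tightv_iff)
  then obtain b where b: "b \<in> U_space n" "0 < ip n (pathv d) b"
    "\<And>c'. c' \<in> tightv n a x \<Longrightarrow> c' \<noteq> pathv d \<Longrightarrow> ip n c' b = 0"
    using simple_vertex_dual(1)[OF a v] by blast
  show ?thesis
  proof (intro bexI[of _ b] conjI ballI allI impI)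
    show "sum b (set d) \<noteq> 0" using b(2) assms by (auto simp: tight_def ip_pathv)
    show "b p = 0" if "p \<in> idx n" "x p = 0" for p
    proof -
      have "punit p \<in> tightv n a x" using that by (auto simp: tightv_iff)
      moreover have "punit p p \<noteq> pathv d p" by (simp add: punit_def pathv_def)
      then have "punit p \<noteq> pathv d" by metis
      ultimately show ?thesis using b(3) that by fastforce
    qed
    show "sum b (set e) = 0" if "tight n a x e" "set e \<noteq> set d" for e
      using b(3)[of "pathv e"] that by (auto simp: tightv_iff pathv_eq_iff tight_def ip_pathv)
    show "b \<in> U_space n" by (rule b(1))
  qed
qed

text \<open>Replacing \<open>p\<close> by \<open>p'\<close> gives a path with the same ends, whose
  bound forces \<open>x p' = 0\<close>; it is therefore tight too. Then the two path functionals and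
  the unit functionals at \<open>p\<close> and \<open>p'\<close> satisfy a linear relation, which
  the dual vector of \<open>d\<close> excludes.\<close>

lemma no_flip:
  assumes d: "tight n a x d" and e: "ext d = U @ q # p # r # V"
    and p: "x p = 0" and p': "p' \<in> idx n" "p' \<noteq> p" "lstep q p'" "lstep p' r"
  shows False
proof -
  have dy: "dyck_path n d" using d by (simp add: tight_def)
  have pd: "p \<in> set d" by (rule ext_interior[OF e])
  then have pi: "p \<in> idx n" using dy by (auto simp: dyck_path_iff)
  then have "fst p \<noteq> snd p" by (cases p) auto
  moreover have "ext d = (U @ [q]) @ p # (r # V)" using e by simp
  ultimately obtain u w where uw: "d = u @ p # w" "U @ [q] = (src d, src d) # u" "r # V = w @ [(snk
      d, snk d)]"
    using ext_split by metis
  let ?d = "u @ p' # w"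
  have "successively lstep ((U @ [q]) @ p # (r # V))" using dyck_path_ext[OF dy] e by simp
  then have "successively lstep ((U @ [q]) @ p' # (r # V))"
    using p' by (auto simp: successively_append_iff successively_Cons)
  then have "successively lstep ((src d, src d) # ?d @ [(snk d, snk d)])"
    unfolding uw by simp
  moreover have "set ?d \<subseteq> idx n" using dy p' uw(1) by (auto simp: dyck_path_iff)
  ultimately have dy': "dyck_path n ?d" and ends: "src ?d = src d" "snk ?d = snk d"
    using dyck_path_ext_iff[of n ?d "src d" "snk d"] by auto
  have dis: "distinct d" "distinct ?d"
    using dy dy' lattice_path_distinct unfolding dyck_path_iff by blast+
  have sm: "sum y (set d) = sum y (set u) + sum y (set w) + y p"
    "sum y (set ?d) = sum y (set u) + sum y (set w) + y p'" for y :: "nat \<times> nat \<Rightarrow> real"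
    using sum_set_append[of u "p # w" y] sum_set_append[of u "p' # w" y] dis uw(1) by auto
  have x0: "0 \<le> x p'" using simple_vertex_mem p' by (auto simp: FFLV_iff)
  have "sum x (set ?d) \<le> lam n a (src d) - lam n a (snk d)"
    using simple_vertex_mem dy' ends by (auto simp: FFLV_iff)
  then have xp': "x p' = 0" using d sm[of x] p x0 by (auto simp: tight_def)
  have t': "tight n a x ?d"
    using d sm[of x] p xp' dy' ends by (auto simp: tight_def)
  have "p \<notin> set ?d" using dis(1) uw(1) p'(2) by auto
  then have ne: "set ?d \<noteq> set d" using pd by blast
  obtain b where b: "sum b (set d) \<noteq> 0" "\<And>p. p \<in> idx n \<Longrightarrow> x p = 0 \<Longrightarrow> b p = 0"
    "\<And>e. tight n a x e \<Longrightarrow> set e \<noteq> set d \<Longrightarrow> sum b (set e) = 0" "b \<in> U_space n"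
    using simple_vertex_path_dual[OF d] by blast
  show False using b(1) b(2)[OF pi p] b(2)[OF p'(1) xp'] b(3)[OF t' ne] sm[of b] by simp
qed

text \<open>In general the peak flips to \<open>(i + 1, j)\<close>. Near the diagonal this point
  does not belong to \<open>idx n\<close>: for \<open>j = i\<close> the path consists of the zero
  alone and cannot be tight, and for \<open>j = i + 1\<close> removing the peak cuts the path into
  two Dyck paths. These are tight because their bounds add up, and again a linear relation between
  tight functionals arises.\<close>

lemma no_zero_peak:
  assumes R: "tedge n a x (i, j) (i, j + 1)" and D: "tedge n a x (i, j + 1) (i + 1, j + 1)"
    and ij: "i \<le> j" and z: "x (i, j + 1) = 0"
  shows False
proof -
  obtain d U V where d: "tight n a x d" and e: "ext d = U @ (i, j) # (i, j + 1) # (i + 1, j + 1) #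
      V"
    using tedge_combine[OF simple_vertex_mem R D] ij by auto
  have dy: "dyck_path n d" using d by (simp add: tight_def)
  have pi: "(i, j + 1) \<in> idx n" using ext_interior[OF e] dy by (auto simp: dyck_path_iff)
  consider "j = i" | "j = i + 1" | "i + 1 < j" using ij by linarith
  then show False
  proof cases
    case 1
    have "fst (i, j + 1) \<noteq> snd (i, j + 1)" using ij by simp
    moreover have "ext d = (U @ [(i, j)]) @ (i, j + 1) # ((i + 1, j + 1) # V)" using e by simp
    ultimately obtain u w where uw: "d = u @ (i, j + 1) # w" "U @ [(i, j)] = (src d, src d) # u"
      "(i + 1, j + 1) # V = w @ [(snk d, snk d)]"
      using ext_split by metis
    have "u = []"
      using uw(1,2) dy 1 by (cases u rule: rev_cases) (auto simp: dyck_path_iff)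
    moreover have "w = []"
      using uw(1,3) dy 1 by (cases w) (auto simp: dyck_path_iff)
    ultimately have "d = [(i, j + 1)]" using uw(1) by simp
    then show False using tight_meets_support[OF d a] z by simp
  next
    case 2
    have "fst (i, j + 1) \<noteq> snd (i, j + 1)" using ij by simp
    moreover have "ext d = (U @ [(i, j)]) @ (i, j + 1) # ((i + 1, j + 1) # V)" using e by simp
    ultimately obtain u w where uw: "d = u @ (i, j + 1) # w" "U @ [(i, j)] = (src d, src d) # u"
      "(i + 1, j + 1) # V = w @ [(snk d, snk d)]"
      using ext_split by metis
    obtain u' where u': "u = u' @ [(i, j)]"
      using uw(2) 2 by (cases u rule: rev_cases) auto
    obtain w' where w': "w = (i + 1, j + 1) # w'"
      using uw(3) 2 by (cases w) auto
    have hd: "src u = src d" "snk w = snk d" "snk u = j" "src w = j"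
      using uw(1) u' w' 2 by (simp_all add: src_def snk_def hd_append)
    have dyu: "dyck_path n u" "dyck_path n w"
      using dy uw(1) u' w' 2 by (auto simp: dyck_path_iff successively_append_iff hd_append)
    have dis: "distinct d" using dy lattice_path_distinct by (auto simp: dyck_path_iff)
    have sm: "sum y (set d) = sum y (set u) + sum y (set w) + y (i, j + 1)" for y :: "nat \<times> nat \<Rightarrow>
        real"
      using sum_set_append[of u "(i, j + 1) # w" y] dis uw(1) by auto
    have "sum x (set u) \<le> lam n a (src d) - lam n a j" "sum x (set w) \<le> lam n a j - lam n a (snk d)"
      using simple_vertex_mem dyu hd by (auto simp: FFLV_iff)
    moreover have "sum x (set u) + sum x (set w) = lam n a (src d) - lam n a (snk d)"
      using d sm[of x] z by (simp add: tight_def)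
    ultimately have t: "tight n a x u" "tight n a x w" using dyu hd by (auto simp: tight_def)
    have "(i, j + 1) \<in> set d" "(i, j + 1) \<notin> set u" "(i, j + 1) \<notin> set w"
      using dis uw(1) by auto
    then have ne: "set u \<noteq> set d" "set w \<noteq> set d" by blast+
    obtain b where b: "sum b (set d) \<noteq> 0" "\<And>p. p \<in> idx n \<Longrightarrow> x p = 0 \<Longrightarrow> b p = 0"
      "\<And>e. tight n a x e \<Longrightarrow> set e \<noteq> set d \<Longrightarrow> sum b (set e) = 0" "b \<in> U_space n"
      using simple_vertex_path_dual[OF d] by blast
    show False
      using b(1) b(2)[OF pi z] b(3)[OF t(1) ne(1)] b(3)[OF t(2) ne(2)] sm[of b] by simp
  next
    case 3
    show False
      by (rule no_flip[OF d e z, of "(i + 1, j)"]) (use 3 pi in \<open>auto simp: lstep_def\<close>)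
  qed
qed

text \<open>A valley flips away from the diagonal, so no boundary cases arise.\<close>

lemma no_zero_valley:
  assumes D: "tedge n a x (i, j) (i + 1, j)" and R: "tedge n a x (i + 1, j) (i + 1, j + 1)"
    and ij: "i + 1 < j" and z: "x (i + 1, j) = 0"
  shows False
proof -
  obtain d U V where d: "tight n a x d" and e: "ext d = U @ (i, j) # (i + 1, j) # (i + 1, j + 1) #
      V"
    using tedge_combine[OF simple_vertex_mem D R] ij by auto
  have dy: "dyck_path n d" using d by (simp add: tight_def)
  have "(i, j) \<in> set (ext d)" "(i + 1, j + 1) \<in> set (ext d)" unfolding e by auto
  then have "(i, j) \<in> set d" "(i + 1, j + 1) \<in> set d"
    using ij by (auto dest!: ext_off_diagonal)
  then have "(i, j) \<in> idx n" "(i + 1, j + 1) \<in> idx n" using dy by (auto simp: dyck_path_iff)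
  then show False
    by (intro no_flip[OF d e z, of "(i, j + 1)"]) (auto simp: lstep_def)
qed

abbreviation (input) "tR p \<equiv> tedge n a x p (fst p, snd p + 1)"
abbreviation (input) "tD p \<equiv> tedge n a x p (fst p + 1, snd p)"
abbreviation (input) "ev \<equiv> edge_val (\<lambda>p. tR p) (\<lambda>p. tD p) (\<lambda>p. x p \<noteq> 0)"

text \<open>Let \<open>g\<close> be 1 on unforced edges and 0 on forced ones. Along a tight path
  \<open>y\<close> telescopes to the difference of the labels of the two end edges, which are both
  0, so every tight functional kills \<open>y\<close> and \<open>y\<close> vanishes. Hence labels
  are constant along a tight path and equal to the 0 of its first edge. The gain is that at a
  support point being forced also requires the edge referred to to be tight.\<close>

lemma tedge_good:
  assumes "tedge n a x q p"
  shows "ev (fst p = fst q) (fst q) (snd q)"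
proof -
  define g :: "nat \<times> nat \<Rightarrow> nat \<times> nat \<Rightarrow> real" where
    "g q p = of_bool (\<not> ev (fst p = fst q) (fst q) (snd q))" for q p
  \<comment> \<open>At a support point every tight outgoing edge has the label of the down edge and
    every tight incoming edge that of the edge from the left, where a missing edge counts as
    unforced. So \<open>y\<close> is the outgoing minus the incoming label.\<close>
  define y :: "nat \<times> nat \<Rightarrow> real" where
    "y p = (if x p \<noteq> 0 then of_bool (\<not> (tD p \<and> ev False (fst p) (snd p)))
       - of_bool (\<not> (tR (fst p, snd p - 1) \<and> ev True (fst p) (snd p - 1))) else 0)" for p
  have node: "y p = g p r - g q p" if d: "tight n a x d" and e: "ext d = U @ q # p # r # V" for d U
      q p r V
  proof -
    have dy: "dyck_path n d" using d by (simp add: tight_def)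
    have pi: "p \<in> idx n" using ext_interior[OF e] dy by (auto simp: dyck_path_iff)
    obtain i j where p: "p = (i, j)" by (cases p)
    have ij: "i < j" "1 \<le> i" using pi p by auto
    have st: "lstep q p" "lstep p r"
      using dyck_path_ext[OF dy] unfolding e by (auto simp: successively_append_iff)
    have tqp: "tedge n a x q p" unfolding tedge_def using d e by blast
    have "ext d = (U @ [q]) @ p # r # V" using e by simp
    then have tpr: "tedge n a x p r" unfolding tedge_def using d by blast
    have ins: "q = (i, j - 1) \<or> q = (i - 1, j)" using st(1) p ij by (cases q) (auto simp: lstep_def)
    have outs: "r = (i, j + 1) \<or> r = (i + 1, j)" using st(2) p by (auto simp: lstep_def)
    have ne: "(i = i - 1) = False" using ij by simp
    have i1: "i - 1 + 1 = i" and j1: "j - 1 + 1 = j" using ij by auto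
    have EF: "ev False (i - 1) j = (if x (i, j) \<noteq> 0 then tR (i, j - 1) \<and> ev True i (j - 1) else ev
        False i j)"
      by (subst edge_val.simps(2)) (use ij in simp)
    have ET: "ev True i j = (if x (i, j) \<noteq> 0 then tD (i, j) \<and> ev False i j else ev True i (j - 1))"
      by (subst edge_val.simps(1)) (use ij in simp)
    have gin: "g q p = of_bool (\<not> (tR (i, j - 1) \<and> ev True i (j - 1)))" if "x (i, j) \<noteq> 0"
      using ins
    proof
      assume q: "q = (i, j - 1)"
      then have "tR (i, j - 1)" using tqp p j1 by simp
      then show ?thesis using q p by (simp add: g_def)
    next
      assume q: "q = (i - 1, j)"
      have "g q p = of_bool (\<not> ev False (i - 1) j)" unfolding g_def p q fst_conv snd_conv ne by
          (rule refl)
      then show ?thesis unfolding EF using that by simp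
    qed
    have gout: "g p r = of_bool (\<not> (tD (i, j) \<and> ev False i j))" if "x (i, j) \<noteq> 0"
      using outs
    proof
      assume r: "r = (i, j + 1)"
      then have "g p r = of_bool (\<not> ev True i j)" using p by (simp add: g_def)
      then show ?thesis unfolding ET using that by simp
    next
      assume r: "r = (i + 1, j)"
      then have "tD (i, j)" using tpr p by simp
      then show ?thesis using r p by (simp add: g_def)
    qed
    show ?thesis
    proof (cases "x (i, j) = 0")
      case False
      then show ?thesis using gin gout p by (simp add: y_def)
    next
      case True
      \<comment> \<open>A tight path goes straight through a zero of \<open>x\<close>, and there
        \<open>edge_val\<close> passes the value on unchanged.\<close>
      have "g p r = g q p"
        using ins
      proof
        assume q: "q = (i, j - 1)"
        have "r \<noteq> (i + 1, j)"
        proof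
          assume r: "r = (i + 1, j)"
          show False
            by (rule no_zero_peak[of i "j - 1"]) (use tqp tpr q r p ij True j1 in auto)
        qed
        then have r: "r = (i, j + 1)" using outs by blast
        then have "g p r = of_bool (\<not> ev True i j)" using p by (simp add: g_def)
        then show ?thesis unfolding ET using True q p by (simp add: g_def)
      next
        assume q: "q = (i - 1, j)"
        have "r \<noteq> (i, j + 1)"
        proof
          assume r: "r = (i, j + 1)"
          show False
            by (rule no_zero_valley[of "i - 1" j]) (use tqp tpr q r p ij True i1 in auto)
        qed
        then have r: "r = (i + 1, j)" using outs by blast
        have "g q p = of_bool (\<not> ev False (i - 1) j)" unfolding g_def p q fst_conv snd_conv ne ..
        then show ?thesis unfolding EF using True r p by (simp add: g_def)
      qed
      then show ?thesis using True p by (simp add: y_def)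
    qed
  qed
  have ends: "ext d = (src d, src d) # (src d, src d + 1) # tl d @ [(snk d, snk d)]"
    "ext d = ((src d, src d) # butlast d) @ [(snk d - 1, snk d), (snk d, snk d)]"
    "g (src d, src d) (src d, src d + 1) = 0" "g (snk d - 1, snk d) (snk d, snk d) = 0"
    if d: "dyck_path n d" for d
  proof -
    have "d \<noteq> []" using d by (simp add: dyck_path_iff)
    then have h: "d = hd d # tl d" and l: "d = butlast d @ [last d]" by simp_all
    show "ext d = (src d, src d) # (src d, src d + 1) # tl d @ [(snk d, snk d)]"
      using h dyck_path_ends(4)[OF d] unfolding ext_def by (metis append_Cons)
    show "ext d = ((src d, src d) # butlast d) @ [(snk d - 1, snk d), (snk d, snk d)]"
      using l dyck_path_ends(5)[OF d] unfolding ext_def by (metis append.assoc append_Cons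
          append_Nil)
    show "g (src d, src d) (src d, src d + 1) = 0" by (simp add: g_def edge_val.simps)
    have "(snk d = snk d - 1) = False" using dyck_path_ends[OF d] by auto
    then show "g (snk d - 1, snk d) (snk d, snk d) = 0"
      unfolding g_def fst_conv snd_conv by (simp add: edge_val.simps)
  qed
  have "sum y (set d) = 0" if d: "tight n a x d" for d
  proof -
    have dy: "dyck_path n d" using d by (simp add: tight_def)
    note E = ends[OF dy]
    let ?e = "tl d @ [(snk d, snk d)]"
    have "sum_list (map y (butlast ((src d, src d + 1) # ?e)))
        = g (snk d - 1, snk d) (snk d, snk d) - g (src d, src d) (src d, src d + 1)"
    proof (rule telescope)
      show "y p' = g p' r - g q' p'"
        if "(src d, src d) # (src d, src d + 1) # ?e = U @ q' # p' # r # V" for U q' p' r V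
        by (rule node[OF d trans[OF E(1) that]])
      show "(src d, src d) # (src d, src d + 1) # ?e = ((src d, src d) # butlast d) @ [(snk d - 1,
          snk d), (snk d, snk d)]"
        using E(1,2) by simp
    qed
    moreover have "butlast ((src d, src d + 1) # ?e) = d"
      using E(1) by (simp add: ext_def butlast_append)
    ultimately have "sum_list (map y d) = 0" unfolding E(3,4) by (simp only: diff_self)
    moreover have "distinct d" using dy lattice_path_distinct by (auto simp: dyck_path_iff)
    ultimately show ?thesis by (simp add: sum_list_distinct_conv_sum_set)
  qed
  then have "ip n c y = 0" if "c \<in> tightv n a x" for c
    using that by (auto simp: tightv_iff tight_def ip_pathv y_def)
  moreover have "y \<in> U_space n"
    using simple_vertex_mem by (auto simp: U_space_def y_def FFLV_iff)
  ultimately have y0: "y = 0" using simple_vertex_dual(2)[OF a v] by blast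
  obtain d U V where d: "tight n a x d" and e: "ext d = U @ q # p # V"
    using assms by (auto simp: tedge_def)
  have dy: "dyck_path n d" using d by (simp add: tight_def)
  note E = ends[OF dy]
  have "g q p = g (src d, src d) (src d, src d + 1)"
  proof (rule edge_constant[where g = g and e = "tl d @ [(snk d, snk d)]"])
    show "g p' r = g q' p'"
      if "(src d, src d) # (src d, src d + 1) # tl d @ [(snk d, snk d)] = U @ q' # p' # r # V" for U
          q' p' r V
    proof -
      have "y p' = g p' r - g q' p'" by (rule node[OF d trans[OF E(1) that]])
      then show ?thesis using y0 by simp
    qed
    show "(src d, src d) # (src d, src d + 1) # tl d @ [(snk d, snk d)] = U @ q # p # V"
      using E(1) e by simp
  qed
  then show ?thesis using E(3) by (simp add: g_def)
qed

text \<open>Otherwise all tight functionals vanish on the unit vector at \<open>p\<close>.\<close>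

lemma simple_vertex_support_tight:
  assumes "p \<in> idx n" "x p \<noteq> 0"
  shows "\<exists>d. tight n a x d \<and> p \<in> set d"
proof (rule ccontr)
  assume neg: "\<not> ?thesis"
  have "ip n c (punit p) = 0" if "c \<in> tightv n a x" for c
    unfolding ip_punit_right[OF assms(1)]
    using that neg assms by (auto simp: tightv_iff punit_def pathv_def)
  then have "punit p = 0"
    using simple_vertex_dual(2)[OF a v U_space_punit[OF assms(1)]] by blast
  then have "punit p p = 0" by simp
  then show False by (simp add: punit_def)
qed

text \<open>A tight path through the point that arrives from above or leaves to the right does so
  along a forced edge. Unfolding what forced means at a support point gives the tight edge from the
  left, respectively downwards.\<close>

lemma simple_vertex_support_edges:
  assumes "(i, j) \<in> idx n" "x (i, j) \<noteq> 0"
  shows "tR (i, j - 1)" "tD (i, j)"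
proof -
  have ij: "i < j" "1 \<le> i" using assms(1) by auto
  obtain d where d: "tight n a x d" "(i, j) \<in> set d"
    using simple_vertex_support_tight[OF assms] by blast
  have dy: "dyck_path n d" using d by (simp add: tight_def)
  obtain u w where "d = u @ (i, j) # w" using d(2) by (meson split_list)
  then have "ext d = ((src d, src d) # u) @ (i, j) # (w @ [(snk d, snk d)])" by (simp add: ext_def)
  moreover obtain U q where "(src d, src d) # u = U @ [q]" by (meson neq_Nil_conv rev_exhaust)
  moreover obtain r V where "w @ [(snk d, snk d)] = r # V" by (metis append_is_Nil_conv list.exhaust
      not_Cons_self2)
  ultimately have e: "ext d = U @ q # (i, j) # r # V" by simp
  have st: "lstep q (i, j)" "lstep (i, j) r"
    using dyck_path_ext[OF dy] unfolding e by (auto simp: successively_append_iff)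
  have tqp: "tedge n a x q (i, j)" unfolding tedge_def using d e by blast
  have "ext d = (U @ [q]) @ (i, j) # r # V" using e by simp
  then have tpr: "tedge n a x (i, j) r" unfolding tedge_def using d by blast
  have ins: "q = (i, j - 1) \<or> q = (i - 1, j)" using st(1) ij by (cases q) (auto simp: lstep_def)
  have outs: "r = (i, j + 1) \<or> r = (i + 1, j)" using st(2) by (auto simp: lstep_def)
  show "tR (i, j - 1)"
    using ins
  proof
    assume "q = (i, j - 1)"
    then show ?thesis using tqp ij by simp
  next
    assume q: "q = (i - 1, j)"
    have "(i = i - 1) = False" using ij by simp
    then have "ev False (i - 1) j" using tedge_good[OF tqp] unfolding q fst_conv snd_conv by simp
    then show ?thesis using assms(2) ij by (subst (asm) edge_val.simps(2)) simp
  qed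
  show "tD (i, j)"
    using outs
  proof
    assume "r = (i, j + 1)"
    then have "ev True i j" using tedge_good[OF tpr] by simp
    then show ?thesis using assms(2) ij by (subst (asm) edge_val.simps(1)) simp
  next
    assume q: "r = (i + 1, j)"
    then show ?thesis using tpr by simp
  qed
qed

text \<open>Walk left from the given edge. A support point has a tight edge entering from the left;
  at a zero a tight path cannot arrive from above, since it would form a valley. The edges found are
  spliced by exchanging tails, down to the diagonal point \<open>(i, i)\<close>.\<close>

lemma tight_row_prefix:
  assumes "tR (i, j)" "i \<le> j"
  shows "\<exists>d V. tight n a x d \<and> ext d = map (Pair i) [i..<j + 2] @ V"
  using assms(2,1)
proof (induction j rule: dec_induct)
  case base
  then obtain d U V where d: "tight n a x d" and e: "ext d = U @ (i, i) # (i, i + 1) # V"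
    by (auto simp: tedge_def)
  have dy: "dyck_path n d" using d by (simp add: tight_def)
  have "U = []"
  proof (rule ccontr)
    assume "U \<noteq> []"
    then obtain U' q where "U = U' @ [q]" by (meson rev_exhaust)
    then have "ext d = U' @ q # (i, i) # (i, i + 1) # V" using e by simp
    then have "(i, i) \<in> set d" by (rule ext_interior)
    then show False using dy by (auto simp: dyck_path_iff)
  qed
  then show ?case using d e by (intro exI[of _ d] exI[of _ V]) simp
next
  case (step j)
  then obtain d U V where d: "tight n a x d" and e: "ext d = U @ (i, Suc j) # (i, Suc j + 1) # V"
    by (auto simp: tedge_def)
  have dy: "dyck_path n d" using d by (simp add: tight_def)
  have "U \<noteq> []" using e step(1) by (auto simp: ext_def)
  then obtain U' q where "U = U' @ [q]" by (meson rev_exhaust)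
  then have e': "ext d = U' @ q # (i, Suc j) # (i, Suc j + 1) # V" using e by simp
  have pi: "(i, Suc j) \<in> idx n" using ext_interior[OF e'] dy by (auto simp: dyck_path_iff)
  have st: "lstep q (i, Suc j)"
    using dyck_path_ext[OF dy] unfolding e' by (auto simp: successively_append_iff)
  have tqp: "tedge n a x q (i, Suc j)" unfolding tedge_def using d e' by blast
  have "tR (i, j)"
  proof (cases "x (i, Suc j) = 0")
    case False
    then show ?thesis using simple_vertex_support_edges(1)[OF pi] by simp
  next
    case True
    have "q \<noteq> (i - 1, Suc j)"
    proof
      assume "q = (i - 1, Suc j)"
      then show False
        by (intro no_zero_valley[of "i - 1" "Suc j"]) (use tqp step.prems True pi in auto)
    qed
    then have "q = (i, j)" using st by (cases q) (auto simp: lstep_def)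
    then show ?thesis using tqp by simp
  qed
  then obtain d' V' where d': "tight n a x d'" "ext d' = map (Pair i) [i..<j + 2] @ V'"
    using step.IH by blast
  then have "ext d' = map (Pair i) [i..<Suc j] @ (i, Suc j) # V'" using step(1) by simp
  from tight_ext_swap[OF simple_vertex_mem d'(1) d this e]
  obtain f where "tight n a x f" "ext f = map (Pair i) [i..<Suc j] @ (i, Suc j) # (i, Suc j + 1) #
      V"
    using step(1) by auto
  then show ?case using step(1) by (intro exI[of _ f] exI[of _ V]) simp
qed

text \<open>Mirror image of \<open>tight_row_prefix\<close>: walking down the column, a tight path
  cannot turn right at a zero, as this would again be a valley.\<close>

lemma tight_column_suffix:
  assumes "tD (i, j)" "i < j"
  shows "\<exists>d U. tight n a x d \<and> ext d = U @ map (\<lambda>k. (k, j)) [i..<j + 1]"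
  using assms
proof (induction "j - i" arbitrary: i)
  case (Suc m)
  then obtain d U V where d: "tight n a x d" and e: "ext d = U @ (i, j) # (i + 1, j) # V"
    by (auto simp: tedge_def)
  have dy: "dyck_path n d" using d by (simp add: tight_def)
  show ?case
  proof (cases "i + 1 = j")
    case True
    have "V = []"
    proof (rule ccontr)
      assume "V \<noteq> []"
      then obtain r V' where "V = r # V'" by (meson neq_Nil_conv)
      then have "ext d = U @ (i, j) # (i + 1, j) # r # V'" using e by simp
      then have "(i + 1, j) \<in> set d" by (rule ext_interior)
      then show False using dy True by (auto simp: dyck_path_iff)
    qed
    then show ?thesis using d e True by (intro exI[of _ d] exI[of _ U]) auto
  next
    case False
    then have ij: "i + 1 < j" using Suc.prems by simp
    have "last (ext d) = (snk d, snk d)" by (simp add: ext_def)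
    then have "V \<noteq> []" using e ij by auto
    then obtain r V' where V: "V = r # V'" by (meson neq_Nil_conv)
    then have e': "ext d = U @ (i, j) # (i + 1, j) # r # V'" using e by simp
    have pi: "(i + 1, j) \<in> idx n" using ext_interior[OF e'] dy by (auto simp: dyck_path_iff)
    have st: "lstep (i + 1, j) r"
      using dyck_path_ext[OF dy] unfolding e' by (auto simp: successively_append_iff)
    have "ext d = (U @ [(i, j)]) @ (i + 1, j) # r # V'" using e' by simp
    then have tpr: "tedge n a x (i + 1, j) r" unfolding tedge_def using d by blast
    have "tD (i + 1, j)"
    proof (cases "x (i + 1, j) = 0")
      case False
      then show ?thesis using simple_vertex_support_edges(2)[OF pi] by simp
    next
      case True
      have "r \<noteq> (i + 1, j + 1)"
      proof
        assume "r = (i + 1, j + 1)"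
        then show False
          by (intro no_zero_valley[of i j]) (use tpr Suc.prems True ij in auto)
      qed
      then show ?thesis using st tpr by (auto simp: lstep_def)
    qed
    moreover have "m = j - (i + 1)" using Suc.hyps(2) by simp
    ultimately obtain d' U' where d': "tight n a x d'" "ext d' = U' @ map (\<lambda>k. (k, j)) [i + 1..<j +
        1]"
      using Suc.hyps(1)[of "i + 1"] ij by blast
    have up: "[i + 1..<j + 1] = (i + 1) # [i + 2..<j + 1]" "[i..<j + 1] = i # (i + 1) # [i + 2..<j +
        1]"
      using ij by (simp_all add: upt_conv_Cons del: upt_Suc)
    have 1: "ext d' = U' @ (i + 1, j) # map (\<lambda>k. (k, j)) [i + 2..<j + 1]"
      using d'(2) unfolding up by simp
    have 2: "ext d = (U @ [(i, j)]) @ (i + 1, j) # V" using e by simp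
    have "\<exists>f. tight n a x f \<and> ext f = (U @ [(i, j)]) @ (i + 1, j) # map (\<lambda>k. (k, j)) [i + 2..<j +
        1]"
      by (rule tight_ext_swap[OF simple_vertex_mem d d'(1) 2 1]) (use ij in simp)
    then obtain f where f: "tight n a x f"
      "ext f = (U @ [(i, j)]) @ (i + 1, j) # map (\<lambda>k. (k, j)) [i + 2..<j + 1]" by blast
    show ?thesis unfolding up by (intro exI[of _ f] exI[of _ U]) (simp add: f del: upt_Suc)
  qed
qed simp

text \<open>Splice the tight row prefix ending at \<open>(i, j)\<close> with the tight column suffix
  starting there.\<close>

lemma simple_vertex_hooks_tight:
  assumes "(i, j) \<in> idx n" "x (i, j) \<noteq> 0"
  shows "tight n a x (hook i j)"
proof -
  have ij: "i < j" "1 \<le> i" "j \<le> n" using assms(1) by auto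
  have j1: "j - 1 + 2 = j + 1" "i \<le> j - 1" using ij by auto
  obtain d V where d: "tight n a x d" "ext d = map (Pair i) [i..<j + 1] @ V"
    using tight_row_prefix[OF simple_vertex_support_edges(1)[OF assms] j1(2)] unfolding j1(1) by
        blast
  obtain d' U where d': "tight n a x d'" "ext d' = U @ map (\<lambda>k. (k, j)) [i..<j + 1]"
    using tight_column_suffix[OF simple_vertex_support_edges(2)[OF assms] ij(1)] by blast
  have up1: "[i..<j + 1] = [i..<j] @ [j]" using ij by simp
  have up2: "[i..<j + 1] = i # [i + 1..<j + 1]"
    using upt_conv_Cons[of i "j + 1"] ij by simp
  have 1: "ext d = map (Pair i) [i..<j] @ (i, j) # V" using d(2) unfolding up1 by simp
  have 2: "ext d' = U @ (i, j) # map (\<lambda>k. (k, j)) [i + 1..<j + 1]" using d'(2) unfolding up2 by simp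
  have "\<exists>f. tight n a x f \<and> ext f = map (Pair i) [i..<j] @ (i, j) # map (\<lambda>k. (k, j)) [i + 1..<j +
      1]"
    by (rule tight_ext_swap[OF simple_vertex_mem d(1) d'(1) 1 2]) (use ij in simp)
  then obtain f where f: "tight n a x f"
    "ext f = map (Pair i) [i..<j] @ (i, j) # map (\<lambda>k. (k, j)) [i + 1..<j + 1]" by blast
  have "ext (hook i j) = ext f"
  proof -
    have "[i..<j] = i # [i + 1..<j]" "[i + 1..<j + 1] = [i + 1..<j] @ [j]"
      using ij by (simp_all add: upt_conv_Cons)
    then have "ext (hook i j) = map (Pair i) [i..<j] @ (i, j) # map (\<lambda>k. (k, j)) [i + 1..<j + 1]"
      unfolding ext_def dyck_path_hook(2,3)[OF ij(2,1,3)] by (simp add: hook_def del: upt_Suc)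
    then show ?thesis using f(2) by simp
  qed
  then show ?thesis using ext_inj f(1) by metis
qed

text \<open>For the second clause take the dual vector \<open>b\<close> of \<open>d\<close>. It
  vanishes at the zeros of \<open>x\<close>, so if \<open>d\<close> were none of the tight hooks,
  the hook system would force \<open>b = 0\<close>.\<close>

lemma simple_vertex_imp_hook_vertex: "hook_vertex n a x"
  unfolding hook_vertex_def
proof (intro conjI allI impI)
  show "tight n a x (hook i j)" if "(i, j) \<in> idx n" "x (i, j) \<noteq> 0" for i j
    by (rule simple_vertex_hooks_tight[OF that])
  fix d assume d: "tight n a x d"
  obtain b where b: "sum b (set d) \<noteq> 0" "\<And>p. p \<in> idx n \<Longrightarrow> x p = 0 \<Longrightarrow> b p = 0"
    "\<And>e. tight n a x e \<Longrightarrow> set e \<noteq> set d \<Longrightarrow> sum b (set e) = 0" "b \<in> U_space n"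
    using simple_vertex_path_dual[OF d] by blast
  have "b \<noteq> 0" using b(1) by auto
  then obtain i j where ij: "(i, j) \<in> idx n" "x (i, j) \<noteq> 0" "sum b (set (hook i j)) \<noteq> 0"
    using hook_system_trivial[OF b(4), of x] b(2) by blast
  then have eq: "set (hook i j) = set d"
    using b(3)[OF simple_vertex_hooks_tight] by blast
  have dy: "dyck_path n d" using d by (simp add: tight_def)
  have ij': "1 \<le> i" "i < j" "j \<le> n" using ij(1) by auto
  have "(i, i + 1) \<in> set d" "(j - 1, j) \<in> set d" "(i, j) \<in> set d"
    unfolding eq[symmetric] set_hook using ij' by (auto simp: image_iff)
  moreover have "i \<le> src d" "snk d \<le> j"
    using dyck_path_ends(6,7)[OF dy] ij' unfolding eq[symmetric] set_hook by auto
  ultimately have "src d = i" "snk d = j"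
    using dyck_path_elem[OF dy] by (meson le_antisym)+
  then show "(src d, snk d) \<in> set d" "x (src d, snk d) \<noteq> 0"
    using \<open>(i, j) \<in> set d\<close> ij by auto
qed

end

section \<open>The unimodular basis at a hook vertex\<close>

text \<open>Solves, by recursion on \<open>j - i\<close>, the system that prescribes the value at
  zeros of \<open>x\<close> and minus the hook sum at the support. All pivots are 1 or -1, so
  integral data give integral solutions; this is the source of unimodularity.\<close>

function hook_inv :: "(nat \<times> nat \<Rightarrow> real) \<Rightarrow> (nat \<times> nat \<Rightarrow> real) \<Rightarrow> nat \<Rightarrow> nat \<Rightarrow> real" where
  "hook_inv x z i j =
     (if x (i, j) = 0 \<or> j \<le> i then z (i, j)
      else - z (i, j) - (\<Sum>k\<in>{i<..<j}. hook_inv x z i k) - (\<Sum>k\<in>{i<..<j}. hook_inv x z k j))"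
  by pat_completeness auto
termination
  by (relation "Wellfounded.measure (\<lambda>(x, z, i, j). j - i)") auto

declare hook_inv.simps [simp del]

lemma hook_inv_Ints: "(\<And>p. z p \<in> \<int>) \<Longrightarrow> hook_inv x z i j \<in> \<int>"
  by (induction x z i j rule: hook_inv.induct) (subst hook_inv.simps, auto intro!: Ints_diff
      Ints_minus Ints_sum)

context
  fixes n :: nat and a :: "nat \<Rightarrow> nat" and x :: "nat \<times> nat \<Rightarrow> real"
  assumes x: "x \<in> FFLV n a" and hv: "hook_vertex n a x"
begin

definition hook_coord :: "(nat \<times> nat \<Rightarrow> real) \<Rightarrow> nat \<times> nat \<Rightarrow> real" where
  "hook_coord y p = (if x p = 0 then y p else - sum y (set (hook (fst p) (snd p))))"

text \<open>The basis dual to the coordinates \<open>hook_coord\<close>; it generates the tangent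
  cone.\<close>

definition hook_basis :: "nat \<times> nat \<Rightarrow> nat \<times> nat \<Rightarrow> real" where
  "hook_basis p = (\<lambda>(i, j). hook_inv x (punit p) i j)"

lemma hook_coord_sum:
  "hook_coord (\<Sum>b\<in>B. c b *\<^sub>R f b) q = (\<Sum>b\<in>B. c b * hook_coord (f b) q)"
proof (cases "x q = 0")
  case False
  have "(\<Sum>p\<in>H. \<Sum>b\<in>B. c b * f b p) = (\<Sum>b\<in>B. c b * (\<Sum>p\<in>H. f b p))" for H
    by (subst sum.swap) (simp add: sum_distrib_left)
  then show ?thesis using False by (simp add: hook_coord_def sum_fun_apply sum_negf)
qed (simp add: hook_coord_def sum_fun_apply)

lemma hook_coord_diff: "hook_coord (y - z) q = hook_coord y q - hook_coord z q"
  by (simp add: hook_coord_def sum_subtractf)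

lemma hook_coord_basis: "q \<in> idx n \<Longrightarrow> hook_coord (hook_basis p) q = of_bool (q = p)"
proof -
  assume q: "q \<in> idx n"
  obtain i j where ij: "q = (i, j)" by (cases q)
  then have lt: "i < j" using q by simp
  show ?thesis
  proof (cases "x q = 0")
    case True
    then show ?thesis using ij by (simp add: hook_coord_def hook_basis_def hook_inv.simps punit_def)
  next
    case False
    have "hook_basis p (i, j) = - punit p (i, j) - (\<Sum>k\<in>{i<..<j}. hook_basis p (i, k)) -
        (\<Sum>k\<in>{i<..<j}. hook_basis p (k, j))"
      unfolding hook_basis_def by (simp, subst hook_inv.simps) (use False lt ij in simp)
    then show ?thesis using False ij sum_hook_corner[OF lt, of "hook_basis p"]
      by (simp add: hook_coord_def punit_def)
  qed
qed

lemma hook_coord_trivial: "y \<in> U_space n \<Longrightarrow> (\<And>p. p \<in> idx n \<Longrightarrow> hook_coord y p = 0) \<Longrightarrow> y = 0"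
  by (rule hook_system_trivial[of y n x]) (fastforce simp: hook_coord_def)+

lemma hook_basis_lattice: "p \<in> idx n \<Longrightarrow> hook_basis p \<in> U_lattice n"
proof -
  assume p: "p \<in> idx n"
  have "hook_basis p q = 0" if "q \<notin> idx n" for q
  proof -
    have "x q = 0" using x that by (cases q) (auto simp: FFLV_iff U_space_def)
    then show ?thesis using p that by (cases q) (auto simp: hook_basis_def hook_inv.simps punit_def)
  qed
  moreover have "hook_basis p q \<in> \<int>" for q
    by (cases q) (auto simp: hook_basis_def punit_def intro!: hook_inv_Ints)
  ultimately show ?thesis by (auto simp: U_lattice_def U_space_def)
qed

lemma hook_expand:
  assumes y: "y \<in> U_space n" shows "y = (\<Sum>p\<in>idx n. hook_coord y p *\<^sub>R hook_basis p)"
proof -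
  have "y - (\<Sum>p\<in>idx n. hook_coord y p *\<^sub>R hook_basis p) = 0"
  proof (rule hook_coord_trivial)
    show "y - (\<Sum>p\<in>idx n. hook_coord y p *\<^sub>R hook_basis p) \<in> U_space n"
      using y hook_basis_lattice
      by (intro U_space_diff U_space_sum U_space_scaleR) (auto simp: U_lattice_def)
    fix q assume q: "q \<in> idx n"
    have "(\<Sum>p\<in>idx n. hook_coord y p * hook_coord (hook_basis p) q) = (\<Sum>p\<in>idx n. if p = q then
        hook_coord y q else 0)"
      by (rule sum.cong) (auto simp: hook_coord_basis[OF q])
    then show "hook_coord (y - (\<Sum>p\<in>idx n. hook_coord y p *\<^sub>R hook_basis p)) q = 0"
      using q by (simp add: hook_coord_diff hook_coord_sum)
  qed
  then show ?thesis by (simp only: right_minus_eq)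
qed

lemma hook_basis_inj: "inj_on hook_basis (idx n)"
proof (rule inj_onI)
  fix p q assume pq: "p \<in> idx n" "q \<in> idx n" "hook_basis p = hook_basis q"
  have "hook_coord (hook_basis p) q = hook_coord (hook_basis q) q" using pq(3) by simp
  then show "p = q" using hook_coord_basis[OF pq(2)] by (simp split: if_splits)
qed

lemma hook_basis_reindex:
  "(\<Sum>b\<in>hook_basis ` idx n. c b *\<^sub>R b) = (\<Sum>p\<in>idx n. c (hook_basis p) *\<^sub>R hook_basis p)"
  by (simp add: sum.reindex[OF hook_basis_inj])

lemma hook_expand_image:
  assumes "y \<in> U_space n"
  shows "y = (\<Sum>b\<in>hook_basis ` idx n. hook_coord y (inv_into (idx n) hook_basis b) *\<^sub>R b)"
  unfolding hook_basis_reindex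
  by (subst hook_expand[OF assms], rule sum.cong) (simp_all add: inv_into_f_f[OF hook_basis_inj])

lemma hook_coord_combination:
  assumes "q \<in> idx n"
  shows "hook_coord (\<Sum>b\<in>hook_basis ` idx n. c b *\<^sub>R b) q = c (hook_basis q)"
proof -
  have "(\<Sum>p\<in>idx n. c (hook_basis p) * hook_coord (hook_basis p) q) = (\<Sum>p\<in>idx n. if p = q then c
      (hook_basis q) else 0)"
    by (rule sum.cong) (auto simp: hook_coord_basis[OF assms])
  then show ?thesis using assms by (simp add: hook_basis_reindex hook_coord_sum)
qed

lemma hook_basis_independent: "independent (hook_basis ` idx n)"
proof
  assume "dependent (hook_basis ` idx n)"
  then obtain c b where c: "b \<in> hook_basis ` idx n" "c b \<noteq> 0" "(\<Sum>b\<in>hook_basis ` idx n. c b *\<^sub>R b) =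
      0"
    by (auto simp: dependent_finite)
  then obtain q where q: "q \<in> idx n" "b = hook_basis q" by auto
  have "hook_coord 0 q = 0" by (simp add: hook_coord_def)
  then show False using hook_coord_combination[OF q(1), of c] c q by simp
qed

text \<open>Stated for an arbitrary predicate to serve both the tangent cone (nonnegativity) and the
  extreme point property (vanishing).\<close>

lemma hook_tightv: "(\<forall>c\<in>tightv n a x. P (ip n c y)) \<longleftrightarrow> (\<forall>q\<in>idx n. P (hook_coord y q))"
proof (intro iffI ballI)
  fix q assume P: "\<forall>c\<in>tightv n a x. P (ip n c y)" and q: "q \<in> idx n"
  show "P (hook_coord y q)"
  proof (cases "x q = 0")
    case True
    then have "punit q \<in> tightv n a x" using q by (auto simp: tightv_iff)
    then show ?thesis using P q True by (auto simp: hook_coord_def)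
  next
    case False
    obtain i j where ij: "q = (i, j)" by (cases q)
    have t: "tight n a x (hook i j)" using hv q False ij unfolding hook_vertex_def by blast
    then have "pathv (hook i j) \<in> tightv n a x" by (auto simp: tightv_iff)
    then have "P (ip n (pathv (hook i j)) y)" using P by blast
    then show ?thesis using t False ij by (simp add: hook_coord_def ip_pathv tight_def)
  qed
next
  fix c assume P: "\<forall>q\<in>idx n. P (hook_coord y q)" and "c \<in> tightv n a x"
  then consider p where "p \<in> idx n" "c = punit p" "x p = 0" | d where "tight n a x d" "c = pathv d"
    by (auto simp: tightv_iff)
  then show "P (ip n c y)"
  proof cases
    case 1
    then show ?thesis using P by (fastforce simp: hook_coord_def)
  next
    case 2
    have d: "dyck_path n d" using 2 by (simp add: tight_def)
    have c: "(src d, snk d) \<in> set d" "x (src d, snk d) \<noteq> 0" using hv 2 unfolding hook_vertex_def by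
        blast+
    have "(src d, snk d) \<in> idx n" using dyck_path_ends[OF d] by auto
    then have "P (hook_coord y (src d, snk d))" using P by blast
    then show ?thesis using c dyck_path_hook_iff[OF d c(1)] 2 d by (simp add: hook_coord_def
        ip_pathv)
  qed
qed

lemma hook_tangent_cone: "tangent_cone (FFLV n a) x = convex_cone hull (hook_basis ` idx n)"
proof -
  have "y \<in> U_space n \<and> (\<forall>q\<in>idx n. 0 \<le> hook_coord y q) \<longleftrightarrow>
      (\<exists>u. y = (\<Sum>b\<in>hook_basis ` idx n. u b *\<^sub>R b) \<and> (\<forall>b\<in>hook_basis ` idx n. 0 \<le> u b))" for y
  proof
    assume y: "y \<in> U_space n \<and> (\<forall>q\<in>idx n. 0 \<le> hook_coord y q)"
    then show "\<exists>u. y = (\<Sum>b\<in>hook_basis ` idx n. u b *\<^sub>R b) \<and> (\<forall>b\<in>hook_basis ` idx n. 0 \<le> u b)"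
      using hook_expand_image[of y]
      by (intro exI[of _ "\<lambda>b. hook_coord y (inv_into (idx n) hook_basis b)"])
         (auto simp: inv_into_f_f[OF hook_basis_inj])
  next
    assume "\<exists>u. y = (\<Sum>b\<in>hook_basis ` idx n. u b *\<^sub>R b) \<and> (\<forall>b\<in>hook_basis ` idx n. 0 \<le> u b)"
    then obtain u where u: "y = (\<Sum>b\<in>hook_basis ` idx n. u b *\<^sub>R b)" "\<forall>b\<in>hook_basis ` idx n. 0 \<le> u b"
        by blast
    have "y \<in> U_space n" unfolding u(1)
      using hook_basis_lattice by (intro U_space_sum U_space_scaleR) (auto simp: U_lattice_def)
    then show "y \<in> U_space n \<and> (\<forall>q\<in>idx n. 0 \<le> hook_coord y q)"
      using u hook_coord_combination by auto
  qed
  then show ?thesis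
    unfolding tangent_cone_FFLV[OF x] hook_tightv[where P = "\<lambda>r. 0 \<le> r"]
    by (subst convex_cone_hull_finite) auto
qed

lemma hook_lattice_basis: "lattice_basis (U_lattice n) (hook_basis ` idx n)"
  unfolding lattice_basis_def
proof (intro conjI set_eqI iffI)
  fix y assume y: "y \<in> U_lattice n"
  have "hook_coord y q \<in> \<int>" for q
    using y by (cases q) (auto simp: hook_coord_def U_lattice_def)
  then have "hook_coord y q = real_of_int \<lfloor>hook_coord y q\<rfloor>" for q
    by (metis Ints_cases floor_of_int)
  moreover have "y \<in> U_space n" using y by (simp add: U_lattice_def)
  ultimately have "y = (\<Sum>b\<in>hook_basis ` idx n. real_of_int \<lfloor>hook_coord y (inv_into (idx n)
      hook_basis b)\<rfloor> *\<^sub>R b)"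
    using hook_expand_image[of y] by simp
  then show "y \<in> {\<Sum>b\<in>hook_basis ` idx n. real_of_int (c b) *\<^sub>R b | c. True}"
    by (intro CollectI exI[of _ "\<lambda>b. \<lfloor>hook_coord y (inv_into (idx n) hook_basis b)\<rfloor>"]) simp
next
  fix y assume "y \<in> {\<Sum>b\<in>hook_basis ` idx n. real_of_int (c b) *\<^sub>R b | c. True}"
  then obtain c where c: "y = (\<Sum>b\<in>hook_basis ` idx n. real_of_int (c b) *\<^sub>R b)" by blast
  have "y \<in> U_space n" unfolding c
    using hook_basis_lattice by (intro U_space_sum U_space_scaleR) (auto simp: U_lattice_def)
  moreover have "y q \<in> \<int>" for q
    unfolding c sum_fun_apply using hook_basis_lattice
    by (cases q) (auto simp: U_lattice_def intro!: Ints_sum Ints_mult)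
  ultimately show "y \<in> U_lattice n" by (simp add: U_lattice_def)
qed (simp_all add: hook_basis_independent)

lemma hook_extreme_point: "x extreme_point_of FFLV n a"
  unfolding extreme_point_of_def
proof (intro conjI ballI x notI)
  fix y z assume yz: "y \<in> FFLV n a" "z \<in> FFLV n a" "x \<in> open_segment y z"
  then obtain t where t: "y \<noteq> z" "0 < t" "t < 1" "x = (1 - t) *\<^sub>R y + t *\<^sub>R z"
    by (auto simp: in_segment)
  have "ip n c (y - x) = 0" if "c \<in> tightv n a x" for c
  proof -
    define m where "m = ip n c x"
    then have m: "(c, m) \<in> constrs n a" "ip n c x = m" using that by (auto simp: tightv_def)
    have le: "m \<le> ip n c y" "m \<le> ip n c z" using yz m by (auto simp: FFLV_constrs)
    have "m = (1 - t) * ip n c y + t * ip n c z" using m(2) t(4) by simp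
    then have "(1 - t) * (ip n c y - m) + t * (ip n c z - m) = 0" by (simp add: algebra_simps)
    moreover have "0 \<le> (1 - t) * (ip n c y - m)" "0 \<le> t * (ip n c z - m)" using t le by auto
    ultimately have "(1 - t) * (ip n c y - m) = 0" by linarith
    then show ?thesis using t m(2) by simp
  qed
  then have "\<forall>q\<in>idx n. hook_coord (y - x) q = 0" using hook_tightv[where P = "\<lambda>r. r = 0"] by blast
  then have "y - x = 0"
    by (intro hook_coord_trivial) (use yz(1) x in \<open>simp_all add: FFLV_iff U_space_diff\<close>)
  then have "y = x" by (simp only: right_minus_eq)
  have "z p = x p" for p
  proof -
    have "x p = (1 - t) * y p + t * z p" using fun_cong[OF t(4), of p] by simp
    then have "t * (z p - x p) = 0" using \<open>y = x\<close> by (auto simp: algebra_simps)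
    then show ?thesis using t(2) by simp
  qed
  then have "z = x" by (simp add: fun_eq_iff)
  then show False using t(1) \<open>y = x\<close> by simp
qed

lemma hook_vertex_imp_simple_vertex: "simple_vertex n (FFLV n a) x"
  unfolding simple_vertex_def simplicial_cone_def unimodular_cone_def
  using hook_extreme_point hook_lattice_basis hook_tangent_cone hook_basis_independent finite_idx
  by (meson finite_imageI)

end

lemma simple_vertex_iff:
  assumes "\<forall>i\<in>{1..n - 1}. 0 < a i"
  shows "simple_vertex n (FFLV n a) x \<longleftrightarrow> x \<in> FFLV n a \<and> hook_vertex n a x"
  using simple_vertex_mem[OF assms] simple_vertex_imp_hook_vertex[OF assms]
      hook_vertex_imp_simple_vertex
  by blast

section \<open>Weights and the points of the permutations\<close>

text \<open>The coefficient of \<epsilon>_m in the weight of \<open>T\<close>, in the normalisation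
  of \<open>lam\<close>: subtracting \<epsilon>_i - \<epsilon>_j lowers coordinate \<open>i\<close>
  and raises coordinate \<open>j\<close>.\<close>

definition mu :: "nat \<Rightarrow> (nat \<Rightarrow> nat) \<Rightarrow> (nat \<times> nat \<Rightarrow> real) \<Rightarrow> nat \<Rightarrow> real" where
  "mu n a T m = lam n a m - (\<Sum>p\<in>idx n. T p * of_bool (fst p = m)) + (\<Sum>p\<in>idx n. T p * of_bool (snd p
      = m))"

lemma lam_eq: "1 \<le> m \<Longrightarrow> lam n a m = (\<Sum>k\<in>{1..<n}. real (a k) * of_bool (m \<le> k))"
  unfolding lam_def by (rule sum.mono_neutral_cong_left) auto

lemma lam_less:
  assumes "\<forall>i\<in>{1..n - 1}. 0 < a i" "1 \<le> i" "i < j" "j \<le> n"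
  shows "lam n a j < lam n a i"
proof -
  have "lam n a i = (\<Sum>k=i..<j. real (a k)) + lam n a j"
    unfolding lam_def using assms by (intro sum.atLeastLessThan_concat[symmetric]) auto
  moreover have "0 < (\<Sum>k=i..<j. real (a k))" by (rule sum_pos) (use assms in auto)
  ultimately show ?thesis by simp
qed

lemma eps_apply:
  assumes "m \<in> {1..n}" "k \<in> {1..<n}"
  shows "eps n m k = of_bool (m = k) - of_bool (m = k + 1)"
  using assms by (auto simp: eps_def fund_weight_def)

lemma eps_outside: "k \<notin> {1..<n} \<Longrightarrow> eps n m k = 0"
  by (auto simp: eps_def fund_weight_def)

lemma pos_root_eq: "i \<le> j \<Longrightarrow> pos_root n i j = eps n i - eps n j"
proof (induction j rule: dec_induct)
  case (step j)
  then have "pos_root n i (Suc j) = pos_root n i j + simple_root n j"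
    by (simp add: pos_root_def)
  then show ?case using step by (simp add: simple_root_eps)
qed (simp add: pos_root_def)

lemma highest_weight_apply: "highest_weight n a k = (if k \<in> {1..<n} then real (a k) else 0)"
proof -
  have "highest_weight n a k = (\<Sum>i\<in>{1..<n}. if i = k then real (a k) else 0)"
    unfolding highest_weight_def sum_fun_apply by (rule sum.cong) (auto simp: fund_weight_def)
  then show ?thesis by simp
qed

lemma point_weight_apply:
  "point_weight n a T k = (if k \<in> {1..<n} then mu n a T k - mu n a T (k + 1) else 0)"
proof -
  have "point_weight n a T k = highest_weight n a k - (\<Sum>p\<in>idx n. T p * pos_root n (fst p) (snd p)
      k)"
    by (simp add: point_weight_def sum_fun_apply case_prod_unfold)
  also have "(\<Sum>p\<in>idx n. T p * pos_root n (fst p) (snd p) k) = (\<Sum>p\<in>idx n. T p * (eps n (fst p) k -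
      eps n (snd p) k))"
    by (rule sum.cong) (auto simp: pos_root_eq)
  finally have pw: "point_weight n a T k =
    highest_weight n a k - (\<Sum>p\<in>idx n. T p * (eps n (fst p) k - eps n (snd p) k))" .
  show ?thesis
  proof (cases "k \<in> {1..<n}")
    case True
    have "lam n a k = real (a k) + lam n a (k + 1)"
      using True unfolding lam_def by (subst sum.atLeast_Suc_lessThan) auto
    moreover have "(\<Sum>p\<in>idx n. T p * (eps n (fst p) k - eps n (snd p) k)) =
      (\<Sum>p\<in>idx n. T p * of_bool (fst p = k) - T p * of_bool (fst p = k + 1)
        - T p * of_bool (snd p = k) + T p * of_bool (snd p = k + 1))"
    proof (rule sum.cong)
      fix p assume "p \<in> idx n"
      then have "fst p \<in> {1..n}" "snd p \<in> {1..n}" by (auto simp: idx_def)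
      then show "T p * (eps n (fst p) k - eps n (snd p) k) =
        T p * of_bool (fst p = k) - T p * of_bool (fst p = k + 1)
        - T p * of_bool (snd p = k) + T p * of_bool (snd p = k + 1)"
        unfolding eps_apply[OF \<open>fst p \<in> {1..n}\<close> True] eps_apply[OF \<open>snd p \<in> {1..n}\<close> True]
        by (simp add: algebra_simps)
    qed simp
    ultimately show ?thesis
      unfolding pw highest_weight_apply mu_def using True
      by (simp add: sum.distrib sum_subtractf del: sum_mult_of_bool_eq)
  next
    case False
    then show ?thesis unfolding pw highest_weight_apply by (simp only: eps_outside[OF False]
        if_False) simp
  qed
qed

lemma weyl_act_apply:
  assumes w: "w permutes {1..n}"
  shows "weyl_act n w (highest_weight n a) k =
    (if k \<in> {1..<n} then lam n a (inv w k) - lam n a (inv w (k + 1)) else 0)"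
proof -
  have "weyl_act n w (highest_weight n a) k
      = (\<Sum>i\<in>{1..<n}. real (a i) * (\<Sum>m\<in>{1..i}. eps n (w m) k))"
    unfolding weyl_act_def sum_fun_apply
    by (rule sum.cong) (auto simp: highest_weight_apply sum_fun_apply)
  also have "\<dots> = (\<Sum>i\<in>{1..<n}. \<Sum>m\<in>{1..n}. real (a i) * of_bool (m \<le> i) * eps n (w m) k)"
  proof (rule sum.cong)
    fix i assume "i \<in> {1..<n}"
    then show "real (a i) * (\<Sum>m\<in>{1..i}. eps n (w m) k)
        = (\<Sum>m\<in>{1..n}. real (a i) * of_bool (m \<le> i) * eps n (w m) k)"
      unfolding sum_distrib_left by (intro sum.mono_neutral_cong_left) auto
  qed simp
  also have "\<dots> = (\<Sum>m\<in>{1..n}. (\<Sum>i\<in>{1..<n}. real (a i) * of_bool (m \<le> i)) * eps n (w m) k)"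
    by (subst sum.swap) (simp only: sum_distrib_right)
  also have "\<dots> = (\<Sum>m\<in>{1..n}. lam n a m * eps n (w m) k)"
    by (rule sum.cong) (auto simp only: lam_eq atLeastAtMost_iff)
  finally have W: "weyl_act n w (highest_weight n a) k = (\<Sum>m\<in>{1..n}. lam n a m * eps n (w m) k)" .
  show ?thesis
  proof (cases "k \<in> {1..<n}")
    case True
    have iw: "w m = l \<longleftrightarrow> m = inv w l" for m l using permutes_inverses[OF w] by metis
    have "(\<Sum>m\<in>{1..n}. lam n a m * eps n (w m) k)
      = (\<Sum>m\<in>{1..n}. (if m = inv w k then lam n a (inv w k) else 0) - (if m = inv w (k + 1) then lam
          n a (inv w (k + 1)) else 0))"
    proof (rule sum.cong)
      fix m assume m: "m \<in> {1..n}"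
      then have "w m \<in> {1..n}" using permutes_in_image[OF w] by blast
      then show "lam n a m * eps n (w m) k =
        (if m = inv w k then lam n a (inv w k) else 0) - (if m = inv w (k + 1) then lam n a (inv w
            (k + 1)) else 0)"
        unfolding eps_apply[OF \<open>w m \<in> {1..n}\<close> True] iw by auto
    qed simp
    also have "\<dots> = lam n a (inv w k) - lam n a (inv w (k + 1))"
    proof -
      have "inv w k \<in> {1..n}" "inv w (k + 1) \<in> {1..n}"
        using True permutes_in_image[OF permutes_inv[OF w]] by auto
      then show ?thesis by (simp add: sum_subtractf)
    qed
    finally show ?thesis unfolding W using True by simp
  next
    case False
    then show ?thesis unfolding W by (simp only: eps_outside[OF False] if_False) simp
  qed
qed

lemma sum_mu: "(\<Sum>m\<in>{1..n}. mu n a T m) = (\<Sum>m\<in>{1..n}. lam n a m)"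
proof -
  have "(\<Sum>m\<in>{1..n}. \<Sum>p\<in>idx n. T p * of_bool (f p = m)) = (\<Sum>p\<in>idx n. T p)"
    if "\<And>p. p \<in> idx n \<Longrightarrow> f p \<in> {1..n}" for f
  proof (subst sum.swap, rule sum.cong)
    fix p assume "p \<in> idx n"
    then have "f p \<in> {1..n}" using that by blast
    then show "(\<Sum>m\<in>{1..n}. T p * of_bool (f p = m)) = T p"
      by (simp add: of_bool_def if_distrib cong: if_cong)
  qed simp
  from this[of fst] this[of snd] show ?thesis
    by (auto simp: mu_def sum.distrib sum_subtractf idx_def simp del: sum_mult_of_bool_eq)
qed

text \<open>Coordinates in the fundamental weights are consecutive differences, so they determine
  the \<open>mu\<close> coordinates up to a common constant. Roots have coordinate sum 0, so by
  \<open>sum_mu\<close> the totals agree and the constant vanishes.\<close>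

lemma point_weight_eq_weyl_act_iff:
  assumes w: "w permutes {1..n}" and n: "1 \<le> n"
  shows "point_weight n a T = weyl_act n w (highest_weight n a) \<longleftrightarrow>
    (\<forall>m\<in>{1..n}. mu n a T m = lam n a (inv w m))"
proof
  assume eq: "point_weight n a T = weyl_act n w (highest_weight n a)"
  define c where "c m = mu n a T m - lam n a (inv w m)" for m
  have step: "c k = c (k + 1)" if "k \<in> {1..<n}" for k
    using fun_cong[OF eq, of k] that by (simp add: point_weight_apply weyl_act_apply[OF w] c_def)
  have const: "c m = c 1" if "1 \<le> m" "m \<le> n" for m
    using that
  proof (induction m rule: dec_induct)
    case (step m)
    then show ?case using \<open>\<And>k. k \<in> {1..<n} \<Longrightarrow> c k = c (k + 1)\<close>[of m] by simp
  qed simp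
  have "(\<Sum>m\<in>{1..n}. c m) = (\<Sum>m\<in>{1..n}. c 1)"
    by (rule sum.cong[OF refl], rule const) auto
  then have "(\<Sum>m\<in>{1..n}. c m) = real n * c 1" by simp
  moreover have "(\<Sum>m\<in>{1..n}. c m) = 0"
    unfolding c_def sum_subtractf sum_mu
    using sum.permute[OF permutes_inv[OF w], of "lam n a"] by (simp add: o_def)
  ultimately have "c 1 = 0" using n by simp
  then show "\<forall>m\<in>{1..n}. mu n a T m = lam n a (inv w m)"
    using const unfolding c_def by (metis atLeastAtMost_iff eq_iff_diff_eq_0)
next
  assume "\<forall>m\<in>{1..n}. mu n a T m = lam n a (inv w m)"
  then show "point_weight n a T = weyl_act n w (highest_weight n a)"
    by (auto simp: fun_eq_iff point_weight_apply weyl_act_apply[OF w])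
qed

text \<open>
  Here \<open>v\<close> is the inverse of \<open>w\<close>, so \<open>w{1..k}\<close> consists of the \<open>m\<close> with \<open>v m \<le> k\<close>. The corners are
  the pairs of the \<open>s\<close>-th smallest element outside this set and the \<open>s\<close>-th largest element inside it,
  as long as the former is smaller than the latter.
\<close>

definition outs :: "(nat \<Rightarrow> nat) \<Rightarrow> nat \<Rightarrow> nat \<Rightarrow> nat" where
  "outs v k i = card {m \<in> {1..i}. k < v m}"

definition ins :: "nat \<Rightarrow> (nat \<Rightarrow> nat) \<Rightarrow> nat \<Rightarrow> nat \<Rightarrow> nat" where
  "ins n v k j = card {m \<in> {j..n}. v m \<le> k}"

definition corner :: "nat \<Rightarrow> (nat \<Rightarrow> nat) \<Rightarrow> nat \<Rightarrow> nat \<times> nat \<Rightarrow> bool" where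
  "corner n v k p \<longleftrightarrow> p \<in> idx n \<and> k < v (fst p) \<and> v (snd p) \<le> k \<and> outs v k (fst p) = ins n v k (snd
      p)"

definition perm_point :: "nat \<Rightarrow> (nat \<Rightarrow> nat) \<Rightarrow> (nat \<Rightarrow> nat) \<Rightarrow> nat \<times> nat \<Rightarrow> real" where
  "perm_point n a v p = (\<Sum>k\<in>{1..<n}. real (a k) * of_bool (corner n v k p))"

section \<open>Ranks in the nested matchings\<close>

lemma outs_0 [simp]: "outs v k 0 = 0"
  by (simp add: outs_def)

lemma outs_Suc: "outs v k (Suc i) = outs v k i + of_bool (k < v (Suc i))"
proof -
  have "{m \<in> {1..Suc i}. k < v m} = (if k < v (Suc i) then insert (Suc i) {m \<in> {1..i}. k < v m} else
      {m \<in> {1..i}. k < v m})"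
    by (auto simp: le_Suc_eq)
  then show ?thesis by (simp add: outs_def)
qed

lemma ins_Suc: "j \<le> n \<Longrightarrow> ins n v k j = ins n v k (Suc j) + of_bool (v j \<le> k)"
proof -
  assume "j \<le> n"
  then have "{m \<in> {j..n}. v m \<le> k} = (if v j \<le> k then insert j {m \<in> {Suc j..n}. v m \<le> k} else {m \<in>
      {Suc j..n}. v m \<le> k})"
    by (auto simp: Suc_le_eq le_less)
  then show ?thesis by (simp add: ins_def)
qed

lemma outs_mono: "i \<le> i' \<Longrightarrow> outs v k i \<le> outs v k i'"
  unfolding outs_def by (rule card_mono) auto

lemma ins_antimono: "j \<le> j' \<Longrightarrow> ins n v k j' \<le> ins n v k j"
  unfolding ins_def by (rule card_mono) auto

lemma outs_strict: "i < i' \<Longrightarrow> k < v i' \<Longrightarrow> outs v k i < outs v k i'"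
  using outs_Suc[of v k "i' - 1"] outs_mono[of i "i' - 1" v k] by (cases i') auto

lemma ins_strict: "j < j' \<Longrightarrow> j \<le> n \<Longrightarrow> v j \<le> k \<Longrightarrow> ins n v k j' < ins n v k j"
  using ins_Suc[of j n v k] ins_antimono[of "Suc j" j' n v k] by auto

lemma outs_pos: "1 \<le> i \<Longrightarrow> k < v i \<Longrightarrow> 1 \<le> outs v k i"
  using outs_strict[of 0 i k v] by simp

lemma ins_pos: "j \<le> n \<Longrightarrow> v j \<le> k \<Longrightarrow> 1 \<le> ins n v k j"
  using ins_strict[of j "Suc j" n v k] by simp

lemma outs_attained:
  "1 \<le> s \<Longrightarrow> s \<le> outs v k i \<Longrightarrow> \<exists>i'. 1 \<le> i' \<and> i' \<le> i \<and> k < v i' \<and> outs v k i' = s"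
proof (induction i)
  case (Suc i)
  show ?case
  proof (cases "s \<le> outs v k i")
    case True
    then show ?thesis using Suc by (meson le_SucI)
  next
    case False
    then show ?thesis using Suc.prems outs_Suc[of v k i]
      by (intro exI[of _ "Suc i"]) (cases "k < v (Suc i)"; simp)
  qed
qed simp

lemma ins_attained:
  "1 \<le> s \<Longrightarrow> s \<le> ins n v k j \<Longrightarrow> \<exists>j'. j \<le> j' \<and> j' \<le> n \<and> v j' \<le> k \<and> ins n v k j' = s"
proof (induction "Suc n - j" arbitrary: j)
  case 0
  then have "{m \<in> {j..n}. v m \<le> k} = {}" by auto
  then show ?case using 0 by (simp add: ins_def)
next
  case (Suc d)
  then have jn: "j \<le> n" by simp
  show ?case
  proof (cases "s \<le> ins n v k (Suc j)")
    case True
    moreover have "d = Suc n - Suc j" using Suc.hyps(2) by simp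
    ultimately obtain j' where "Suc j \<le> j'" "j' \<le> n" "v j' \<le> k" "ins n v k j' = s"
      using Suc.hyps(1)[of "Suc j"] Suc.prems(1) by blast
    then show ?thesis by (intro exI[of _ j']) auto
  next
    case False
    then show ?thesis using Suc.prems ins_Suc[OF jn, of v k] jn
      by (intro exI[of _ j]) (cases "v j \<le> k"; simp)
  qed
qed

text \<open>Along the product order \<open>outs\<close> grows and \<open>ins\<close> shrinks, so
  equality of ranks holds at most once: the corners for a fixed \<open>k\<close> form an
  antichain.\<close>

lemma corner_unique:
  assumes "corner n v k (i, j)" "corner n v k (i', j')" "i \<le> i'" "j \<le> j'"
  shows "i = i' \<and> j = j'"
proof -
  have eq: "outs v k i = ins n v k j" "outs v k i' = ins n v k j'" "k < v i'" "v j \<le> k" "j \<le> n"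
    using assms by (auto simp: corner_def)
  have "outs v k i \<le> outs v k i'" "ins n v k j' \<le> ins n v k j"
    using assms outs_mono ins_antimono by auto
  then have "outs v k i = outs v k i'" "ins n v k j = ins n v k j'" using eq by auto
  then show ?thesis
    using outs_strict[of i i' k v] ins_strict[of j j' n v k] eq assms(3,4) by force
qed

context
  fixes n :: nat and v :: "nat \<Rightarrow> nat"
  assumes v: "v permutes {1..n}"
begin

lemma v_range: "m \<in> {1..n} \<Longrightarrow> 1 \<le> v m \<and> v m \<le> n"
  using permutes_in_image[OF v, of m] by simp

lemma card_below:
  assumes "k \<le> n" shows "card {m \<in> {1..n}. v m \<le> k} = k"
proof -
  have "v ` {m \<in> {1..n}. v m \<le> k} = (v ` {1..n}) \<inter> {..k}" by blast
  also have "\<dots> = {1..k}" unfolding permutes_image[OF v] using assms by auto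
  finally have "card (v ` {m \<in> {1..n}. v m \<le> k}) = k" by simp
  moreover have "card (v ` {m \<in> {1..n}. v m \<le> k}) = card {m \<in> {1..n}. v m \<le> k}"
    by (rule card_image, rule inj_on_subset[OF permutes_inj[OF v]]) simp
  ultimately show ?thesis by simp
qed

text \<open>Cut the \<open>k\<close> elements \<open>m\<close> with \<open>v m \<le> k\<close> at
  position \<open>c\<close>. For \<open>c = k\<close> the two sides of the matching turn out to have
  equal size.\<close>

lemma outs_ins:
  assumes "k \<le> n" "c \<le> n"
  shows "outs v k c + k = ins n v k (Suc c) + c"
proof -
  have "card {m \<in> {1..n}. v m \<le> k} = card ({m \<in> {1..c}. v m \<le> k} \<union> {m \<in> {Suc c..n}. v m \<le> k})"
    by (rule arg_cong[where f = card]) (use assms in auto)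
  then have "k = card {m \<in> {1..c}. v m \<le> k} + ins n v k (Suc c)"
    unfolding card_below[OF assms(1)] ins_def by (subst (asm) card_Un_disjoint) auto
  moreover have "card {1..c} = card ({m \<in> {1..c}. v m \<le> k} \<union> {m \<in> {1..c}. k < v m})"
    by (rule arg_cong[where f = card]) auto
  then have "c = card {m \<in> {1..c}. v m \<le> k} + outs v k c"
    unfolding outs_def by (subst (asm) card_Un_disjoint) auto
  ultimately show ?thesis by simp
qed

text \<open>Passing from \<open>k\<close> to \<open>Suc k\<close> only moves the element
  \<open>u\<close> from the outside to the inside.\<close>

lemma outs_step:
  assumes "v u = Suc k" "u \<in> {1..n}" "i \<le> n"
  shows "outs v k i = outs v (Suc k) i + of_bool (u \<le> i)"
proof -
  have inj: "v m = Suc k \<longleftrightarrow> m = u" for m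
    using inj_eq[OF permutes_inj[OF v], of m u] assms(1) by simp
  have iff: "k < v m \<longleftrightarrow> m = u \<or> Suc k < v m" for m using inj[of m] by linarith
  have "{m \<in> {1..i}. k < v m} = (if u \<le> i then insert u {m \<in> {1..i}. Suc k < v m} else {m \<in> {1..i}.
      Suc k < v m})"
    using assms by (auto simp: iff)
  then show ?thesis using assms(1) by (simp add: outs_def)
qed

lemma ins_step:
  assumes "v u = Suc k" "u \<in> {1..n}"
  shows "ins n v (Suc k) j = ins n v k j + of_bool (j \<le> u)"
proof -
  have inj: "v m = Suc k \<longleftrightarrow> m = u" for m
    using inj_eq[OF permutes_inj[OF v], of m u] assms(1) by simp
  have "{m \<in> {j..n}. v m \<le> Suc k} = (if j \<le> u then insert u {m \<in> {j..n}. v m \<le> k} else {m \<in> {j..n}.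
      v m \<le> k})"
    using assms(2) by (auto simp: le_Suc_eq inj)
  then show ?thesis using assms(1) by (simp add: ins_def)
qed

text \<open>By \<open>outs_ins\<close>, the difference of \<open>outs v k c\<close> and
  \<open>ins n v k (Suc c)\<close> is \<open>c - k\<close>. At \<open>c = i\<close> it is at most 0
  and at \<open>c = j - 1\<close> at least 0, since both counts are monotone and the ranks of
  \<open>i\<close> and \<open>j\<close> agree.\<close>

lemma corner_range:
  assumes "corner n v k (i, j)"
  shows "1 \<le> k" "k < n" "i \<le> k" "k < j"
proof -
  have c: "1 \<le> i" "i < j" "j \<le> n" "k < v i" "v j \<le> k" "outs v k i = ins n v k j"
    using assms by (auto simp: corner_def)
  show "1 \<le> k" using v_range[of j] c by simp
  show k: "k < n" using v_range[of i] c by simp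
  have "ins n v k j \<le> ins n v k (Suc i)" using c by (intro ins_antimono) simp
  then show "i \<le> k" using outs_ins[of k i] c k by simp
  have "outs v k i \<le> outs v k (j - 1)" using c by (intro outs_mono) simp
  moreover have "outs v k (j - 1) + k = ins n v k (Suc (j - 1)) + (j - 1)"
    by (rule outs_ins) (use c k in auto)
  ultimately show "k < j" using c by simp
qed

lemma corner_in_row:
  assumes "1 \<le> m" "m \<le> k" "k < n" "k < v m"
  shows "\<exists>j. corner n v k (m, j)"
proof -
  have "1 \<le> outs v k m" using outs_pos assms by blast
  moreover have "outs v k m \<le> ins n v k (Suc m)" using outs_ins[of k m] assms by simp
  ultimately obtain j where "Suc m \<le> j" "j \<le> n" "v j \<le> k" "ins n v k j = outs v k m"
    using ins_attained by blast
  then show ?thesis using assms by (intro exI[of _ j]) (auto simp: corner_def)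
qed

lemma corner_in_column:
  assumes "k < m" "m \<le> n" "v m \<le> k"
  shows "\<exists>i. corner n v k (i, m)"
proof -
  have "1 \<le> ins n v k m" using ins_pos assms by blast
  moreover have "outs v k (m - 1) + k = ins n v k (Suc (m - 1)) + (m - 1)"
    by (rule outs_ins) (use assms in auto)
  then have "ins n v k m \<le> outs v k (m - 1)" using assms by simp
  ultimately obtain i where "1 \<le> i" "i \<le> m - 1" "k < v i" "outs v k i = ins n v k m"
    using outs_attained by blast
  then show ?thesis using assms by (intro exI[of _ i]) (auto simp: corner_def)
qed

lemma sum_corner_row:
  assumes "m \<in> {1..n}" "k \<in> {1..<n}"
  shows "(\<Sum>p\<in>idx n. of_bool (corner n v k p) * of_bool (fst p = m)) = (of_bool (m \<le> k \<and> k < v m) ::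
      real)"
proof (cases "m \<le> k \<and> k < v m")
  case True
  then obtain j where j: "corner n v k (m, j)" using corner_in_row assms by auto
  have uniq: "j' = j" if "corner n v k (m, j')" for j'
    using corner_unique[OF j that] corner_unique[OF that j] by (cases "j \<le> j'") auto
  have iff: "corner n v k p \<and> fst p = m \<longleftrightarrow> p = (m, j)" for p
    using j uniq[of "snd p"] by (cases p) auto
  have "(\<Sum>p\<in>idx n. of_bool (corner n v k p) * of_bool (fst p = m)) = (\<Sum>p\<in>idx n. of_bool (p = (m, j))
      :: real)"
    by (rule sum.cong) (simp_all only: of_bool_conj[symmetric] iff)
  also have "\<dots> = 1" using j by (simp add: corner_def)
  finally show ?thesis using True by simp
next
  case False
  then have "corner n v k p \<Longrightarrow> fst p \<noteq> m" for p
    using corner_range(3)[of k m "snd p"] by (cases p) (auto simp: corner_def)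
  then have "(\<Sum>p\<in>idx n. of_bool (corner n v k p) * of_bool (fst p = m)) = (0::real)"
    by (intro sum.neutral) auto
  then show ?thesis using False by simp
qed

lemma sum_corner_column:
  assumes "m \<in> {1..n}" "k \<in> {1..<n}"
  shows "(\<Sum>p\<in>idx n. of_bool (corner n v k p) * of_bool (snd p = m)) = (of_bool (k < m \<and> v m \<le> k) ::
      real)"
proof (cases "k < m \<and> v m \<le> k")
  case True
  then obtain i where i: "corner n v k (i, m)" using corner_in_column assms by auto
  have uniq: "i' = i" if "corner n v k (i', m)" for i'
    using corner_unique[OF i that] corner_unique[OF that i] by (cases "i \<le> i'") auto
  have iff: "corner n v k p \<and> snd p = m \<longleftrightarrow> p = (i, m)" for p
    using i uniq[of "fst p"] by (cases p) auto
  have "(\<Sum>p\<in>idx n. of_bool (corner n v k p) * of_bool (snd p = m)) = (\<Sum>p\<in>idx n. of_bool (p = (i, m))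
      :: real)"
    by (rule sum.cong) (simp_all only: of_bool_conj[symmetric] iff)
  also have "\<dots> = 1" using i by (simp add: corner_def)
  finally show ?thesis using True by simp
next
  case False
  then have "corner n v k p \<Longrightarrow> snd p \<noteq> m" for p
    using corner_range(4)[of k "fst p" m] by (cases p) (auto simp: corner_def)
  then have "(\<Sum>p\<in>idx n. of_bool (corner n v k p) * of_bool (snd p = m)) = (0::real)"
    by (intro sum.neutral) auto
  then show ?thesis using False by simp
qed

text \<open>For each \<open>k\<close> the matching trades elements of {1..k} outside w{1..k} for
  elements of w{1..k} outside {1..k}. This turns the indicator of \<open>m \<le> k\<close> into that
  of \<open>v m \<le> k\<close>.\<close>

lemma mu_perm_point:
  assumes m: "m \<in> {1..n}"
  shows "mu n a (perm_point n a v) m = lam n a (v m)"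
proof -
  have sw: "(\<Sum>p\<in>idx n. perm_point n a v p * of_bool (Q p))
      = (\<Sum>k\<in>{1..<n}. real (a k) * (\<Sum>p\<in>idx n. of_bool (corner n v k p) * of_bool (Q p)))" for Q
    unfolding perm_point_def sum_distrib_right
    by (subst sum.swap) (simp only: sum_distrib_left mult.assoc)
  have "(\<Sum>p\<in>idx n. perm_point n a v p * of_bool (fst p = m)) = (\<Sum>k\<in>{1..<n}. real (a k) * of_bool (m
      \<le> k \<and> k < v m))"
    unfolding sw by (rule sum.cong) (simp_all only: sum_corner_row[OF m])
  moreover have "(\<Sum>p\<in>idx n. perm_point n a v p * of_bool (snd p = m)) = (\<Sum>k\<in>{1..<n}. real (a k) *
      of_bool (k < m \<and> v m \<le> k))"
    unfolding sw by (rule sum.cong) (simp_all only: sum_corner_column[OF m])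
  moreover have "lam n a m = (\<Sum>k\<in>{1..<n}. real (a k) * of_bool (m \<le> k))"
    by (rule lam_eq) (use m in simp)
  ultimately have "mu n a (perm_point n a v) m = (\<Sum>k\<in>{1..<n}. real (a k) * of_bool (m \<le> k))
     - (\<Sum>k\<in>{1..<n}. real (a k) * of_bool (m \<le> k \<and> k < v m))
     + (\<Sum>k\<in>{1..<n}. real (a k) * of_bool (k < m \<and> v m \<le> k))"
    unfolding mu_def by (simp only:)
  also have "\<dots> = (\<Sum>k\<in>{1..<n}. real (a k) * of_bool (v m \<le> k))"
    unfolding sum_subtractf[symmetric] sum.distrib[symmetric]
    by (rule sum.cong) (auto simp: not_less not_le)
  also have "\<dots> = lam n a (v m)" by (rule lam_eq[symmetric]) (use v_range[OF m] in simp)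
  finally show ?thesis .
qed

end

section \<open>Uniqueness of the points of the permutations\<close>

lemma idx_coords: "p \<in> idx n \<Longrightarrow> fst p \<in> {1..n}" "p \<in> idx n \<Longrightarrow> snd p \<in> {1..n}"
  by (auto simp: idx_def)

context
  fixes n :: nat and v :: "nat \<Rightarrow> nat" and a :: "nat \<Rightarrow> nat"
  assumes v: "v permutes {1..n}" and a: "\<forall>i\<in>{1..n - 1}. 0 < a i"
begin

lemma perm_point_nonneg: "0 \<le> perm_point n a v p"
  unfolding perm_point_def by (rule sum_nonneg) auto

lemma perm_point_nonzero_iff: "perm_point n a v p \<noteq> 0 \<longleftrightarrow> (\<exists>k. corner n v k p)"
proof
  assume "perm_point n a v p \<noteq> 0"
  then show "\<exists>k. corner n v k p"
    unfolding perm_point_def by (rule sum.not_neutral_contains_not_neutral) (auto split: if_splits)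
next
  assume "\<exists>k. corner n v k p"
  then obtain k where k: "corner n v k p" by blast
  then have kr: "k \<in> {1..<n}" using corner_range(1,2)[OF v, of k "fst p" "snd p"] by auto
  have "0 < perm_point n a v p"
    unfolding perm_point_def by (rule sum_pos2[OF _ kr]) (use k kr a in auto)
  then show "perm_point n a v p \<noteq> 0" by simp
qed

lemma perm_point_U: "perm_point n a v \<in> U_space n"
  by (auto simp: U_space_def perm_point_def corner_def)

lemma sum_perm_point:
  "sum (perm_point n a v) A = (\<Sum>k\<in>{1..<n}. real (a k) * (\<Sum>p\<in>A. of_bool (corner n v k p)))"
proof -
  have "sum (perm_point n a v) A = (\<Sum>p\<in>A. \<Sum>k\<in>{1..<n}. real (a k) * of_bool (corner n v k p))"
    by (rule sum.cong) (simp_all only: perm_point_def)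
  also have "\<dots> = (\<Sum>k\<in>{1..<n}. \<Sum>p\<in>A. real (a k) * of_bool (corner n v k p))"
    by (rule sum.swap)
  finally show ?thesis by (simp only: sum_distrib_left)
qed

lemma corner_hits_le:
  assumes d: "dyck_path n d"
  shows "(\<Sum>p\<in>set d. of_bool (corner n v k p)) \<le> (of_bool (src d \<le> k \<and> k < snk d) :: real)"
    and "(\<Sum>p\<in>set d. of_bool (corner n v k p)) = (0::real) \<longleftrightarrow> (\<forall>p\<in>set d. \<not> corner n v k p)"
proof -
  show "(\<Sum>p\<in>set d. of_bool (corner n v k p)) = (0::real) \<longleftrightarrow> (\<forall>p\<in>set d. \<not> corner n v k p)"
    by (subst sum_nonneg_eq_0_iff) auto
  show "(\<Sum>p\<in>set d. of_bool (corner n v k p)) \<le> (of_bool (src d \<le> k \<and> k < snk d) :: real)"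
  proof (cases "\<exists>p\<in>set d. corner n v k p")
    case True
    then obtain i j where p: "(i, j) \<in> set d" "corner n v k (i, j)" by auto
    have s: "successively lstep d" using d by (simp add: dyck_path_iff)
    have uniq: "q = (i, j)" if "q \<in> set d" "corner n v k q" for q
    proof -
      obtain i' j' where q: "q = (i', j')" by (cases q)
      have c: "corner n v k (i', j')" using that(2) q by simp
      have "i \<le> i' \<and> j \<le> j' \<or> i' \<le> i \<and> j' \<le> j"
        using lattice_path_chain[OF s p(1) that(1)] q by simp
      then show ?thesis using corner_unique[OF p(2) c] corner_unique[OF c p(2)] q by blast
    qed
    have "(\<Sum>p\<in>set d. of_bool (corner n v k p)) = (\<Sum>p\<in>set d. if p = (i, j) then 1 else (0::real))"
    proof (rule sum.cong)
      fix q assume "q \<in> set d"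
      then have "corner n v k q \<longleftrightarrow> q = (i, j)" using uniq p(2) by blast
      then show "of_bool (corner n v k q) = (if q = (i, j) then 1 else (0::real))" by simp
    qed simp
    then show ?thesis
      using p corner_range(3,4)[OF v p(2)] dyck_path_elem[OF d p(1)] by simp
  next
    case False
    then have "(\<Sum>p\<in>set d. of_bool (corner n v k p)) = (0::real)" by (intro sum.neutral) auto
    then show ?thesis by simp
  qed
qed

lemma perm_point_FFLV: "perm_point n a v \<in> FFLV n a"
  unfolding FFLV_iff
proof (intro conjI perm_point_U ballI perm_point_nonneg allI impI)
  fix d assume d: "dyck_path n d"
  have "sum (perm_point n a v) (set d) \<le> (\<Sum>k\<in>{1..<n}. real (a k) * of_bool (src d \<le> k \<and> k < snk d))"
    unfolding sum_perm_point by (intro sum_mono mult_left_mono corner_hits_le[OF d]) auto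
  also have "\<dots> = lam n a (src d) - lam n a (snk d)"
    by (rule lam_diff[symmetric]) (use dyck_path_ends[OF d] in auto)
  finally show "sum (perm_point n a v) (set d) \<le> lam n a (src d) - lam n a (snk d)" .
qed

text \<open>The bound of a path is the sum of its \<open>a k\<close>, and for each \<open>k\<close>
  the path meets at most one corner. Missing one of them loses a positive
  \<open>a k\<close>.\<close>

lemma tight_perm_point_meets:
  assumes t: "tight n a (perm_point n a v) d" and k: "src d \<le> k" "k < snk d"
  shows "\<exists>p\<in>set d. corner n v k p"
proof (rule ccontr)
  assume neg: "\<not> ?thesis"
  have d: "dyck_path n d" using t by (simp add: tight_def)
  have kr: "k \<in> {1..<n}" using dyck_path_ends[OF d] k by auto
  have "sum (perm_point n a v) (set d) < (\<Sum>k\<in>{1..<n}. real (a k) * of_bool (src d \<le> k \<and> k < snk d))"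
    unfolding sum_perm_point
  proof (rule sum_strict_mono_ex1)
    show "\<forall>k\<in>{1..<n}. real (a k) * (\<Sum>p\<in>set d. of_bool (corner n v k p)) \<le> real (a k) * of_bool (src
        d \<le> k \<and> k < snk d)"
      by (intro ballI mult_left_mono corner_hits_le[OF d]) auto
    have "(\<Sum>p\<in>set d. of_bool (corner n v k p)) = (0::real)" using neg by (intro sum.neutral) auto
    moreover have "0 < a k" using a kr by auto
    ultimately have "real (a k) * (\<Sum>p\<in>set d. of_bool (corner n v k p)) < real (a k) * of_bool (src d
        \<le> k \<and> k < snk d)"
      using k by simp
    then show "\<exists>k\<in>{1..<n}. real (a k) * (\<Sum>p\<in>set d. of_bool (corner n v k p)) < real (a k) * of_bool
        (src d \<le> k \<and> k < snk d)"
      using kr by blast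
  qed simp
  also have "\<dots> = lam n a (src d) - lam n a (snk d)"
    by (rule lam_diff[symmetric]) (use dyck_path_ends[OF d] in auto)
  finally show False using t by (simp add: tight_def)
qed

text \<open>If the rank of \<open>i\<close> is at most that of \<open>j\<close>, the partner of
  \<open>i\<close> is \<open>j\<close> or lies to its right, and the row of that hook contains the
  point. Otherwise the partner of \<open>j\<close> lies above, and the column of its hook
  does.\<close>

lemma out_in_covered:
  assumes "(i, j) \<in> idx n" "k < v i" "v j \<le> k"
  shows "\<exists>q. corner n v k q \<and> (i, j) \<in> set (hook (fst q) (snd q))"
proof -
  have ij: "1 \<le> i" "i < j" "j \<le> n" using assms by auto
  show ?thesis
  proof (cases "outs v k i \<le> ins n v k j")
    case True
    then obtain j' where "j \<le> j'" "j' \<le> n" "v j' \<le> k" "ins n v k j' = outs v k i"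
      using ins_attained outs_pos[of i k v] assms ij by blast
    then show ?thesis using ij assms
      by (intro exI[of _ "(i, j')"]) (auto simp: corner_def set_hook)
  next
    case False
    then obtain i' where "1 \<le> i'" "i' \<le> i" "k < v i'" "outs v k i' = ins n v k j"
      using outs_attained[of "ins n v k j" v k i] ins_pos[of j n v k] assms ij by auto
    then show ?thesis using ij assms
      by (intro exI[of _ "(i', j)"]) (auto simp: corner_def set_hook image_iff le_less)
  qed
qed

text \<open>The elements common to {1..k} and w{1..k} cancel on the right; the others are exactly
  the rows and columns of the corners.\<close>

lemma sum_corner_lam:
  assumes k: "k \<in> {1..<n}"
  shows "(\<Sum>q\<in>{q. corner n v k q}. lam n a (fst q) - lam n a (snd q))
    = (\<Sum>m\<in>{1..n}. lam n a m * (of_bool (m \<le> k) - of_bool (v m \<le> k)))"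
proof -
  have sub: "{q. corner n v k q} \<subseteq> idx n" by (auto simp: corner_def)
  have *: "(\<Sum>q\<in>{q. corner n v k q}. lam n a (f q))
      = (\<Sum>m\<in>{1..n}. lam n a m * (\<Sum>p\<in>idx n. of_bool (corner n v k p) * of_bool (f p = m)))"
    if f: "\<And>p. p \<in> idx n \<Longrightarrow> f p \<in> {1..n}" for f
  proof -
    have "(\<Sum>q\<in>{q. corner n v k q}. lam n a (f q)) = (\<Sum>p\<in>idx n. of_bool (corner n v k p) * lam n a (f
        p))"
      using sub by (intro sum.mono_neutral_cong_left) auto
    also have "\<dots> = (\<Sum>p\<in>idx n. \<Sum>m\<in>{1..n}. lam n a m * (of_bool (corner n v k p) * of_bool (f p =
        m)))"
    proof (rule sum.cong)
      fix p assume "p \<in> idx n"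
      then have "f p \<in> {1..n}" by (rule f)
      have "(\<Sum>m\<in>{1..n}. lam n a m * (of_bool (corner n v k p) * of_bool (f p = m)))
        = (\<Sum>m\<in>{1..n}. if m = f p then of_bool (corner n v k p) * lam n a (f p) else 0)"
        by (rule sum.cong) auto
      then show "of_bool (corner n v k p) * lam n a (f p) = (\<Sum>m\<in>{1..n}. lam n a m * (of_bool (corner
          n v k p) * of_bool (f p = m)))"
        using \<open>f p \<in> {1..n}\<close> by simp
    qed simp
    also have "\<dots> = (\<Sum>m\<in>{1..n}. lam n a m * (\<Sum>p\<in>idx n. of_bool (corner n v k p) * of_bool (f p =
        m)))"
      by (subst sum.swap) (simp only: sum_distrib_left)
    finally show ?thesis .
  qed
  have "(\<Sum>q\<in>{q. corner n v k q}. lam n a (fst q)) = (\<Sum>m\<in>{1..n}. lam n a m * of_bool (m \<le> k \<and> k < v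
      m))"
    by (rule trans[OF *[of fst, OF idx_coords(1)]], assumption, rule sum.cong) (simp_all only:
        sum_corner_row[OF v _ k])
  moreover have "(\<Sum>q\<in>{q. corner n v k q}. lam n a (snd q)) = (\<Sum>m\<in>{1..n}. lam n a m * of_bool (k < m
      \<and> v m \<le> k))"
    by (rule trans[OF *[of snd, OF idx_coords(2)]], assumption, rule sum.cong) (simp_all only:
        sum_corner_column[OF v _ k])
  moreover have "(\<Sum>m\<in>{1..n}. lam n a m * of_bool (m \<le> k \<and> k < v m)) - (\<Sum>m\<in>{1..n}. lam n a m *
      of_bool (k < m \<and> v m \<le> k))
    = (\<Sum>m\<in>{1..n}. lam n a m * (of_bool (m \<le> k) - of_bool (v m \<le> k)))"
    unfolding sum_subtractf[symmetric] by (rule sum.cong) (auto simp: not_less not_le)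
  ultimately show ?thesis by (simp only: sum_subtractf)
qed

text \<open>
  The coordinates of an extremal weight indexed by \<open>w{1..k}\<close> have the largest possible sum. The
  hooks at the corners cover all positions that contribute to it positively, and their bounds add up to this
  maximum, so all inequalities are equalities.
\<close>

lemma weight_forces_hooks:
  assumes T: "T \<in> FFLV n a" and mu: "\<And>m. m \<in> {1..n} \<Longrightarrow> mu n a T m = lam n a (v m)"
    and k: "k \<in> {1..<n}"
  shows "corner n v k (i, j) \<Longrightarrow> tight n a T (hook i j)"
    and "corner n v k q \<Longrightarrow> p \<in> set (hook (fst q) (snd q)) \<Longrightarrow> \<not> (k < v (fst p) \<and> v (snd p) \<le> k) \<Longrightarrow> T p =
        0"
    and "p \<in> idx n \<Longrightarrow> v (fst p) \<le> k \<Longrightarrow> k < v (snd p) \<Longrightarrow> T p = 0"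
proof -
  define A where "A = {q. corner n v k q}"
  define N :: "nat \<times> nat \<Rightarrow> real" where "N p = (\<Sum>q\<in>A. of_bool (p \<in> set (hook (fst q) (snd q))))" for
      p
  \<comment> \<open>The coefficient of \<open>T p\<close> in the sum of the weight coordinates over
    all \<open>m\<close> with \<open>v m \<le> k\<close>.\<close>
  define del :: "nat \<times> nat \<Rightarrow> real" where "del p = of_bool (v (snd p) \<le> k) - of_bool (v (fst p) \<le> k)"
      for p
  have finA: "finite A" unfolding A_def by (rule finite_subset[OF _ finite_idx[of n]]) (auto simp:
      corner_def)
  have A: "dyck_path n (hook (fst q) (snd q))" "src (hook (fst q) (snd q)) = fst q" "snk (hook (fst
      q) (snd q)) = snd q"
    if "q \<in> A" for q
    using that dyck_path_hook[of "fst q" "snd q" n] by (auto simp: A_def corner_def idx_def)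
  have Tpos: "0 \<le> T p" if "p \<in> idx n" for p using T that by (auto simp: FFLV_iff)
  have hookle: "sum T (set (hook (fst q) (snd q))) \<le> lam n a (fst q) - lam n a (snd q)" if "q \<in> A"
      for q
    using T A[OF that] by (auto simp: FFLV_iff)
  have delN: "del p \<le> N p" if "p \<in> idx n" for p
  proof (cases "k < v (fst p) \<and> v (snd p) \<le> k")
    case True
    then obtain q where q: "corner n v k q" "p \<in> set (hook (fst q) (snd q))"
      using out_in_covered[of "fst p" "snd p" k] \<open>p \<in> idx n\<close> by auto
    have "1 \<le> N p"
      unfolding N_def using member_le_sum[of q A "\<lambda>q. of_bool (p \<in> set (hook (fst q) (snd q))) ::
          real"] q finA
      by (auto simp: A_def)
    then show ?thesis by (simp add: del_def)
  next
    case False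
    then have "del p \<le> 0" by (auto simp: del_def)
    moreover have "0 \<le> N p" unfolding N_def by (rule sum_nonneg) auto
    ultimately show ?thesis by simp
  qed
  have "(\<Sum>m\<in>{1..n}. of_bool (v m \<le> k) * mu n a T m) = (\<Sum>m\<in>{1..n}. of_bool (v m \<le> k) * lam n a (v
      m))"
    by (rule sum.cong) (auto simp: mu)
  also have "\<dots> = (\<Sum>m\<in>{1..n}. of_bool (m \<le> k) * lam n a m)"
    using sum.permute[OF v, of "\<lambda>m. of_bool (m \<le> k) * lam n a m"] by (simp add: o_def)
  finally have W1: "(\<Sum>m\<in>{1..n}. of_bool (v m \<le> k) * mu n a T m) = (\<Sum>m\<in>{1..n}. of_bool (m \<le> k) * lam
      n a m)" .
  have sw: "(\<Sum>m\<in>{1..n}. of_bool (v m \<le> k) * (\<Sum>p\<in>idx n. T p * of_bool (f p = m))) = (\<Sum>p\<in>idx n. T p *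
      of_bool (v (f p) \<le> k))"
    if f: "\<And>p. p \<in> idx n \<Longrightarrow> f p \<in> {1..n}" for f
  proof -
    have "(\<Sum>m\<in>{1..n}. of_bool (v m \<le> k) * (\<Sum>p\<in>idx n. T p * of_bool (f p = m)))
      = (\<Sum>p\<in>idx n. \<Sum>m\<in>{1..n}. of_bool (v m \<le> k) * (T p * of_bool (f p = m)))"
      by (subst sum.swap) (simp only: sum_distrib_left)
    also have "\<dots> = (\<Sum>p\<in>idx n. T p * of_bool (v (f p) \<le> k))"
    proof (rule sum.cong)
      fix p assume "p \<in> idx n"
      then have "f p \<in> {1..n}" by (rule f)
      have "(\<Sum>m\<in>{1..n}. of_bool (v m \<le> k) * (T p * of_bool (f p = m)))
        = (\<Sum>m\<in>{1..n}. if m = f p then T p * of_bool (v (f p) \<le> k) else 0)"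
        by (rule sum.cong) auto
      then show "(\<Sum>m\<in>{1..n}. of_bool (v m \<le> k) * (T p * of_bool (f p = m))) = T p * of_bool (v (f p)
          \<le> k)"
        using \<open>f p \<in> {1..n}\<close> by simp
    qed simp
    finally show ?thesis .
  qed
  have "(\<Sum>m\<in>{1..n}. of_bool (v m \<le> k) * mu n a T m) = (\<Sum>m\<in>{1..n}. of_bool (v m \<le> k) * lam n a m)
      - (\<Sum>m\<in>{1..n}. of_bool (v m \<le> k) * (\<Sum>p\<in>idx n. T p * of_bool (fst p = m)))
      + (\<Sum>m\<in>{1..n}. of_bool (v m \<le> k) * (\<Sum>p\<in>idx n. T p * of_bool (snd p = m)))"
    unfolding mu_def by (simp only: distrib_left right_diff_distrib sum.distrib sum_subtractf)
  also have "\<dots> = (\<Sum>m\<in>{1..n}. of_bool (v m \<le> k) * lam n a m) + (\<Sum>p\<in>idx n. T p * del p)"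
    unfolding del_def right_diff_distrib sum_subtractf
    using sw[of fst, OF idx_coords(1)] sw[of snd, OF idx_coords(2)] by linarith
  finally have "(\<Sum>p\<in>idx n. T p * del p) = (\<Sum>m\<in>{1..n}. of_bool (m \<le> k) * lam n a m) - (\<Sum>m\<in>{1..n}.
      of_bool (v m \<le> k) * lam n a m)"
    using W1 by simp
  also have "\<dots> = (\<Sum>m\<in>{1..n}. lam n a m * (of_bool (m \<le> k) - of_bool (v m \<le> k)))"
    unfolding sum_subtractf[symmetric] by (rule sum.cong) (auto simp: algebra_simps)
  also have "\<dots> = (\<Sum>q\<in>A. lam n a (fst q) - lam n a (snd q))"
    unfolding A_def by (rule sum_corner_lam[OF k, symmetric])
  finally have W: "(\<Sum>p\<in>idx n. T p * del p) = (\<Sum>q\<in>A. lam n a (fst q) - lam n a (snd q))" .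
  have "(\<Sum>q\<in>A. sum T (set (hook (fst q) (snd q)))) = (\<Sum>q\<in>A. \<Sum>p\<in>idx n. T p * of_bool (p \<in> set (hook
      (fst q) (snd q))))"
  proof (rule sum.cong)
    fix q assume "q \<in> A"
    then have "set (hook (fst q) (snd q)) \<subseteq> idx n" using A(1) by (auto simp: dyck_path_iff)
    then show "sum T (set (hook (fst q) (snd q))) = (\<Sum>p\<in>idx n. T p * of_bool (p \<in> set (hook (fst q)
        (snd q))))"
      by (intro sum.mono_neutral_cong_left) auto
  qed simp
  also have "\<dots> = (\<Sum>p\<in>idx n. T p * N p)"
    unfolding N_def by (subst sum.swap) (simp only: sum_distrib_left)
  finally have hs: "(\<Sum>q\<in>A. sum T (set (hook (fst q) (snd q)))) = (\<Sum>p\<in>idx n. T p * N p)" .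
  have le1: "(\<Sum>q\<in>A. sum T (set (hook (fst q) (snd q)))) \<le> (\<Sum>q\<in>A. lam n a (fst q) - lam n a (snd q))"
    by (rule sum_mono) (use hookle in auto)
  have nn: "0 \<le> T p * (N p - del p)" if "p \<in> idx n" for p using Tpos delN that by simp
  have "(\<Sum>p\<in>idx n. T p * (N p - del p)) \<le> 0"
    using le1 hs W by (simp add: right_diff_distrib sum_subtractf)
  then have z: "(\<Sum>p\<in>idx n. T p * (N p - del p)) = 0" using nn by (intro antisym sum_nonneg) auto
  then have "\<forall>p\<in>idx n. T p * (N p - del p) = 0"
    using nn by (subst (asm) sum_nonneg_eq_0_iff) auto
  then have E: "T p = 0 \<or> N p = del p" if "p \<in> idx n" for p using that by auto
  have "(\<Sum>q\<in>A. (lam n a (fst q) - lam n a (snd q)) - sum T (set (hook (fst q) (snd q)))) = 0"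
    using z hs W by (simp add: right_diff_distrib sum_subtractf)
  then have H: "\<forall>q\<in>A. (lam n a (fst q) - lam n a (snd q)) - sum T (set (hook (fst q) (snd q))) = 0"
    using hookle finA by (subst (asm) sum_nonneg_eq_0_iff) auto
  show "tight n a T (hook i j)" if "corner n v k (i, j)"
  proof -
    have "(i, j) \<in> A" using that by (simp add: A_def)
    then show ?thesis using H A by (fastforce simp: tight_def)
  qed
  show "T p = 0" if q: "corner n v k q" and p: "p \<in> set (hook (fst q) (snd q))" and np: "\<not> (k < v
      (fst p) \<and> v (snd p) \<le> k)"
  proof -
    have "q \<in> A" using q by (simp add: A_def)
    then have "p \<in> idx n" using A(1)[of q] p unfolding dyck_path_iff by blast
    have "1 \<le> N p"
      unfolding N_def using member_le_sum[of q A "\<lambda>q. of_bool (p \<in> set (hook (fst q) (snd q))) ::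
          real"] p finA \<open>q \<in> A\<close>
      by auto
    moreover have "del p \<le> 0" using np by (auto simp: del_def)
    ultimately show ?thesis using E[OF \<open>p \<in> idx n\<close>] by auto
  qed
  show "T p = 0" if "p \<in> idx n" "v (fst p) \<le> k" "k < v (snd p)"
  proof -
    have "del p = -1" using that by (simp add: del_def)
    moreover have "0 \<le> N p" unfolding N_def by (rule sum_nonneg) auto
    ultimately show ?thesis using E[OF that(1)] by auto
  qed
qed

text \<open>If \<open>v i < v j\<close>, the point contributes negatively for
  \<open>k = v i\<close>. Otherwise let \<open>g\<close> be the rank of \<open>i\<close> minus that
  of \<open>j\<close>. It has no zero for \<open>v j \<le> k < v i\<close>, and it drops by at most
  one per step, so it is negative at \<open>v j\<close> or positive on the whole range. In the first
  case consider \<open>k = v j - 1\<close>, where \<open>j\<close> is not yet inside: the partner of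
  \<open>i\<close> lies right of \<open>j\<close>, so the point is on a corner hook without
  contributing positively. In the second case argue likewise with \<open>k = v i\<close> and the
  partner of \<open>j\<close>.\<close>

lemma weight_zero_off_corners:
  assumes T: "T \<in> FFLV n a" and mu: "\<And>m. m \<in> {1..n} \<Longrightarrow> mu n a T m = lam n a (v m)"
    and ij: "(i, j) \<in> idx n" and nc: "\<And>k. \<not> corner n v k (i, j)"
  shows "T (i, j) = 0"
proof -
  have r: "1 \<le> i" "i < j" "j \<le> n" using ij by auto
  have vi: "1 \<le> v i" "v i \<le> n" and vj: "1 \<le> v j" "v j \<le> n"
    using v_range[OF v, of i] v_range[OF v, of j] r by auto
  have "v i \<noteq> v j" using inj_eq[OF permutes_inj[OF v], of i j] r by simp
  then consider "v i < v j" | "v j < v i" by linarith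
  then show ?thesis
  proof cases
    case 1
    then show ?thesis
      using weight_forces_hooks(3)[OF T mu, of "v i" "(i, j)"] vi vj ij by auto
  next
    case 2
    define g where "g k = int (outs v k i) - int (ins n v k j)" for k
    have gne: "g k \<noteq> 0" if "v j \<le> k" "k < v i" for k
      using nc[of k] that ij by (auto simp: corner_def g_def)
    have gstep: "g k - 1 \<le> g (Suc k)" if "k < n" for k
    proof -
      have "Suc k \<in> v ` {1..n}" using permutes_image[OF v] that by auto
      then obtain u where u: "u \<in> {1..n}" "v u = Suc k" by auto
      show ?thesis
        using outs_step[OF v u(2,1), of i] ins_step[OF v u(2,1), of j] r by (auto simp: g_def)
    qed
    show ?thesis
    proof (cases "g (v j) < 0")
      case True
      obtain k where k: "v j = Suc k" using vj by (cases "v j") auto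
      have st: "outs v k i = outs v (Suc k) i" "ins n v (Suc k) j = ins n v k j + 1"
        using outs_step[OF v k, of i] ins_step[OF v k, of j] r by auto
      have op: "1 \<le> outs v k i" using outs_pos[of i k v] r 2 k by simp
      have "outs v k i \<le> ins n v k j" using True st k by (simp add: g_def)
      then obtain j' where j': "j \<le> j'" "j' \<le> n" "v j' \<le> k" "ins n v k j' = outs v k i"
        using ins_attained[OF op] by blast
      have c: "corner n v k (i, j')" using j' r 2 k by (auto simp: corner_def)
      have "j < j'" using j' k by (cases "j = j'") auto
      then have "(i, j) \<in> set (hook (fst (i, j')) (snd (i, j')))" using r by (auto simp: set_hook)
      then show ?thesis
        using weight_forces_hooks(2)[OF T mu _ c, of "(i, j)"] corner_range[OF v c] k by auto
    next
      case False
      have gpos: "0 < g k" if "v j \<le> k" "k < v i" for k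
        using that
      proof (induction k rule: dec_induct)
        case base
        then show ?case using False gne[of "v j"] 2 by force
      next
        case (step k)
        then have "0 < g k" by simp
        then have "0 \<le> g (Suc k)" using gstep[of k] step vi by simp
        then show ?case using gne[of "Suc k"] step by simp
      qed
      obtain k where k: "v i = Suc k" using vi by (cases "v i") auto
      have gk: "0 < g k" by (rule gpos) (use k 2 in auto)
      have st: "outs v k i = outs v (Suc k) i + 1" "ins n v (Suc k) j = ins n v k j"
        using outs_step[OF v k, of i] ins_step[OF v k, of j] r by auto
      have ip: "1 \<le> ins n v (Suc k) j" using ins_pos[of j n v "Suc k"] r 2 k by simp
      have "ins n v (Suc k) j \<le> outs v (Suc k) i" using gk st by (simp add: g_def)
      then obtain i' where i': "1 \<le> i'" "i' \<le> i" "Suc k < v i'" "outs v (Suc k) i' = ins n v (Suc k)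
          j"
        using outs_attained[OF ip] by blast
      have c: "corner n v (Suc k) (i', j)" using i' r 2 k by (auto simp: corner_def)
      have "i' < i" using i' k by (cases "i' = i") auto
      then have "(i, j) \<in> set (hook (fst (i', j)) (snd (i', j)))" using r by (auto simp: set_hook)
      then show ?thesis
        using weight_forces_hooks(2)[OF T mu _ c, of "(i, j)"] corner_range[OF v c] k by auto
    qed
  qed
qed

lemma perm_point_hook_tight:
  assumes "corner n v k (i, j)" shows "tight n a (perm_point n a v) (hook i j)"
  using weight_forces_hooks(1)[OF perm_point_FFLV mu_perm_point[OF v] _ assms] corner_range[OF v
      assms] by auto

text \<open>Both points vanish off the corners and make the corner hooks tight, so their difference
  solves the homogeneous hook system.\<close>

lemma perm_point_unique:
  assumes T: "T \<in> FFLV n a" and mu: "\<And>m. m \<in> {1..n} \<Longrightarrow> mu n a T m = lam n a (v m)"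
  shows "T = perm_point n a v"
proof -
  have "T - perm_point n a v = 0"
  proof (rule hook_system_trivial[where x = "perm_point n a v"])
    show "T - perm_point n a v \<in> U_space n"
      using T perm_point_U by (intro U_space_diff) (auto simp: FFLV_iff)
  next
    fix p assume p: "p \<in> idx n" "perm_point n a v p = 0"
    then have "\<not> corner n v k p" for k using perm_point_nonzero_iff by blast
    then have "T (fst p, snd p) = 0" by (intro weight_zero_off_corners[OF T mu]) (use p in auto)
    then show "(T - perm_point n a v) p = 0" using p by simp
  next
    fix i j assume ij: "(i, j) \<in> idx n" "perm_point n a v (i, j) \<noteq> 0"
    then obtain k where k: "corner n v k (i, j)" using perm_point_nonzero_iff by blast
    have "k \<in> {1..<n}" using corner_range[OF v k] by auto
    then have "tight n a T (hook i j)" using weight_forces_hooks(1)[OF T mu _ k] by blast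
    then show "sum (T - perm_point n a v) (set (hook i j)) = 0"
      using perm_point_hook_tight[OF k] by (simp add: tight_def sum_subtractf)
  qed
  then show ?thesis by (simp only: right_minus_eq)
qed

end

lemma perm_vertex_eq:
  assumes w: "w permutes {1..n}" and a: "\<forall>i\<in>{1..n - 1}. 0 < a i" and n: "1 \<le> n"
  shows "perm_vertex n a w = perm_point n a (inv w)"
  unfolding perm_vertex_def
proof (rule the_equality)
  note v = permutes_inv[OF w]
  have "perm_point n a (inv w) p \<in> \<int>" for p
    unfolding perm_point_def by (rule Ints_sum) auto
  then show "perm_point n a (inv w) \<in> FFLV_points n a \<and>
      point_weight n a (perm_point n a (inv w)) = weyl_act n w (highest_weight n a)"
    using perm_point_FFLV[OF v a] perm_point_U[OF v a] mu_perm_point[OF v]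
    unfolding point_weight_eq_weyl_act_iff[OF w n] FFLV_points_def U_lattice_def by blast
  fix T assume "T \<in> FFLV_points n a \<and> point_weight n a T = weyl_act n w (highest_weight n a)"
  then show "T = perm_point n a (inv w)"
    using perm_point_unique[OF v a] unfolding point_weight_eq_weyl_act_iff[OF w n] FFLV_points_def
        by blast
qed

section \<open>Simple vertices and uncrossed permutations\<close>

text \<open>With \<open>m = i + 1\<close> this is the condition on \<open>i\<close> and
  \<open>j\<close>. The quantifiers range over all naturals, so the notion does not depend on the
  ground set, which varies when permutations are glued below.\<close>

definition uncrossed :: "(nat \<Rightarrow> nat) \<Rightarrow> bool" where
  "uncrossed v \<longleftrightarrow> \<not> (\<exists>m j. v j < m \<and> m < j \<and> j < v m)"

lemma uncrossed_iff:
  assumes "v permutes {1..n}"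
  shows "uncrossed v \<longleftrightarrow> (\<forall>i j. 1 \<le> i \<and> i < j \<and> j \<le> n \<longrightarrow> v j \<le> i \<longrightarrow> v (i + 1) \<le> j)"
proof
  assume u: "uncrossed v"
  show "\<forall>i j. 1 \<le> i \<and> i < j \<and> j \<le> n \<longrightarrow> v j \<le> i \<longrightarrow> v (i + 1) \<le> j"
  proof (intro allI impI)
    fix i j assume "1 \<le> i \<and> i < j \<and> j \<le> n" "v j \<le> i"
    \<comment> \<open>The case \<open>i + 1 = j\<close> is automatic, since
      \<open>v j \<le> i < j\<close>.\<close>
    then have "i + 1 = j \<or> v j < i + 1 \<and> i + 1 < j" "v j \<le> j" by auto
    then show "v (i + 1) \<le> j"
      using u unfolding uncrossed_def by (metis not_less)
  qed
next
  assume *: "\<forall>i j. 1 \<le> i \<and> i < j \<and> j \<le> n \<longrightarrow> v j \<le> i \<longrightarrow> v (i + 1) \<le> j"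
  show "uncrossed v"
    unfolding uncrossed_def
  proof
    assume "\<exists>m j. v j < m \<and> m < j \<and> j < v m"
    then obtain m j where mj: "v j < m" "m < j" "j < v m" by blast
    have "j \<in> {1..n}" using assms mj by (metis permutes_not_in less_trans less_irrefl)
    moreover have "1 \<le> v j" using v_range[OF assms calculation] by simp
    ultimately have "1 \<le> m - 1 \<and> m - 1 < j \<and> j \<le> n" "v j \<le> m - 1" using mj by auto
    then have "v (m - 1 + 1) \<le> j" using * by blast
    then show False using mj by simp
  qed
qed

text \<open>A crossing \<open>v j < m < j < v m\<close> yields a corner \<open>(i, j)\<close> with
  \<open>i < m\<close> and a corner \<open>(m, l)\<close> with \<open>l > j\<close>. Their tight
  hooks meet at \<open>(m, j)\<close>, one in its column and the other in its row, and exchanging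
  tails gives a tight path from \<open>i\<close> to \<open>l\<close> that avoids
  \<open>(i, l)\<close>. Without crossings, the corners met by a tight path are followed along its
  first row up to its sink.\<close>

lemma perm_point_hook_vertex_iff:
  assumes v: "v permutes {1..n}" and a: "\<forall>i\<in>{1..n - 1}. 0 < a i"
  shows "hook_vertex n a (perm_point n a v) \<longleftrightarrow> uncrossed v"
proof
  assume u: "uncrossed v"
  have key: "v m \<le> j" if "v j < m" "m \<le> j" for m j
    using u that unfolding uncrossed_def by (metis le_neq_implies_less less_imp_le not_less)
  show "hook_vertex n a (perm_point n a v)"
    unfolding hook_vertex_def
  proof (intro conjI allI impI)
    fix i j assume "(i, j) \<in> idx n" "perm_point n a v (i, j) \<noteq> 0"
    then show "tight n a (perm_point n a v) (hook i j)"
      using perm_point_nonzero_iff[OF v a] perm_point_hook_tight[OF v a] by blast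
  next
    fix d assume t: "tight n a (perm_point n a v) d"
    have d: "dyck_path n d" using t by (simp add: tight_def)
    \<comment> \<open>An invariant for moving right in row \<open>src d\<close>: its last clause
      forces a corner for \<open>k = j\<close> on the path to lie again in this row.\<close>
    define Q where "Q j \<longleftrightarrow> j \<le> snk d \<and> src d < j \<and> (src d, j) \<in> set d \<and> (\<exists>k. corner n v k (src d, j))
        \<and>
      (\<forall>m. src d < m \<longrightarrow> m \<le> j \<longrightarrow> v m \<le> j)" for j
    have "\<exists>j. Q j"
    proof -
      obtain i j where p: "(i, j) \<in> set d" "corner n v (src d) (i, j)"
        using tight_perm_point_meets[OF v a t, of "src d"] dyck_path_ends[OF d] by auto
      have e: "i = src d" "src d < j" "j \<le> snk d"
        using corner_range[OF v p(2)] dyck_path_elem[OF d p(1)] by auto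
      have vj: "v j \<le> src d" using p(2) by (simp add: corner_def)
      have "v m \<le> j" if "src d < m" "m \<le> j" for m
        by (rule key) (use vj that in auto)
      then have "Q j" using e p by (auto simp: Q_def)
      then show ?thesis ..
    qed
    moreover have "\<forall>j. Q j \<longrightarrow> j \<le> snk d" by (simp add: Q_def)
    ultimately obtain j where j: "Q j" "\<And>j'. Q j' \<Longrightarrow> j' \<le> j"
      by (metis (no_types, lifting) GreatestI_nat Greatest_le_nat)
    have "j = snk d"
    proof (rule ccontr)
      assume "j \<noteq> snk d"
      then have "src d \<le> j" "j < snk d" using j(1) by (auto simp: Q_def)
      then obtain i j' where p: "(i, j') \<in> set d" "corner n v j (i, j')"
        using tight_perm_point_meets[OF v a t, of j] by auto
      have r: "i \<le> j" "j < j'" "src d \<le> i" "j' \<le> snk d" "j < v i" "v j' \<le> j"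
        using corner_range[OF v p(2)] dyck_path_elem[OF d p(1)] p(2) by (auto simp: corner_def)
      have "v m \<le> j" if "src d < m" "m \<le> j" for m using j(1) that by (simp add: Q_def)
      then have i: "i = src d" using r by (metis le_neq_implies_less not_less)
      have "v m \<le> j'" if m: "src d < m" "m \<le> j'" for m
      proof (cases "m \<le> j")
        case True
        then have "v m \<le> j" using j(1) m by (auto simp: Q_def)
        then show ?thesis using r by simp
      next
        case False
        show ?thesis by (rule key) (use False r m in auto)
      qed
      then have "Q j'" using p i r j(1) by (auto simp: Q_def)
      then show False using j(2) r by fastforce
    qed
    then show "(src d, snk d) \<in> set d" "perm_point n a v (src d, snk d) \<noteq> 0"
      using j(1) perm_point_nonzero_iff[OF v a] by (auto simp: Q_def)
  qed
next
  assume hv: "hook_vertex n a (perm_point n a v)"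
  show "uncrossed v"
    unfolding uncrossed_def
  proof
    assume "\<exists>m j. v j < m \<and> m < j \<and> j < v m"
    then obtain m j where mj: "v j < m" "m < j" "j < v m" by blast
    have "j \<in> {1..n}" "m \<in> {1..n}"
      using v mj by (metis permutes_not_in less_trans less_irrefl)+
    then have r: "1 \<le> v j" "j \<le> n" "1 \<le> m" "m \<le> n" "j < n"
      using v_range[OF v, of j] v_range[OF v, of m] mj by auto
    \<comment> \<open>For this \<open>k\<close>, \<open>j\<close> is inside and \<open>m\<close>
      outside, and \<open>outs_ins\<close> at \<open>c = m\<close> gives \<open>m\<close> a larger
      rank than \<open>j\<close>; hence the partner of \<open>j\<close> lies strictly above row
      \<open>m\<close>. Below, the level \<open>j\<close> plays the same role for the partner of
      \<open>m\<close>.\<close>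
    define k where "k = m - 1"
    have k: "v j \<le> k" "k < v m" "k \<le> n" "m = Suc k" using mj r by (auto simp: k_def)
    have "outs v k m = ins n v k (Suc m) + 1" using outs_ins[OF v, of k m] k r by simp
    moreover have "ins n v k j \<le> ins n v k (Suc m)" using mj by (intro ins_antimono) simp
    ultimately have o1: "ins n v k j < outs v k m" by simp
    have "1 \<le> ins n v k j" using ins_pos r k by blast
    then obtain i where i: "1 \<le> i" "i \<le> m" "k < v i" "outs v k i = ins n v k j"
      using outs_attained[of "ins n v k j" v k m] o1 by auto
    then have "i < m" using o1 by (cases "i = m") auto
    have c1: "corner n v k (i, j)" using i \<open>i < m\<close> mj r k by (auto simp: corner_def)
    have "outs v j (j - 1) + j = ins n v j (Suc (j - 1)) + (j - 1)"
      by (rule outs_ins[OF v]) (use r in auto)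
    moreover have "outs v j m \<le> outs v j (j - 1)" using mj by (intro outs_mono) simp
    ultimately have o2: "outs v j m < ins n v j j" using mj by simp
    have "1 \<le> outs v j m" using outs_pos r mj by blast
    then obtain l where l: "j \<le> l" "l \<le> n" "v l \<le> j" "ins n v j l = outs v j m"
      using ins_attained[of "outs v j m" n v j j] o2 by auto
    then have "j < l" using o2 by (cases "j = l") auto
    have c2: "corner n v j (m, l)" using l \<open>j < l\<close> mj r by (auto simp: corner_def)
    have t: "tight n a (perm_point n a v) (hook i j)" "tight n a (perm_point n a v) (hook m l)"
      using perm_point_hook_tight[OF v a] c1 c2 by auto
    have h: "(m, j) \<in> set (hook i j)" "(m, j) \<in> set (hook m l)"
      using \<open>i < m\<close> \<open>j < l\<close> mj by (auto simp: set_hook)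
    obtain p s p' s' where ps: "hook i j = p @ (m, j) # s" "hook m l = p' @ (m, j) # s'"
      using h by (meson split_list)
    let ?d = "p @ (m, j) # s'"
    have td: "tight n a (perm_point n a v) ?d"
      using tight_swap[OF perm_point_FFLV[OF v a]] t ps by metis
    have "src ?d = src (hook i j)" "snk ?d = snk (hook m l)"
      unfolding ps by (simp_all add: src_def snk_def hd_append)
    then have "src ?d = i" "snk ?d = l"
      using dyck_path_hook[of i j n] dyck_path_hook[of m l n] i r \<open>i < m\<close> \<open>j < l\<close> mj l by auto
    then have "(i, l) \<in> set ?d" using hv td unfolding hook_vertex_def by metis
    moreover have "set p \<subseteq> set (hook i j)" "set ((m, j) # s') \<subseteq> set (hook m l)" unfolding ps by auto
    ultimately have "(i, l) \<in> set (hook i j) \<or> (i, l) \<in> set (hook m l)" by auto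
    then show False using \<open>i < m\<close> \<open>j < l\<close> by (auto simp: set_hook)
  qed
qed

section \<open>Simple vertices have extremal weight\<close>

lemma sum_idx_row:
  fixes x :: "nat \<times> nat \<Rightarrow> real"
  assumes "1 \<le> m"
  shows "(\<Sum>p\<in>idx n. x p * of_bool (fst p = m)) = (\<Sum>k=Suc m..<Suc n. x (m, k))"
proof -
  have "(\<Sum>p\<in>idx n. x p * of_bool (fst p = m)) = (\<Sum>p\<in>Pair m ` {Suc m..<Suc n}. x p)"
    using assms by (intro sum.mono_neutral_cong_right) auto
  also have "\<dots> = (\<Sum>k=Suc m..<Suc n. x (m, k))"
    by (subst sum.reindex) (auto simp: inj_on_def)
  finally show ?thesis .
qed

lemma sum_idx_column:
  fixes x :: "nat \<times> nat \<Rightarrow> real"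
  assumes "m \<le> n"
  shows "(\<Sum>p\<in>idx n. x p * of_bool (snd p = m)) = (\<Sum>k=1..<m. x (k, m))"
proof -
  have "(\<Sum>p\<in>idx n. x p * of_bool (snd p = m)) = (\<Sum>p\<in>(\<lambda>k. (k, m)) ` {1..<m}. x p)"
    using assms by (intro sum.mono_neutral_cong_right) auto
  also have "\<dots> = (\<Sum>k=1..<m. x (k, m))"
    by (subst sum.reindex) (auto simp: inj_on_def)
  finally show ?thesis .
qed

lemma sum_extend:
  fixes f :: "nat \<Rightarrow> real"
  assumes "i \<le> j" "j \<le> k" "\<And>l. j \<le> l \<Longrightarrow> l < k \<Longrightarrow> f l = 0"
  shows "(\<Sum>l=i..<k. f l) = (\<Sum>l=i..<j. f l)"
proof -
  have "(\<Sum>l=i..<k. f l) = (\<Sum>l=i..<j. f l) + (\<Sum>l=j..<k. f l)"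
    using assms by (intro sum.atLeastLessThan_concat[symmetric]) auto
  moreover have "(\<Sum>l=j..<k. f l) = 0" by (rule sum.neutral) (use assms in auto)
  ultimately show ?thesis by simp
qed

lemma sum_extend_left:
  fixes f :: "nat \<Rightarrow> real"
  assumes "i \<le> j" "j \<le> k" "\<And>l. i \<le> l \<Longrightarrow> l < j \<Longrightarrow> f l = 0"
  shows "(\<Sum>l=i..<k. f l) = (\<Sum>l=j..<k. f l)"
proof -
  have "(\<Sum>l=i..<k. f l) = (\<Sum>l=i..<j. f l) + (\<Sum>l=j..<k. f l)"
    using assms by (intro sum.atLeastLessThan_concat[symmetric]) auto
  moreover have "(\<Sum>l=i..<j. f l) = 0" by (rule sum.neutral) (use assms in auto)
  ultimately show ?thesis by simp
qed

context
  fixes n :: nat and a :: "nat \<Rightarrow> nat" and x :: "nat \<times> nat \<Rightarrow> real"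
  assumes a: "\<forall>i\<in>{1..n - 1}. 0 < a i" and x: "x \<in> FFLV n a" and hv: "hook_vertex n a x"
begin

definition supp :: "nat \<Rightarrow> nat \<Rightarrow> bool" where
  "supp i j \<longleftrightarrow> (i, j) \<in> idx n \<and> x (i, j) \<noteq> 0"

definition rowsum :: "nat \<Rightarrow> nat \<Rightarrow> real" where "rowsum i j = (\<Sum>k=Suc i..<Suc j. x (i, k))"
definition colsum :: "nat \<Rightarrow> nat \<Rightarrow> real" where "colsum i j = (\<Sum>k=i..<j. x (k, j))"

lemma not_supp: "\<not> supp i j \<Longrightarrow> x (i, j) = 0"
  using x by (auto simp: supp_def FFLV_iff U_space_def)

lemma supp_hook:
  assumes "supp i j"
  shows "tight n a x (hook i j)" "rowsum i j + colsum (Suc i) j = lam n a i - lam n a j"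
proof -
  have ij: "1 \<le> i" "i < j" "j \<le> n" using assms by (auto simp: supp_def)
  show t: "tight n a x (hook i j)" using assms hv unfolding supp_def hook_vertex_def by blast
  have "{i<..j} = {Suc i..<Suc j}" "{i<..<j} = {Suc i..<j}" by auto
  then show "rowsum i j + colsum (Suc i) j = lam n a i - lam n a j"
    using t dyck_path_hook[OF ij] by (simp add: tight_def sum_hook rowsum_def colsum_def)
qed

text \<open>The hooks at \<open>(i, m)\<close> and \<open>(m, j)\<close> are joined by
  \<open>(m - 1, m + 1)\<close> to a Dyck path from \<open>i\<close> to \<open>j\<close>. The two
  tight bounds already add up to its bound, so it is tight with value 0 at the joint; but it does
  not contain \<open>(i, j)\<close>.\<close>

lemma supp_row_column: "supp m j \<Longrightarrow> supp i m \<Longrightarrow> False"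
proof -
  assume mj: "supp m j" and im: "supp i m"
  have r: "1 \<le> i" "i < m" "m < j" "j \<le> n" "m \<le> n" using mj im by (auto simp: supp_def)
  note h1 = dyck_path_hook[of i m n] and h2 = dyck_path_hook[of m j n]
  let ?q = "(m - 1, m + 1)" and ?d = "hook i m @ (m - 1, m + 1) # hook m j"
  have dy: "dyck_path n (hook i m)" "dyck_path n (hook m j)" using h1 h2 r by auto
  have e: "hd (hook m j) = (m, m + 1)" "last (hook i m) = (m - 1, m)" "hd (hook i m) = (i, i + 1)"
      "last (hook m j) = (j - 1, j)"
    using dyck_path_ends(4,5)[OF dy(1)] dyck_path_ends(4,5)[OF dy(2)] h1 h2 r by auto
  have ne: "hook i m \<noteq> []" "hook m j \<noteq> []" using dy by (auto simp: dyck_path_iff)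
  have d: "dyck_path n ?d"
    using dy e ne r by (auto simp: dyck_path_iff successively_append_iff successively_Cons
        lstep_def)
  have sd: "src ?d = i" "snk ?d = j" using ne e by (simp_all add: src_def snk_def)
  have dis: "distinct ?d" using d lattice_path_distinct unfolding dyck_path_iff by blast
  have "sum x (set ?d) = sum x (set (hook i m)) + (x ?q + sum x (set (hook m j)))"
    using sum_set_append[OF dis, of x] dis by simp
  moreover have "sum x (set (hook i m)) = lam n a i - lam n a m" "sum x (set (hook m j)) = lam n a m
      - lam n a j"
    using supp_hook(1)[OF im] supp_hook(1)[OF mj] h1 h2 r by (auto simp: tight_def)
  moreover have "sum x (set ?d) \<le> lam n a i - lam n a j" using x d sd by (auto simp: FFLV_iff)
  moreover have "?q \<in> idx n" using r by auto
  then have "0 \<le> x ?q" using x unfolding FFLV_iff by blast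
  ultimately have q0: "x ?q = 0" and t: "tight n a x ?d" using d sd by (auto simp: tight_def)
  have "(i, j) \<in> set ?d" "x (i, j) \<noteq> 0" using hv t sd unfolding hook_vertex_def by metis+
  then have "(i, j) \<in> set (hook i m) \<union> set (hook m j)" using q0 by auto
  then show False using r by (auto simp: set_hook)
qed

lemma mu_eq: "m \<in> {1..n} \<Longrightarrow> mu n a x m = lam n a m - rowsum m n + colsum 1 m"
  unfolding mu_def rowsum_def colsum_def
  by (simp only: sum_idx_row sum_idx_column atLeastAtMost_iff)

lemma rowsum_0: "\<not> (\<exists>j. supp m j) \<Longrightarrow> rowsum m j = 0"
  unfolding rowsum_def by (rule sum.neutral) (use not_supp in blast)

lemma colsum_0: "\<not> (\<exists>i. supp i m) \<Longrightarrow> colsum i m = 0"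
  unfolding colsum_def by (rule sum.neutral) (use not_supp in blast)

text \<open>One move of a walk that carries the value \<open>lam n a k\<close>. If row
  \<open>i\<close> has a next support point \<open>(i, j')\<close>, subtracting the partial row sum
  from its hook equation leaves a statement about column \<open>j'\<close>, which \<open>C\<close>
  takes over. If there is none, the row is complete, and as column \<open>i\<close> is zero the
  coordinate at \<open>i\<close> is the value sought.\<close>

lemma attained_from_row:
  assumes s: "supp i j" and R: "rowsum i j = lam n a i - lam n a k"
    and C: "\<And>j'. supp i j' \<Longrightarrow> colsum i j' = lam n a k - lam n a j' \<Longrightarrow> \<exists>m\<in>{1..n}. mu n a x m = lam n a
        k"
  shows "\<exists>m\<in>{1..n}. mu n a x m = lam n a k"
proof (cases "\<exists>j'>j. supp i j'")
  case True
  define j' where "j' = (LEAST j'. j < j' \<and> supp i j')"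
  have j': "j < j'" "supp i j'" using LeastI_ex[OF True] by (auto simp: j'_def)
  have no: "\<not> supp i l" if "j < l" "l < j'" for l using not_less_Least[of l] that by (auto simp:
      j'_def)
  have ij: "i < j" "i < j'" using s j' by (auto simp: supp_def)
  have "rowsum i j' = (\<Sum>l=Suc i..<j'. x (i, l)) + x (i, j')"
    using ij unfolding rowsum_def by simp
  also have "(\<Sum>l=Suc i..<j'. x (i, l)) = rowsum i j"
    unfolding rowsum_def by (rule sum_extend) (use ij j' no not_supp in auto)
  finally have "rowsum i j' = rowsum i j + x (i, j')" .
  moreover have "colsum i j' = x (i, j') + colsum (Suc i) j'"
    unfolding colsum_def using ij by (intro sum.atLeast_Suc_lessThan) simp
  ultimately have "colsum i j' = lam n a k - lam n a j'"
    using supp_hook(2)[OF j'(2)] R by simp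
  then show ?thesis using C j' by blast
next
  case False
  have i: "i \<in> {1..n}" "j \<le> n" "i < j" using s by (auto simp: supp_def)
  have "rowsum i n = rowsum i j"
    unfolding rowsum_def by (rule sum_extend) (use i False not_supp in auto)
  moreover have "colsum 1 i = 0" by (rule colsum_0) (use s supp_row_column in blast)
  ultimately show ?thesis using mu_eq[OF i(1)] R i(1) by (intro bexI[of _ i]) auto
qed

text \<open>The other move: the hook equation at the next support point above turns the column
  statement into a row statement. The row index drops, so the walk ends; with no such point the
  coordinate at \<open>j\<close> is the value sought.\<close>

lemma attained_from_column:
  "supp i j \<Longrightarrow> colsum i j = lam n a k - lam n a j \<Longrightarrow> \<exists>m\<in>{1..n}. mu n a x m = lam n a k"
proof (induction i arbitrary: j rule: less_induct)
  case (less i)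
  have ij: "1 \<le> i" "i < j" "j \<in> {1..n}" using less.prems(1) by (auto simp: supp_def)
  show ?case
  proof (cases "\<exists>i'<i. supp i' j")
    case True
    define i' where "i' = (GREATEST i'. i' < i \<and> supp i' j)"
    have i': "i' < i \<and> supp i' j"
      unfolding i'_def by (rule GreatestI_ex_nat[where b = i]) (use True in auto)
    have no: "\<not> supp l j" if "i' < l" "l < i" for l
      using Greatest_le_nat[of "\<lambda>i'. i' < i \<and> supp i' j" l i] that by (auto simp: i'_def)
    have "colsum (Suc i') j = colsum i j"
      unfolding colsum_def by (rule sum_extend_left) (use i' ij no not_supp in auto)
    then have R: "rowsum i' j = lam n a i' - lam n a k"
      using supp_hook(2)[of i' j] i' less.prems(2) by simp
    show ?thesis
      by (rule attained_from_row[OF _ R]) (use i' less.IH in auto)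
  next
    case False
    have "colsum 1 j = colsum i j"
      unfolding colsum_def by (rule sum_extend_left) (use ij False not_supp in auto)
    moreover have "rowsum j n = 0" by (rule rowsum_0) (use less.prems(1) supp_row_column in blast)
    ultimately show ?thesis using mu_eq[OF ij(3)] less.prems(2) ij(3) by (intro bexI[of _ j]) auto
  qed
qed

text \<open>The walk starts in column \<open>k\<close> at the support point nearest to the diagonal,
  or in row \<open>k\<close> at the first support point, where the remaining part of the hook sum is
  0. If both are empty, coordinate \<open>k\<close> is unchanged.\<close>

lemma lam_attained:
  assumes k: "k \<in> {1..n}"
  shows "\<exists>m\<in>{1..n}. mu n a x m = lam n a k"
proof -
  consider (col) "\<exists>i. supp i k" | (row) "\<exists>j. supp k j" | (none) "\<not> (\<exists>i. supp i k)" "\<not> (\<exists>j. supp k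
      j)" by blast
  then show ?thesis
  proof cases
    case col
    define i where "i = (GREATEST i. supp i k)"
    have b: "i \<le> k" if "supp i k" for i using that by (auto simp: supp_def)
    have i: "supp i k" unfolding i_def by (rule GreatestI_ex_nat[where b = k]) (use col b in auto)
    have no: "\<not> supp l k" if "i < l" for l
      using Greatest_le_nat[of "\<lambda>i. supp i k" l k] b that by (auto simp: i_def)
    have "colsum (Suc i) k = 0"
      unfolding colsum_def by (rule sum.neutral) (use no not_supp in auto)
    then have "rowsum i k = lam n a i - lam n a k" using supp_hook(2)[OF i] by simp
    then show ?thesis using attained_from_row[OF i] attained_from_column by blast
  next
    case row
    define j where "j = (LEAST j. supp k j)"
    have j: "supp k j" unfolding j_def using row by (rule LeastI_ex)
    have no: "\<not> supp k l" if "l < j" for l using not_less_Least[of l] that by (auto simp: j_def)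
    have kj: "k < j" using j by (auto simp: supp_def)
    have "rowsum k j = (\<Sum>l=Suc k..<j. x (k, l)) + x (k, j)" using kj unfolding rowsum_def by simp
    also have "(\<Sum>l=Suc k..<j. x (k, l)) = 0" by (rule sum.neutral) (use no not_supp in auto)
    finally have "rowsum k j = x (k, j)" by simp
    moreover have "colsum k j = x (k, j) + colsum (Suc k) j"
      unfolding colsum_def using kj by (intro sum.atLeast_Suc_lessThan) simp
    ultimately have "colsum k j = lam n a k - lam n a j" using supp_hook(2)[OF j] by simp
    then show ?thesis using attained_from_column[OF j] by blast
  next
    case none
    then show ?thesis using mu_eq[OF k] rowsum_0[of k] colsum_0[of k] k by (intro bexI[of _ k]) auto
  qed
qed

text \<open>Since \<open>lam\<close> is strictly decreasing, distinct values are attained at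
  distinct places, so the places form a permutation.\<close>

lemma hook_vertex_imp_perm_point: "\<exists>w. w permutes {1..n} \<and> x = perm_point n a (inv w)"
proof -
  obtain f where f: "\<And>k. k \<in> {1..n} \<Longrightarrow> f k \<in> {1..n}" "\<And>k. k \<in> {1..n} \<Longrightarrow> mu n a x (f k) = lam n a k"
    using lam_attained by metis
  have "inj_on f {1..n}"
  proof (rule inj_onI)
    fix k l assume kl: "k \<in> {1..n}" "l \<in> {1..n}" "f k = f l"
    then have "lam n a k = lam n a l" using f(2) by metis
    then show "k = l"
      using lam_less[OF a, of k l] lam_less[OF a, of l k] kl by (cases k l rule: linorder_cases)
          auto
  qed
  moreover have "f ` {1..n} \<subseteq> {1..n}" using f(1) by blast
  ultimately have bij: "bij_betw f {1..n} {1..n}"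
    by (simp add: bij_betw_def endo_inj_surj)
  define w where "w k = (if k \<in> {1..n} then f k else k)" for k
  have "bij_betw w {1..n} {1..n}"
    using bij by (rule bij_betw_cong[THEN iffD1, rotated]) (simp add: w_def)
  then have w: "w permutes {1..n}" by (rule bij_imp_permutes) (simp only: w_def if_False)
  have "mu n a x m = lam n a (inv w m)" if "m \<in> {1..n}" for m
  proof -
    have "inv w m \<in> {1..n}" using permutes_in_image[OF permutes_inv[OF w]] that by blast
    then have "mu n a x (w (inv w m)) = lam n a (inv w m)" using f(2) by (simp add: w_def)
    then show ?thesis using permutes_inverses(1)[OF w] by simp
  qed
  then have "x = perm_point n a (inv w)" by (rule perm_point_unique[OF permutes_inv[OF w] a x])
  then show ?thesis using w by blast
qed

end

section \<open>Counting uncrossed permutations\<close>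

definition uncrossed_perms :: "nat set \<Rightarrow> (nat \<Rightarrow> nat) set" where
  "uncrossed_perms S = {v. v permutes S \<and> uncrossed v}"

text \<open>Builds a permutation with maximum \<open>M\<close> at position \<open>m\<close>. In
  \<open>A\<close> position \<open>m\<close> stands for position \<open>M\<close>, and the value
  \<open>m\<close> is a placeholder for the one value in {m..<M} taken outside the positions
  strictly between \<open>m\<close> and \<open>M\<close>; \<open>B\<close> tells this value at
  \<open>m\<close> and the values at those positions.\<close>

definition glue :: "nat \<Rightarrow> nat \<Rightarrow> (nat \<Rightarrow> nat) \<times> (nat \<Rightarrow> nat) \<Rightarrow> nat \<Rightarrow> nat" where
  "glue m M = (\<lambda>(A, B). B \<circ> A \<circ> Transposition.transpose m M)"

lemma permutes_nat_cases:
  assumes "p permutes {l..<r::nat}"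
  shows "i < l \<Longrightarrow> p i = i" "r \<le> i \<Longrightarrow> p i = i" "l \<le> i \<Longrightarrow> i < r \<Longrightarrow> l \<le> p i \<and> p i < r"
  using assms permutes_not_in[OF assms, of i] permutes_in_image[OF assms, of i] by auto

context
  fixes l m M :: nat and A B :: "nat \<Rightarrow> nat"
  assumes lm: "l \<le> m" "m < M" and A: "A permutes {l..<Suc m}" and B: "B permutes {m..<M}"
begin

lemma glue_permutes: "glue m M (A, B) permutes {l..<Suc M}"
proof -
  have "A permutes {l..<Suc M}" "B permutes {l..<Suc M}"
    using A B lm by (auto elim: permutes_subset)
  moreover have "Transposition.transpose m M permutes {l..<Suc M}"
    using lm by (intro permutes_swap_id) auto
  ultimately show ?thesis by (auto simp: glue_def intro: permutes_compose)
qed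

lemma glue_apply:
  shows "glue m M (A, B) m = M"
    and "i < m \<Longrightarrow> A i < m \<Longrightarrow> glue m M (A, B) i = A i"
    and "i < m \<Longrightarrow> A i = m \<Longrightarrow> m \<le> glue m M (A, B) i"
    and "m < i \<Longrightarrow> i < M \<Longrightarrow> glue m M (A, B) i = B i"
proof -
  show "glue m M (A, B) m = M"
    using lm permutes_nat_cases(2)[OF A, of M] permutes_nat_cases(2)[OF B, of M] by (simp add:
        glue_def)
  show "glue m M (A, B) i = A i" if "i < m" "A i < m"
    using lm that permutes_nat_cases(1)[OF B, of "A i"] by (simp add: glue_def
        Transposition.transpose_def)
  show "m \<le> glue m M (A, B) i" if "i < m" "A i = m"
    using lm that permutes_nat_cases(3)[OF B, of m] by (simp add: glue_def
        Transposition.transpose_def)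
  show "glue m M (A, B) i = B i" if "m < i" "i < M"
    using lm that permutes_nat_cases(2)[OF A, of i] by (simp add: glue_def
        Transposition.transpose_def)
qed

text \<open>A crossing \<open>k < j\<close> lies on one side of \<open>m\<close>. For
  \<open>j < m\<close> it is seen by \<open>A\<close>, where a placeholder at \<open>k\<close>
  exceeds \<open>j\<close> just as the value it stands for. For \<open>m < j\<close> the value at
  \<open>j\<close> is at least \<open>m\<close>, so \<open>m < k\<close> and \<open>B\<close> sees
  it.\<close>

lemma glue_uncrossed_iff: "uncrossed (glue m M (A, B)) \<longleftrightarrow> uncrossed A \<and> uncrossed B"
proof -
  let ?v = "glue m M (A, B)"
  note ga = glue_apply
  have Ale: "A i \<le> m" if "i < m" for i
    using permutes_nat_cases(1,3)[OF A, of i] that by (cases "i < l") auto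
  have Bge: "m \<le> B i" if "m \<le> i" for i
    using permutes_nat_cases(2,3)[OF B, of i] that by (cases "i < M") auto
  have 1: "uncrossed ?v" if u: "uncrossed A" "uncrossed B"
    unfolding uncrossed_def
  proof
    assume "\<exists>k j. ?v j < k \<and> k < j \<and> j < ?v k"
    then obtain k j where c: "?v j < k" "k < j" "j < ?v k" by blast
    have "j < M"
    proof (rule ccontr)
      assume "\<not> j < M"
      then have "M < ?v k" using c by simp
      moreover have "?v k \<le> M" if "k < Suc M"
        using permutes_nat_cases(1,3)[OF glue_permutes, of k] that by (cases "k < l") auto
      moreover have "?v k = k" if "Suc M \<le> k"
        using permutes_nat_cases(2)[OF glue_permutes that] .
      moreover have "?v j = j" if "Suc M \<le> j"
        using permutes_nat_cases(2)[OF glue_permutes that] .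
      ultimately show False using c by (cases "k < Suc M"; simp)
    qed
    moreover have "j \<noteq> m" using c ga(1) \<open>j < M\<close> by auto
    ultimately consider "j < m" | "m < j" "j < M" by linarith
    then show False
    proof cases
      case 1
      have "A j \<noteq> m" using c 1 ga(3)[of j] by auto
      then have "?v j = A j" using ga(2)[of j] Ale[of j] 1 by simp
      moreover have "j < A k"
        using ga(2)[of k] Ale[of k] c 1 by (cases "A k = m") auto
      ultimately show False using u(1) c unfolding uncrossed_def by metis
    next
      case 2
      then have vj: "?v j = B j" by (rule ga(4))
      then have "m < k" using Bge[of j] c 2 by simp
      then have "?v k = B k" using c 2 by (intro ga(4)) auto
      then show False using u(2) c vj unfolding uncrossed_def by metis
    qed
  qed
  moreover have 2: "uncrossed A" if u: "uncrossed ?v"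
    unfolding uncrossed_def
  proof
    assume "\<exists>k j. A j < k \<and> k < j \<and> j < A k"
    then obtain k j where c: "A j < k" "k < j" "j < A k" by blast
    have "k < m"
    proof (rule ccontr)
      assume "\<not> k < m"
      moreover have "A m \<le> m" using permutes_nat_cases(3)[OF A, of m] lm by auto
      moreover have "A k = k" if "m < k" using permutes_nat_cases(2)[OF A, of k] that by simp
      ultimately show False using c by (cases "k = m") auto
    qed
    then have j: "j < m" using Ale[of k] c by simp
    have "?v j = A j" using j c by (intro ga(2)) auto
    moreover have "j < ?v k"
      using ga(2)[of k] ga(3)[of k] Ale[of k] \<open>k < m\<close> c j by (cases "A k = m") auto
    ultimately show False using u c unfolding uncrossed_def by metis
  qed
  moreover have 3: "uncrossed B" if u: "uncrossed ?v"
    unfolding uncrossed_def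
  proof
    assume "\<exists>k j. B j < k \<and> k < j \<and> j < B k"
    then obtain k j where c: "B j < k" "k < j" "j < B k" by blast
    have "j < M" using permutes_nat_cases(2)[OF B, of j] c by fastforce
    have "m \<le> j" using permutes_nat_cases(1)[OF B, of j] c by fastforce
    then have "m < k" using Bge[of j] c by simp
    then have "?v j = B j" "?v k = B k" using c \<open>j < M\<close> by (auto intro!: ga(4))
    then show False using u c unfolding uncrossed_def by metis
  qed
  ultimately show ?thesis by blast
qed

end

text \<open>The permutation comparing \<open>B\<close> with \<open>B'\<close> also compares
  \<open>A'\<close> with \<open>A\<close>. It is supported on both intervals, which share only
  \<open>m\<close>, so it is the identity.\<close>

lemma glue_inj:
  assumes lm: "l \<le> m" "m < M"
  shows "inj_on (glue m M) (uncrossed_perms {l..<Suc m} \<times> uncrossed_perms {m..<M})"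
proof (rule inj_onI, clarsimp simp: uncrossed_perms_def)
  fix A B A' B'
  assume A: "A permutes {l..<Suc m}" and B: "B permutes {m..<M}"
    and A': "A' permutes {l..<Suc m}" and B': "B' permutes {m..<M}"
    and eq: "glue m M (A, B) = glue m M (A', B')"
  have BA: "B (A i) = B' (A' i)" for i
    using fun_cong[OF eq, of "Transposition.transpose m M i"] by (simp add: glue_def)
  define g where "g = inv B' \<circ> B"
  have g1: "g permutes {m..<M}" unfolding g_def by (intro permutes_compose B permutes_inv B')
  have "g i = A' (inv A i)" for i
    using BA[of "inv A i"] by (simp add: g_def permutes_inverses[OF A] permutes_inverses[OF B'])
  then have "g = A' \<circ> inv A" by (simp add: fun_eq_iff)
  then have g2: "g permutes {l..<Suc m}" by (simp add: permutes_compose A' permutes_inv A)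
  have "g permutes {m}"
    by (rule permutes_superset[OF g1]) (use permutes_not_in[OF g2] in auto)
  then have "g = id" by simp
  then have "inv B' (B i) = i" for i by (simp add: g_def fun_eq_iff)
  then have "B = B'" using permutes_inverses(1)[OF B'] by (metis ext)
  then have "A i = A' i" for i using BA[of i] inj_eq[OF permutes_inj[OF B]] by simp
  then show "A = A' \<and> B = B'" using \<open>B = B'\<close> by (simp add: fun_eq_iff)
qed

lemma glue_surj:
  assumes lm: "l \<le> m" "m < M" and v: "v permutes {l..<Suc M}" "uncrossed v" "v m = M"
  shows "v \<in> glue m M ` (uncrossed_perms {l..<Suc m} \<times> uncrossed_perms {m..<M})"
proof -
  define u where "u = v \<circ> Transposition.transpose m M"
  have "u permutes {l..<Suc M}"
    unfolding u_def using lm by (intro permutes_compose v permutes_swap_id) auto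
  moreover have "u M = M" using v(3) by (simp add: u_def)
  then have "u i = i" if "i \<in> {l..<Suc M} - {l..<M}" for i
    using that by (cases "i = M") auto
  ultimately have up: "u permutes {l..<M}" by (rule permutes_superset)
  have ui: "u i = v i" if "m < i" "i < M" for i using that by (simp add: u_def
      Transposition.transpose_def)
  have um: "m \<le> u i" "u i < M" if "m < i" "i < M" for i
  proof -
    show "m \<le> u i"
    proof (rule ccontr)
      assume "\<not> m \<le> u i"
      then have "v i < m" "m < i" "i < v m" using that ui v(3) by auto
      then show False using v(2) unfolding uncrossed_def by blast
    qed
    show "u i < M" using permutes_nat_cases(3)[OF up, of i] that lm by simp
  qed
  have "card (u ` {m<..<M}) \<le> card {m<..<M}" by (rule card_image_le) simp
  also have "\<dots> < card {m..<M}" using lm by simp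
  finally have "\<not> {m..<M} \<subseteq> u ` {m<..<M}"
    using card_mono[of "u ` {m<..<M}" "{m..<M}"] by auto
  \<comment> \<open>There is one position fewer than values, because uncrossedness with
    \<open>v m = M\<close> keeps the values right of \<open>m\<close> at or above \<open>m\<close>.
    The value left over becomes the image of \<open>m\<close> under \<open>B\<close>.\<close>
  then obtain c where c: "c \<in> {m..<M}" "c \<notin> u ` {m<..<M}" by blast
  define B where "B i = (if i = m then c else if m < i \<and> i < M then u i else i)" for i
  have injB: "inj_on B {m..<M}"
  proof (rule inj_onI)
    fix i j assume ij: "i \<in> {m..<M}" "j \<in> {m..<M}" "B i = B j"
    have uu: "u i = u j \<longleftrightarrow> i = j" using inj_eq[OF permutes_inj[OF up]] .
    show "i = j"
    proof (cases "i = m"; cases "j = m")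
      assume "i \<noteq> m" "j \<noteq> m"
      then show ?thesis using ij uu by (auto simp: B_def)
    next
      assume *: "i = m" "j \<noteq> m"
      then have "c = u j" using ij by (auto simp: B_def)
      then show ?thesis using c(2) * ij by auto
    next
      assume *: "i \<noteq> m" "j = m"
      then have "c = u i" using ij by (auto simp: B_def)
      then show ?thesis using c(2) * ij by auto
    qed auto
  qed
  moreover have "B ` {m..<M} \<subseteq> {m..<M}" using c um by (auto simp: B_def)
  ultimately have "bij_betw B {m..<M} {m..<M}" by (simp add: bij_betw_def endo_inj_surj)
  then have B: "B permutes {m..<M}" by (rule bij_imp_permutes) (use lm in \<open>auto simp: B_def\<close>)
  define A where "A = inv B \<circ> u"
  have "inv B permutes {l..<M}" using permutes_inv[OF B] lm by (auto elim: permutes_subset)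
  then have "A permutes {l..<M}" unfolding A_def by (intro permutes_compose up)
  moreover have "A i = i" if "i \<in> {l..<M} - {l..<Suc m}" for i
  proof -
    have "u i = B i" using that by (auto simp: B_def)
    then show ?thesis by (simp add: A_def permutes_inverses[OF B])
  qed
  ultimately have A: "A permutes {l..<Suc m}" by (rule permutes_superset)
  have "B \<circ> A = u" by (simp add: A_def fun_eq_iff permutes_inverses[OF B])
  then have eq: "v = glue m M (A, B)"
    unfolding glue_def by (simp add: u_def fun_eq_iff)
  then have "uncrossed A" "uncrossed B" using v(2) glue_uncrossed_iff[OF lm A B] by auto
  then show ?thesis using eq A B unfolding uncrossed_perms_def by blast
qed

lemma uncrossed_perms_last_fixed:
  assumes "l \<le> M"
  shows "{v \<in> uncrossed_perms {l..<Suc M}. v M = M} = uncrossed_perms {l..<M}"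
proof (intro set_eqI iffI)
  fix v assume v: "v \<in> {v \<in> uncrossed_perms {l..<Suc M}. v M = M}"
  have "v permutes {l..<M}"
    by (rule permutes_superset[of v "{l..<Suc M}"]) (use v in \<open>auto simp: uncrossed_perms_def
        less_Suc_eq\<close>)
  then show "v \<in> uncrossed_perms {l..<M}" using v by (simp add: uncrossed_perms_def)
next
  fix v assume "v \<in> uncrossed_perms {l..<M}"
  then have v: "v permutes {l..<M}" "uncrossed v" by (auto simp: uncrossed_perms_def)
  have "v permutes {l..<Suc M}" using v(1) by (rule permutes_subset) auto
  moreover have "v M = M" using permutes_nat_cases(2)[OF v(1)] by simp
  ultimately show "v \<in> {v \<in> uncrossed_perms {l..<Suc M}. v M = M}" using v by (simp add:
      uncrossed_perms_def)
qed

lemma finite_uncrossed_perms: "finite S \<Longrightarrow> finite (uncrossed_perms S)"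
  unfolding uncrossed_perms_def by (rule finite_subset[OF _ finite_permutations]) auto

lemma card_uncrossed_perms: "card (uncrossed_perms {l..<l + Suc N}) = large_schroeder N"
proof (induction N arbitrary: l rule: less_induct)
  case (less N)
  show ?case
  proof (cases N)
    case 0
    have "{l..<l + Suc 0} = {l}" by auto
    then have "uncrossed_perms {l..<l + Suc N} = {id}"
      using 0 by (auto simp: uncrossed_perms_def uncrossed_def)
    then show ?thesis using 0 by simp
  next
    case (Suc K)
    define M where "M = l + Suc K"
    define F where "F m = {v \<in> uncrossed_perms {l..<Suc M}. v m = M}" for m
    have lM: "l \<le> M" by (simp add: M_def)
    have fin: "finite (uncrossed_perms S)" if "finite S" for S using finite_uncrossed_perms that .
    have decomp: "uncrossed_perms {l..<Suc M} = F M \<union> (\<Union>m\<in>{l..<M}. F m)"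
    proof (intro set_eqI iffI)
      fix v assume v: "v \<in> uncrossed_perms {l..<Suc M}"
      then have "M \<in> v ` {l..<Suc M}" using lM permutes_image by (fastforce simp:
          uncrossed_perms_def)
      then obtain m where "m \<in> {l..<Suc M}" "v m = M" by auto
      then show "v \<in> F M \<union> (\<Union>m\<in>{l..<M}. F m)" using v by (cases "m = M") (auto simp: F_def)
    qed (auto simp: F_def)
    have disj: "F m \<inter> F m' = {}" if "m \<noteq> m'" for m m'
    proof -
      have "m = m'" if "v \<in> F m" "v \<in> F m'" for v
        using that inj_eq[OF permutes_inj, of v "{l..<Suc M}" m m'] by (auto simp: F_def
            uncrossed_perms_def)
      then show ?thesis using that by blast
    qed
    have finF: "finite (F m)" for m using fin[of "{l..<Suc M}"] by (simp add: F_def)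
    have "F M \<inter> F m = {}" if "m \<in> {l..<M}" for m by (rule disj) (use that in auto)
    then have "F M \<inter> (\<Union>m\<in>{l..<M}. F m) = {}" by blast
    then have "card (uncrossed_perms {l..<Suc M}) = card (F M) + card (\<Union>m\<in>{l..<M}. F m)"
      unfolding decomp by (intro card_Un_disjoint) (auto simp: finF)
    also have "card (F M) = large_schroeder K"
      using uncrossed_perms_last_fixed[OF lM] less.IH[of K l] Suc by (simp add: F_def M_def)
    also have "card (\<Union>m\<in>{l..<M}. F m) = (\<Sum>m\<in>{l..<M}. card (F m))"
      by (rule card_UN_disjoint) (use disj finF in auto)
    also have "\<dots> = (\<Sum>m\<in>{l..<M}. card (uncrossed_perms {l..<Suc m}) * card (uncrossed_perms
        {m..<M}))"
    proof (rule sum.cong)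
      fix m assume "m \<in> {l..<M}"
      then have m: "l \<le> m" "m < M" by auto
      have "F m = glue m M ` (uncrossed_perms {l..<Suc m} \<times> uncrossed_perms {m..<M})"
      proof (intro set_eqI iffI)
        fix v assume "v \<in> F m"
        then show "v \<in> glue m M ` (uncrossed_perms {l..<Suc m} \<times> uncrossed_perms {m..<M})"
          using glue_surj[OF m] by (auto simp: F_def uncrossed_perms_def)
      next
        fix v assume "v \<in> glue m M ` (uncrossed_perms {l..<Suc m} \<times> uncrossed_perms {m..<M})"
        then obtain A B where v: "v = glue m M (A, B)" and A: "A permutes {l..<Suc m}" "uncrossed A"
          and B: "B permutes {m..<M}" "uncrossed B" by (auto simp: uncrossed_perms_def)
        show "v \<in> F m"
          using glue_permutes[OF m A(1) B(1)] glue_uncrossed_iff[OF m A(1) B(1)] glue_apply(1)[OF m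
              A(1) B(1)] A B v
          by (simp add: F_def uncrossed_perms_def)
      qed
      then show "card (F m) = card (uncrossed_perms {l..<Suc m}) * card (uncrossed_perms {m..<M})"
        using card_image[OF glue_inj[OF m]] by (simp add: card_cartesian_product)
    qed simp
    also have "\<dots> = (\<Sum>k\<le>K. card (uncrossed_perms {l..<Suc (l + k)}) * card (uncrossed_perms {l +
        k..<M}))"
      by (rule sum.reindex_bij_witness[of _ "\<lambda>k. l + k" "\<lambda>m. m - l"]) (auto simp: M_def)
    also have "\<dots> = (\<Sum>k\<le>K. large_schroeder k * large_schroeder (K - k))"
    proof (rule sum.cong)
      fix k assume k: "k \<in> {..K}"
      have "card (uncrossed_perms {l..<Suc (l + k)}) = large_schroeder k"
        using less.IH[of k l] k Suc by simp
      moreover have "M = (l + k) + Suc (K - k)" using k by (simp add: M_def)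
      then have "card (uncrossed_perms {l + k..<M}) = large_schroeder (K - k)"
        using less.IH[of "K - k" "l + k"] Suc by simp
      ultimately show "card (uncrossed_perms {l..<Suc (l + k)}) * card (uncrossed_perms {l + k..<M})
        = large_schroeder k * large_schroeder (K - k)" by simp
    qed simp
    finally show ?thesis using Suc by (simp add: M_def)
  qed
qed

text \<open>The weight determines \<open>lam n a (v m)\<close>, and strict decrease of
  \<open>lam\<close> recovers \<open>v m\<close>.\<close>

lemma perm_point_inj:
  assumes a: "\<forall>i\<in>{1..n - 1}. 0 < a i"
  shows "inj_on (perm_point n a) {v. v permutes {1..n}}"
proof (rule inj_onI)
  fix u v assume "u \<in> {v. v permutes {1..n}}" "v \<in> {v. v permutes {1..n}}"
    and eq: "perm_point n a u = perm_point n a v"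
  then have u: "u permutes {1..n}" and v: "v permutes {1..n}" by auto
  show "u = v"
  proof
    fix m
    show "u m = v m"
    proof (cases "m \<in> {1..n}")
      case True
      have "lam n a (u m) = lam n a (v m)"
        using mu_perm_point[OF u True, of a] mu_perm_point[OF v True, of a] eq by simp
      then show ?thesis
        using lam_less[OF a, of "u m" "v m"] lam_less[OF a, of "v m" "u m"] v_range[OF u True]
            v_range[OF v True]
        by (cases "u m" "v m" rule: linorder_cases) auto
    next
      case False
      then show ?thesis using permutes_not_in[OF u] permutes_not_in[OF v] by simp
    qed
  qed
qed

lemma simple_perm_point_iff:
  assumes "\<forall>i\<in>{1..n - 1}. 0 < a i" "v permutes {1..n}"
  shows "simple_vertex n (FFLV n a) (perm_point n a v) \<longleftrightarrow> uncrossed v"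
  using simple_vertex_iff[OF assms(1)] perm_point_hook_vertex_iff[OF assms(2,1)] perm_point_FFLV[OF
      assms(2,1)]
  by blast

lemma simple_vertices_FFLV:
  assumes a: "\<forall>i\<in>{1..n - 1}. 0 < a i"
  shows "{x. simple_vertex n (FFLV n a) x} = perm_point n a ` uncrossed_perms {1..n}"
proof (intro set_eqI iffI)
  fix x assume "x \<in> {x. simple_vertex n (FFLV n a) x}"
  then have s: "simple_vertex n (FFLV n a) x" by simp
  then obtain w where w: "w permutes {1..n}" "x = perm_point n a (inv w)"
    using simple_vertex_iff[OF a] hook_vertex_imp_perm_point[OF a] by blast
  then show "x \<in> perm_point n a ` uncrossed_perms {1..n}"
    using s simple_perm_point_iff[OF a permutes_inv[OF w(1)]] permutes_inv[OF w(1)]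
    unfolding uncrossed_perms_def by blast
next
  fix x assume "x \<in> perm_point n a ` uncrossed_perms {1..n}"
  then show "x \<in> {x. simple_vertex n (FFLV n a) x}"
    using simple_perm_point_iff[OF a] unfolding uncrossed_perms_def by blast
qed

theorem theorem1p5:
  fixes n :: nat and a :: "nat \<Rightarrow> nat"
  assumes "n \<ge> 2"
    and "\<forall>i\<in>{1..n - 1}. 0 < a i"
  shows "(\<forall>w. w permutes {1..n} \<longrightarrow>
            (simple_vertex n (FFLV n a) (perm_vertex n a w) \<longleftrightarrow>
              (\<forall>i j. 1 \<le> i \<and> i < j \<and> j \<le> n \<longrightarrow> inv w j \<le> i \<longrightarrow> inv w (i + 1) \<le> j)))
       \<and> card {v. simple_vertex n (FFLV n a) v} = large_schroeder (n - 1)"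
proof (intro conjI allI impI)
  fix w assume w: "w permutes {1..n}"
  have "perm_vertex n a w = perm_point n a (inv w)"
    by (rule perm_vertex_eq[OF w assms(2)]) (use assms(1) in simp)
  then show "simple_vertex n (FFLV n a) (perm_vertex n a w) \<longleftrightarrow>
      (\<forall>i j. 1 \<le> i \<and> i < j \<and> j \<le> n \<longrightarrow> inv w j \<le> i \<longrightarrow> inv w (i + 1) \<le> j)"
    using simple_perm_point_iff[OF assms(2) permutes_inv[OF w]] uncrossed_iff[OF permutes_inv[OF w]]
        by simp
next
  have "inj_on (perm_point n a) (uncrossed_perms {1..n})"
    by (rule inj_on_subset[OF perm_point_inj[OF assms(2)]]) (auto simp: uncrossed_perms_def)
  moreover have "{1..n} = {1..<1 + Suc (n - 1)}" using assms(1) by auto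
  ultimately show "card {v. simple_vertex n (FFLV n a) v} = large_schroeder (n - 1)"
    unfolding simple_vertices_FFLV[OF assms(2)] using card_image card_uncrossed_perms[of 1 "n - 1"]
        by metis
qed

end
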